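(* For each configuration $\gamma=\sum_{i=1}^\infty\delta_{x_i}\in\Gamma$ and each $n\in\mathbb N$, $$\binom\gamma n=\sum_{\{i_1,\dots,i_n\}\subset\mathbb N}\delta_{x_{i_1}}\odot\delta_{x_{i_2}}\odot\dots\odot\delta_{x_{i_n}},$$ where the sum is over all $n$-element subsets of $\mathbb N$.
   Context: Fix $d\in\mathbb N$. $\mathcal D=C_0^\infty(\mathbb R^d)$ (real-valued), $\mathcal D'$ its dual with pairing extending the $L^2(\mathbb R^d,dx)$ inner product; $\mathcal D$ carries the projective limit topology of the Sobolev spaces $\mathcal H_\tau=W^{l,2}(\mathbb R^d,\varphi(x)dx)$, $\tau=(l,\varphi)$, $l\in\mathbb N_0=\mathbb N\cup\{0\}$, $\varphi\in C^\infty(\mathbb R^d)$, $\varphi\ge1$. $\odot$ is the symmetric tensor product, $f_1\odot\dots\odot f_n=\frac1{n!}\sum_\sigma f_{\sigma(1)}\otimes\dots\otimes f_{\sigma(n)}$. $\mathcal D^{\odot n}$, the projective limit of the $\mathcal H_\tau^{\odot n}$, consists of the symmetric functions in $C_0^\infty((\mathbb R^d)^n)$, and $\mathcal D'^{\odot n}$ is its dual with respect to $L^2(\mathbb R^d,dx)^{\odot n}$. $\delta_x$ is the Dirac measure at $x\in\mathbb R^d$. $\Gamma\subset\mathcal D'$ is the configuration space: the set of Radon measures on $\mathbb R^d$ of the form $\gamma=\sum_{i=1}^\infty\delta_{x_i}$ with $x_i\ne x_j$ for $i\ne j$ (so $\{x_i\}$ is locally finite). The sum in the claim is well defined in $\mathcal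 D'^{\odot n}$: paired with any element of $\mathcal D^{\odot n}$, only finitely many terms are non-zero. The falling factorials on $\mathcal D'$, $(\omega)_n\in\mathcal D'^{\odot n}$, $n\in\mathbb N_0$, $\omega\in\mathcal D'$, are defined as the monic polynomial sequence on $\mathcal D'$ of binomial type with generating function $\sum_{n=0}^\infty\frac1{n!}\langle(\omega)_n,\xi^{\otimes n}\rangle=\exp[\langle\omega,\log(1+\xi)\rangle]$, as formal series in tensor powers of $\xi\in\mathcal D$; that is, $\frac1{n!}\langle(\omega)_n,\xi^{\otimes n}\rangle$ is the coefficient of $t^n$ in the formal power series $\exp\big[\sum_{k\ge1}\frac{(-1)^{k+1}}k t^k\langle\omega,\xi^k\rangle\big]$ for all $\xi\in\mathcal D$ (this determines $(\omega)_n$). One sets $\binom\omega n:=\frac1{n!}(\omega)_n$. *)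

theory Defs
  imports
    "HOL-Probability.Probability"
    "HOL-Computational_Algebra.Formal_Power_Series"
    "HOL-Combinatorics.Permutations"
begin

section \<open>Smooth functions and test functions\<close>

primrec iter_deriv :: "'a list \<Rightarrow> ('a::euclidean_space \<Rightarrow> real) \<Rightarrow> 'a \<Rightarrow> real" where
  "iter_deriv [] f = f"
| "iter_deriv (b # bs) f = (\<lambda>x. frechet_derivative (iter_deriv bs f) (at x) b)"

text \<open>\<open>C\<^sup>\<infinity>\<close>: every iterated partial derivative is again (totally) differentiable everywhere;
  continuity of all of them follows.\<close>

definition smooth :: "('a::euclidean_space \<Rightarrow> real) \<Rightarrow> bool" where
  "smooth f \<longleftrightarrow> (\<forall>bs\<in>lists Basis. \<forall>x. iter_deriv bs f differentiable (at x))"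

definition test_functions :: "('a::euclidean_space \<Rightarrow> real) set" where
  "test_functions = {f. smooth f \<and> compact (closure {x. f x \<noteq> 0})}"

text \<open>The point \<open>(x\<^sub>1, \<dots>, x\<^sub>n)\<close> of \<open>(\<real>\<^sup>d)\<^sup>n\<close> is a vector of type \<open>(real^'d)^'n\<close>, where
  \<open>n = CARD('n)\<close>; thus \<open>n\<close> ranges over the positive integers.\<close>

definition symmetric_function :: "((real^'d)^'n \<Rightarrow> real) \<Rightarrow> bool" where
  "symmetric_function f \<longleftrightarrow>
     (\<forall>\<sigma>. \<sigma> permutes UNIV \<longrightarrow> (\<forall>x. f (\<chi> i. x $ \<sigma> i) = f x))"

definition sym_test_functions :: "((real^'d)^'n \<Rightarrow> real) set" where
  "sym_test_functions = {f \<in> test_functions. symmetric_function f}"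


section \<open>Projective limit topologies\<close>

definition weights :: "('a::euclidean_space \<Rightarrow> real) set" where
  "weights = {\<phi>. smooth \<phi> \<and> (\<forall>x. 1 \<le> \<phi> x)}"

definition weighted_norm ::
  "'a list set \<Rightarrow> ('a::euclidean_space \<Rightarrow> real) \<Rightarrow> ('a \<Rightarrow> real) \<Rightarrow> real" where
  "weighted_norm L w f = sqrt (\<Sum>bs\<in>L. \<integral>x. (iter_deriv bs f x)\<^sup>2 * w x \<partial>lborel)"

text \<open>Derivatives are indexed by lists of standard basis vectors, so each multi-index \<open>\<alpha>\<close> is
  counted once per ordering: the norm of \<open>W\<^sup>l\<^sup>,\<^sup>2(\<real>\<^sup>d, \<phi>(x)dx)\<close> below is
  \<open>\<Sum>k\<le>l. \<integral> |\<nabla>\<^sup>k f(x)|\<^sup>2 \<phi>(x) dx\<close> under a square root, with the Hilbert-Schmidt norm of \<open>\<nabla>\<^sup>k f(x)\<close>.\<close>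

definition H_norm :: "nat \<Rightarrow> (real^'d \<Rightarrow> real) \<Rightarrow> (real^'d \<Rightarrow> real) \<Rightarrow> real" where
  "H_norm l \<phi> = weighted_norm {bs \<in> lists Basis. length bs \<le> l} \<phi>"

text \<open>The Hilbert space norm of the \<open>n\<close>-th tensor power of \<open>W\<^sup>l\<^sup>,\<^sup>2(\<real>\<^sup>d, \<phi>(x)dx)\<close> (up to the same
  harmless positive multiplicities): up to \<open>l\<close> derivatives in \<^emph>\<open>each\<close> of the \<open>n\<close> variables
  \<open>x\<^sub>i\<close>, and the weight \<open>\<phi>(x\<^sub>1) \<cdots> \<phi>(x\<^sub>n)\<close>.  A standard basis vector of \<open>(\<real>\<^sup>d)\<^sup>n\<close> has
  exactly one nonzero block.\<close>

definition H_tensor_norm ::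
  "nat \<Rightarrow> (real^'d \<Rightarrow> real) \<Rightarrow> ((real^'d)^'n \<Rightarrow> real) \<Rightarrow> real" where
  "H_tensor_norm l \<phi> =
     weighted_norm {bs \<in> lists Basis. \<forall>i. length (filter (\<lambda>b. b $ i \<noteq> 0) bs) \<le> l}
       (\<lambda>x. \<Prod>i\<in>UNIV. \<phi> (x $ i))"

text \<open>The coarsest topology on \<open>V\<close> for which the inclusions into all the normed spaces
  \<open>(V, N l \<phi>)\<close> are continuous.\<close>

definition projective_topology ::
  "('a \<Rightarrow> real) set \<Rightarrow> (nat \<Rightarrow> ('b::euclidean_space \<Rightarrow> real) \<Rightarrow> ('a \<Rightarrow> real) \<Rightarrow> real)
     \<Rightarrow> ('a \<Rightarrow> real) topology" where
  "projective_topology V N =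
     topology_generated_by
       {{g \<in> V. N l \<phi> (\<lambda>x. g x - f x) < r} | l \<phi> f r. \<phi> \<in> weights \<and> f \<in> V \<and> 0 < r}"

text \<open>Functionals are extensional, so that equality in the dual is equality of HOL functions.\<close>

definition continuous_dual :: "('a \<Rightarrow> real) topology \<Rightarrow> (('a \<Rightarrow> real) \<Rightarrow> real) set" where
  "continuous_dual T =
     {F \<in> extensional (topspace T).
        (\<forall>f\<in>topspace T. \<forall>g\<in>topspace T. F (\<lambda>x. f x + g x) = F f + F g) \<and>
        (\<forall>c. \<forall>f\<in>topspace T. F (\<lambda>x. c * f x) = c * F f) \<and>
        continuous_map T euclideanreal F}"

text \<open>\<open>\<D>'\<close>, \<open>\<D>'\<^sup>\<otimes>\<^sup>n\<close> and \<open>\<D>'\<^sup>\<odot>\<^sup>n\<close>.  The pairing is application of the functional.\<close>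

definition distributions :: "((real^'d \<Rightarrow> real) \<Rightarrow> real) set" where
  "distributions = continuous_dual (projective_topology test_functions H_norm)"

definition tensor_distributions :: "(((real^'d)^'n \<Rightarrow> real) \<Rightarrow> real) set" where
  "tensor_distributions = continuous_dual (projective_topology test_functions H_tensor_norm)"

definition sym_tensor_distributions :: "(((real^'d)^'n \<Rightarrow> real) \<Rightarrow> real) set" where
  "sym_tensor_distributions =
     continuous_dual (projective_topology sym_test_functions H_tensor_norm)"


section \<open>Tensor products\<close>

definition fun_tensor :: "('n \<Rightarrow> real^'d \<Rightarrow> real) \<Rightarrow> (real^'d)^'n \<Rightarrow> real" where
  "fun_tensor \<xi> = (\<lambda>x. \<Prod>i\<in>UNIV. \<xi> i (x $ i))"

definition dist_tensor ::
  "('n \<Rightarrow> (real^'d \<Rightarrow> real) \<Rightarrow> real) \<Rightarrow> ((real^'d)^'n \<Rightarrow> real) \<Rightarrow> real" where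
  "dist_tensor \<omega> =
     (THE T. T \<in> tensor_distributions \<and>
        (\<forall>\<xi>. (\<forall>i. \<xi> i \<in> test_functions) \<longrightarrow> T (fun_tensor \<xi>) = (\<Prod>i\<in>UNIV. \<omega> i (\<xi> i))))"

definition dist_sym_tensor ::
  "('n \<Rightarrow> (real^'d \<Rightarrow> real) \<Rightarrow> real) \<Rightarrow> ((real^'d)^'n \<Rightarrow> real) \<Rightarrow> real" where
  "dist_sym_tensor \<omega> =
     (\<lambda>f\<in>sym_test_functions.
        (\<Sum>\<sigma> | \<sigma> permutes (UNIV :: 'n set). dist_tensor (\<lambda>i. \<omega> (\<sigma> i)) f) / fact CARD('n))"


section \<open>Configurations\<close>

text \<open>The embedding of Radon measures into \<open>\<D>'\<close>.\<close>

definition measure_dist :: "(real^'d) measure \<Rightarrow> (real^'d \<Rightarrow> real) \<Rightarrow> real" where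
  "measure_dist \<mu> = (\<lambda>f\<in>test_functions. \<integral>x. f x \<partial>\<mu>)"

definition dirac :: "real^'d \<Rightarrow> (real^'d) measure" where
  "dirac y = return borel y"

definition dirac_sum :: "(nat \<Rightarrow> real^'d) \<Rightarrow> (real^'d) measure" where
  "dirac_sum x = measure_of UNIV (sets borel) (\<lambda>A. \<Sum>i. emeasure (dirac (x i)) A)"

text \<open>A Borel measure on \<open>\<real>\<^sup>d\<close> is Radon iff it is finite on compact sets.\<close>

definition configuration_space :: "(real^'d) measure set" where
  "configuration_space =
     {\<gamma>. (\<exists>x. inj x \<and> \<gamma> = dirac_sum x) \<and> (\<forall>K. compact K \<longrightarrow> emeasure \<gamma> K < \<infinity>)}"


section \<open>Falling factorials and binomial coefficients\<close>

text \<open>\<open>exp (\<Sum>k\<ge>1. (-1)\<^sup>k\<^sup>+\<^sup>1 / k \<langle>\<omega>, \<xi>\<^sup>k\<rangle> t\<^sup>k)\<close> as a formal power series in \<open>t\<close>.\<close>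

definition falling_gf :: "((real^'d \<Rightarrow> real) \<Rightarrow> real) \<Rightarrow> (real^'d \<Rightarrow> real) \<Rightarrow> real fps" where
  "falling_gf \<omega> \<xi> =
     fps_compose (fps_exp 1)
       (Abs_fps (\<lambda>k. if k = 0 then 0 else (-1) ^ (k + 1) / real k * \<omega> (\<lambda>y. \<xi> y ^ k)))"

text \<open>\<open>(\<omega>)\<^sub>n\<close> for \<open>\<omega> \<in> \<D>'\<close>; \<open>n = CARD('n)\<close> is read off from the result type.\<close>

definition falling_factorial ::
  "((real^'d \<Rightarrow> real) \<Rightarrow> real) \<Rightarrow> ((real^'d)^'n \<Rightarrow> real) \<Rightarrow> real" where
  "falling_factorial =
     (\<lambda>\<omega>\<in>distributions. THE F. F \<in> sym_tensor_distributions \<and>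
        (\<forall>\<xi>\<in>test_functions.
           F (fun_tensor (\<lambda>_. \<xi>)) / fact CARD('n) = fps_nth (falling_gf \<omega> \<xi>) CARD('n)))"

definition dist_binomial ::
  "((real^'d \<Rightarrow> real) \<Rightarrow> real) \<Rightarrow> ((real^'d)^'n \<Rightarrow> real) \<Rightarrow> real" where
  "dist_binomial \<omega> = (\<lambda>f\<in>sym_test_functions. falling_factorial \<omega> f / fact CARD('n))"

text \<open>An arbitrary numbering of an index set with \<open>CARD('n)\<close> elements by \<open>'n\<close>; symmetric tensor
  products do not depend on it.\<close>

definition numbering :: "nat set \<Rightarrow> 'n::finite \<Rightarrow> nat" where
  "numbering I = (SOME e. bij_betw e UNIV I)"

end

theory Submission
  imports Defs
begin

text \<open>
  Let \<open>\<gamma> = \<Sum>\<^sub>i \<delta>\<^bsub>x i\<^esub>\<close>.  For a test function \<open>\<xi>\<close> only finitely many of the numbers \<open>\<xi> (x i)\<close>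
  are nonzero, and \<open>\<langle>\<gamma>, \<xi>\<^sup>k\<rangle> = \<Sum>\<^sub>i (\<xi> (x i))\<^sup>k\<close>.  So the exponent of the generating function is
  \<open>\<Sum>\<^sub>i log (1 + \<xi> (x i) t)\<close>, its exponential is the polynomial \<open>\<Prod>\<^sub>i (1 + \<xi> (x i) t)\<close>
  (\<open>exp_log_series_eq_prod\<close>), and the coefficient of \<open>t\<^sup>n\<close> is the elementary symmetric function
  \<open>\<Sum>\<^sub>I \<Prod>\<^bsub>i \<in> I\<^esub> \<xi> (x i)\<close> over the \<open>n\<close>-element sets \<open>I\<close>.  This is the value at \<open>\<xi>\<^sup>\<otimes>\<^sup>n\<close> of the
  functional \<open>f \<mapsto> \<Sum>\<^sub>I f (x\<^sub>I)\<close>, where \<open>x\<^sub>I\<close> lists the points with index in \<open>I\<close>.  What remains is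
  that the objects defined by a unique description exist and are unique in the duals concerned.

  Existence needs the continuity of \<open>f \<mapsto> \<Sum>\<^sub>I f (x\<^sub>I)\<close>.  A test function on a Euclidean space is
  bounded at \<open>p\<close> by the integral of the absolute value of its full mixed derivative over the orthant
  with corner \<open>p\<close> that points away from the origin (\<open>abs_le_orthant_integral\<close>).  A point \<open>y\<close> lies
  in the orthant of \<open>p\<close> only if \<open>norm p \<le> norm y\<close>, so summing over the points of a locally
  finite configuration produces a locally bounded multiplicity, which is absorbed by a rapidly
  growing smooth weight through the Cauchy-Schwarz inequality (\<open>sum_abs_le_weighted_norm\<close>,
  \<open>weight_dominating\<close>).

  Uniqueness needs the density of the span of tensor products of test functions
  (\<open>tensor_approx\<close>).  Let \<open>f\<close> be supported in the interior of a cube, and let \<open>m\<close> be large.  Take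
  the derivative of \<open>f\<close> of order \<open>m\<close> in every coordinate, approximate it uniformly on the cube by a
  polynomial (Stone-Weierstrass), and let \<open>Q\<close> be the \<open>m\<close>-fold antiderivative of that polynomial in
  every coordinate that vanishes to order \<open>m\<close> on the faces through the lower corner.  By the mean
  value theorem all derivatives of \<open>f - Q\<close> of order at most \<open>m\<close> in each coordinate are small on the
  cube (\<open>face_bound\<close>), and multiplying \<open>Q\<close> by a tensor product of cut-off functions keeps the
  estimate and yields a sum of tensor products.  For symmetric test functions the approximants are
  symmetrized, and the polarization identity (\<open>permanent_polarization\<close>) expresses symmetrized
  tensor products through powers \<open>\<xi>\<^sup>\<otimes>\<^sup>n\<close>.
\<close>

section \<open>Calculus of smooth functions\<close>

text \<open>The derivative of \<open>f\<close> in the direction \<open>b\<close>; \<open>b\<close> need not be a basis vector.\<close>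

definition partial :: "'a::euclidean_space \<Rightarrow> ('a \<Rightarrow> real) \<Rightarrow> 'a \<Rightarrow> real" where
  "partial b f = (\<lambda>x. frechet_derivative f (at x) b)"

lemma iter_deriv_append: "iter_deriv (as @ bs) f = iter_deriv as (iter_deriv bs f)"
  by (induction as) auto

lemma iter_deriv_Cons: "iter_deriv (b # bs) f = partial b (iter_deriv bs f)"
  by (simp add: partial_def)

lemma iter_deriv_snoc: "iter_deriv (bs @ [b]) f = iter_deriv bs (partial b f)"
  by (simp add: iter_deriv_append partial_def)

text \<open>Smoothness is the greatest property that implies differentiability and is inherited by partial
  derivatives.  Most of the closure properties below come from this coinduction.\<close>

lemma smooth_coinduct:
  assumes "f \<in> S"
    and "\<And>f x. f \<in> S \<Longrightarrow> f differentiable (at x)"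
    and "\<And>f b. f \<in> S \<Longrightarrow> b \<in> Basis \<Longrightarrow> partial b f \<in> S"
  shows "smooth f"
proof -
  have "iter_deriv bs f \<in> S" if "bs \<in> lists Basis" for bs
    using that by (induction bs) (auto simp: assms iter_deriv_Cons simp del: iter_deriv.simps(2))
  then show ?thesis
    unfolding smooth_def using assms(2) by blast
qed

lemma smooth_differentiable: "smooth f \<Longrightarrow> f differentiable (at x)"
  unfolding smooth_def by (drule bspec[of _ _ "[]"]) auto

lemma smooth_has_derivative: "smooth f \<Longrightarrow> (f has_derivative frechet_derivative f (at x)) (at x)"
  using smooth_differentiable frechet_derivative_works by blast

lemma smooth_continuous: "smooth f \<Longrightarrow> continuous_on S f"
  by (meson continuous_at_imp_continuous_on differentiable_imp_continuous_within smooth_differentiable)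

lemma smooth_measurable: "smooth f \<Longrightarrow> f \<in> borel_measurable borel"
  by (simp add: borel_measurable_continuous_onI smooth_continuous)

lemma smooth_iter_deriv:
  assumes "smooth f" "bs \<in> lists Basis" shows "smooth (iter_deriv bs f)"
  unfolding smooth_def
proof (intro ballI allI)
  fix as x assume "as \<in> lists (Basis :: 'a set)"
  then have "as @ bs \<in> lists Basis" using assms(2) by auto
  then show "iter_deriv as (iter_deriv bs f) differentiable at x"
    using assms(1) unfolding smooth_def iter_deriv_append[symmetric] by blast
qed

lemma smooth_partial: "smooth f \<Longrightarrow> b \<in> Basis \<Longrightarrow> smooth (partial b f)"
  using smooth_iter_deriv[of f "[b]"] by (simp add: partial_def)

lemma partial_eqI: "(\<And>x. (f has_derivative f' x) (at x)) \<Longrightarrow> partial b f = (\<lambda>x. f' x b)"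
  unfolding partial_def by (metis frechet_derivative_at)

lemma partial_const: "partial b (\<lambda>x. c) = (\<lambda>x. 0)"
  by (rule partial_eqI) (rule derivative_eq_intros refl)+

lemma partial_add:
  assumes "\<And>x. f differentiable (at x)" "\<And>x. g differentiable (at x)"
  shows "partial b (\<lambda>x. f x + g x) = (\<lambda>x. partial b f x + partial b g x)"
  unfolding partial_def[of b f] partial_def[of b g]
  using assms by (intro partial_eqI has_derivative_add) (simp_all add: frechet_derivative_works)

lemma partial_mult:
  assumes "\<And>x. f differentiable (at x)" "\<And>x. g differentiable (at x)"
  shows "partial b (\<lambda>x. f x * g x) = (\<lambda>x. f x * partial b g x + partial b f x * g x)"
  unfolding partial_def[of b f] partial_def[of b g]
  using assms by (intro partial_eqI has_derivative_mult) (simp_all add: frechet_derivative_works)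

lemma partial_chain:
  assumes "\<And>x. f differentiable (at x)" "\<And>x. (h has_real_derivative h' (f x)) (at (f x))"
  shows "partial b (\<lambda>x. h (f x)) = (\<lambda>x. h' (f x) * partial b f x)"
proof -
  have "((\<lambda>x. h (f x)) has_derivative (\<lambda>y. h' (f x) * frechet_derivative f (at x) y)) (at x)" for x
    using has_derivative_compose[of f _ x UNIV h "\<lambda>y. h' (f x) * y"] assms
    by (simp add: frechet_derivative_works has_field_derivative_def)
  from partial_eqI[OF this] show ?thesis by (simp add: partial_def)
qed

lemma chain_differentiable:
  assumes "f differentiable (at x)" "(h has_real_derivative h' (f x)) (at (f x))"
  shows "(\<lambda>x. h (f x)) differentiable (at x)"
  using assms differentiable_compose[of h f x UNIV]
  by (metis at_within_open differentiableI has_field_derivative_def differentiable_chain_at o_def)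

text \<open>The flat function \<open>exp (- 1 / s)\<close> for positive \<open>s\<close>, extended by zero, together with its multiples by
  \<open>s\<^sup>-\<^sup>k\<close>.  The family, unlike its member for \<open>k = 0\<close>, has derivatives that are linear combinations of
  its members.\<close>

definition flat_exp :: "nat \<Rightarrow> real \<Rightarrow> real" where
  "flat_exp k s = (if s > 0 then (1 / s) ^ k * exp (- 1 / s) else 0)"

lemma flat_exp_deriv: "(flat_exp k has_real_derivative (flat_exp (k+2) s - real k * flat_exp (k+1) s)) (at s)"
proof -
  consider "s < 0" | "s = 0" | "s > 0" by linarith
  then show ?thesis
  proof cases
    case 1
    have "((\<lambda>_. 0) has_real_derivative 0) (at s)" by simp
    then have "(flat_exp k has_real_derivative 0) (at s)"
      by (rule has_field_derivative_transform_within_open[where S="{..<0}"]) (use 1 in \<open>auto simp: flat_exp_def\<close>)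
    then show ?thesis using 1 by (simp add: flat_exp_def)
  next
    case 2
    \<comment> \<open>the difference quotient at \<open>0\<close>\<close>
    have "((\<lambda>y. flat_exp k y / y) \<longlongrightarrow> 0) (at 0)"
    proof (rule filterlim_split_at)
      have "eventually (\<lambda>y. flat_exp k y / y = 0) (at_left 0)"
        by (auto simp: eventually_at_filter flat_exp_def)
      then show "((\<lambda>y. flat_exp k y / y) \<longlongrightarrow> 0) (at_left 0)"
        by (simp add: tendsto_eventually)
      have "((\<lambda>y::real. (1 / y) ^ (Suc k) * exp (- 1 / y)) \<longlongrightarrow> 0) (at_right 0)"
      proof -
        have "((\<lambda>y::real. inverse y ^ Suc k / exp (inverse y)) \<longlongrightarrow> 0) (at_right 0)"
          by (rule filterlim_compose[OF tendsto_power_div_exp_0 filterlim_inverse_at_top_right])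
        then show ?thesis by (simp add: exp_minus field_simps)
      qed
      moreover have "eventually (\<lambda>y. (1 / y) ^ (Suc k) * exp (- 1 / y) = flat_exp k y / y) (at_right 0)"
        by (auto simp: eventually_at_filter flat_exp_def)
      ultimately show "((\<lambda>y. flat_exp k y / y) \<longlongrightarrow> 0) (at_right 0)"
        by (rule Lim_transform_eventually)
    qed
    then have "(flat_exp k has_real_derivative 0) (at 0)"
      by (simp add: has_field_derivative_iff flat_exp_def)
    then show ?thesis using 2 by (simp add: flat_exp_def)
  next
    case 3
    have "((\<lambda>s. (1 / s) ^ k * exp (- 1 / s)) has_real_derivative (flat_exp (k+2) s - real k * flat_exp (k+1) s)) (at s)"
    proof -
      have d: "((\<lambda>s. 1 / s) has_real_derivative - ((1 / s)\<^sup>2)) (at s)"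
        using 3 by (auto intro!: derivative_eq_intros simp: power2_eq_square)
      have e: "((\<lambda>s. (1 / s) ^ k * exp (- (1 / s))) has_real_derivative
         real k * ((1 / s) ^ (k - 1) * - ((1 / s)\<^sup>2)) * exp (- (1 / s)) +
         exp (- (1 / s)) * - (- ((1 / s)\<^sup>2)) * (1 / s) ^ k) (at s)"
        using DERIV_mult[OF DERIV_power[OF d, of k] DERIV_chain2[OF DERIV_exp DERIV_minus[OF d]]]
        by (simp add: mult_ac)
      have "real k * (z ^ (k - 1) * - (z\<^sup>2)) * E + E * - (- (z\<^sup>2)) * z ^ k
          = z ^ (k + 2) * E - real k * (z ^ (k + 1) * E)" for z E :: real
        by (cases k) (simp_all add: power2_eq_square algebra_simps)
      from DERIV_cong[OF e this] 3 show ?thesis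
        by (simp add: flat_exp_def)
    qed
    then show ?thesis
      by (rule has_field_derivative_transform_within_open[where S="{0<..}"]) (use 3 in \<open>auto simp: flat_exp_def\<close>)
  qed
qed

text \<open>A set of functions that contains the smooth ones and is visibly closed under partial derivatives;
  by coinduction it consists of smooth functions, and each introduction rule becomes a closure
  property of smoothness.\<close>

inductive smooth_hull :: "('a::euclidean_space \<Rightarrow> real) \<Rightarrow> bool" where
  base: "smooth f \<Longrightarrow> smooth_hull f"
| add: "smooth_hull f \<Longrightarrow> smooth_hull g \<Longrightarrow> smooth_hull (\<lambda>x. f x + g x)"
| mult: "smooth_hull f \<Longrightarrow> smooth_hull g \<Longrightarrow> smooth_hull (\<lambda>x. f x * g x)"
| comp_flat: "smooth f \<Longrightarrow> smooth_hull (\<lambda>x. flat_exp k (f x))"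
| comp_inverse: "smooth f \<Longrightarrow> (\<And>x. f x > 0) \<Longrightarrow> smooth_hull (\<lambda>x. inverse (f x))"

lemma smooth_const: "smooth (\<lambda>x. c)"
  by (rule smooth_coinduct[of _ "range (\<lambda>c x. c)"]) (auto simp: partial_const)

lemma smooth_hull_partial:
  assumes "smooth_hull f"
  shows "(\<forall>x. f differentiable at x) \<and> (\<forall>b\<in>Basis. smooth_hull (partial b f))"
  using assms
proof induction
  case (base f) then show ?case by (auto intro: smooth_differentiable smooth_partial smooth_hull.base)
next
  case (add f g) then show ?case by (auto simp: partial_add intro: smooth_hull.add)
next
  case (mult f g) then show ?case
    by (auto simp: partial_mult intro!: smooth_hull.add smooth_hull.mult)
next
  case (comp_flat f k)
  have "partial b (\<lambda>x. flat_exp k (f x)) = (\<lambda>x. (flat_exp (k + 2) (f x) + (- real k) * flat_exp (k + 1) (f x)) * partial b f x)" for b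
    using partial_chain[of f "flat_exp k" "\<lambda>y. flat_exp (k + 2) y - real k * flat_exp (k + 1) y",
        OF smooth_differentiable[OF comp_flat] flat_exp_deriv] by simp
  moreover have "smooth_hull (\<lambda>x. (flat_exp (k + 2) (f x) + (- real k) * flat_exp (k + 1) (f x)) * partial b f x)" if "b \<in> Basis" for b
  proof (rule smooth_hull.mult)
    show "smooth_hull (\<lambda>x. flat_exp (k + 2) (f x) + (- real k) * flat_exp (k + 1) (f x))"
      by (rule smooth_hull.add[OF smooth_hull.comp_flat[OF comp_flat]
        smooth_hull.mult[OF smooth_hull.base[OF smooth_const] smooth_hull.comp_flat[OF comp_flat]]])
    show "smooth_hull (partial b f)"
      using comp_flat that by (intro smooth_hull.base smooth_partial)
  qed
  ultimately have "smooth_hull (partial b (\<lambda>x. flat_exp k (f x)))" if "b \<in> Basis" for b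
    using that by simp
  then show ?case
    using chain_differentiable[of f _ "flat_exp k" "\<lambda>y. flat_exp (k + 2) y - real k * flat_exp (k + 1) y",
      OF smooth_differentiable[OF comp_flat] flat_exp_deriv] by simp
next
  case (comp_inverse f)
  have inv: "(inverse has_real_derivative (- 1) * (inverse y * inverse y)) (at y)" if "y > 0" for y :: real
    using that by (auto intro!: derivative_eq_intros)
  have "partial b (\<lambda>x. inverse (f x)) = (\<lambda>x. ((- 1) * (inverse (f x) * inverse (f x))) * partial b f x)" for b
    by (rule partial_chain[of f inverse "\<lambda>y. (- 1) * (inverse y * inverse y)",
        OF smooth_differentiable[OF comp_inverse(1)] inv[OF comp_inverse(2)]])
  moreover have "smooth_hull (\<lambda>x. ((- 1) * (inverse (f x) * inverse (f x))) * partial b f x)" if "b \<in> Basis" for b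
  proof (rule smooth_hull.mult)
    have "smooth_hull (\<lambda>x. inverse (f x))" using comp_inverse by (rule smooth_hull.comp_inverse)
    then show "smooth_hull (\<lambda>x. (- 1) * (inverse (f x) * inverse (f x)))"
      by (intro smooth_hull.mult[OF smooth_hull.base[OF smooth_const]] smooth_hull.mult)
    show "smooth_hull (partial b f)"
      using comp_inverse that by (intro smooth_hull.base smooth_partial)
  qed
  ultimately have "smooth_hull (partial b (\<lambda>x. inverse (f x)))" if "b \<in> Basis" for b
    using that by simp
  then show ?case
    using chain_differentiable[of f _ inverse "\<lambda>y. (- 1) * (inverse y * inverse y)",
      OF smooth_differentiable[OF comp_inverse(1)] inv[OF comp_inverse(2)]] by simp
qed

lemma smooth_hull_smooth: "smooth_hull f \<Longrightarrow> smooth f"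
  using smooth_hull_partial by (intro smooth_coinduct[of f "Collect smooth_hull"]) auto

lemma smooth_add: "smooth f \<Longrightarrow> smooth g \<Longrightarrow> smooth (\<lambda>x. f x + g x)"
  and smooth_mult: "smooth f \<Longrightarrow> smooth g \<Longrightarrow> smooth (\<lambda>x. f x * g x)"
  and smooth_flat: "smooth f \<Longrightarrow> smooth (\<lambda>x. flat_exp k (f x))"
  and smooth_inverse: "smooth f \<Longrightarrow> (\<And>x. f x > 0) \<Longrightarrow> smooth (\<lambda>x. inverse (f x))"
  by (rule smooth_hull_smooth, blast intro: smooth_hull.intros)+

lemma smooth_minus: "smooth f \<Longrightarrow> smooth (\<lambda>x. - f x)"
  using smooth_mult[OF smooth_const[of "-1"]] by simp

lemma smooth_diff: "smooth f \<Longrightarrow> smooth g \<Longrightarrow> smooth (\<lambda>x. f x - g x)"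
  using smooth_add[OF _ smooth_minus] by simp

lemma smooth_sum: "(\<And>i. i \<in> I \<Longrightarrow> smooth (f i)) \<Longrightarrow> smooth (\<lambda>x. \<Sum>i\<in>I. f i x)"
  by (induction I rule: infinite_finite_induct) (auto intro: smooth_add smooth_const)

lemma smooth_prod: "(\<And>i. i \<in> I \<Longrightarrow> smooth (f i)) \<Longrightarrow> smooth (\<lambda>x. \<Prod>i\<in>I. f i x)"
  by (induction I rule: infinite_finite_induct) (auto intro: smooth_mult smooth_const)

lemma smooth_power: "smooth f \<Longrightarrow> smooth (\<lambda>x. f x ^ k)"
  by (induction k) (auto intro: smooth_mult smooth_const)

lemma smooth_bounded_linear:
  assumes "bounded_linear f" shows "smooth f"
proof (rule smooth_coinduct[of _ "insert f (range (\<lambda>c x. c))"])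
  have "(f has_derivative f) (at x)" for x
    using assms bounded_linear_imp_has_derivative by blast
  then show "g \<in> insert f (range (\<lambda>c x. c)) \<Longrightarrow> g differentiable at x"
    "g \<in> insert f (range (\<lambda>c x. c)) \<Longrightarrow> b \<in> Basis \<Longrightarrow> partial b g \<in> insert f (range (\<lambda>c x. c))" for g x b
    using partial_eqI[of f "\<lambda>_. f" b] by (auto simp: partial_const intro: differentiableI)
qed auto

lemma smooth_inner: "smooth (\<lambda>x. x \<bullet> c)"
  by (rule smooth_bounded_linear) (rule bounded_linear_inner_left)

lemma smooth_norm_sq: "smooth (\<lambda>x::'a::euclidean_space. (norm x)\<^sup>2)"
  unfolding norm_eq_sqrt_inner by (subst real_sqrt_pow2, simp, subst euclidean_inner)
    (intro smooth_sum smooth_mult smooth_inner)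

lemma frechet_derivative_cong_open:
  assumes "open U" "x \<in> U" "\<And>y. y \<in> U \<Longrightarrow> f y = g y"
  shows "frechet_derivative f (at x) = frechet_derivative g (at x)"
proof -
  have "(f has_derivative D) (at x) \<longleftrightarrow> (g has_derivative D) (at x)" for D
    using assms has_derivative_transform_within_open[of f D x UNIV U g]
      has_derivative_transform_within_open[of g D x UNIV U f] by auto
  then show ?thesis unfolding frechet_derivative_def by auto
qed

lemma iter_deriv_cong_open:
  assumes "open U" "x \<in> U" "\<And>y. y \<in> U \<Longrightarrow> f y = g y"
  shows "iter_deriv bs f x = iter_deriv bs g x"
  using assms(2)
proof (induction bs arbitrary: x)
  case (Cons b bs)
  show ?case
    using frechet_derivative_cong_open[OF assms(1) Cons.prems, of "iter_deriv bs f" "iter_deriv bs g", OF Cons.IH] by simp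
qed (simp add: assms)

text \<open>Smoothness is a local property.\<close>

lemma smooth_local:
  assumes "\<And>x. \<exists>U g. open U \<and> x \<in> U \<and> smooth g \<and> (\<forall>y\<in>U. f y = g y)"
  shows "smooth f"
  unfolding smooth_def
proof (intro ballI allI)
  fix bs :: "'a list" and x assume bs: "bs \<in> lists Basis"
  obtain U g where U: "open U" "x \<in> U" "smooth g" "\<And>y. y \<in> U \<Longrightarrow> f y = g y" using assms by metis
  have "iter_deriv bs g differentiable at x" using U bs by (auto simp: smooth_def)
  moreover have "iter_deriv bs g y = iter_deriv bs f y" if "y \<in> U" for y
    using iter_deriv_cong_open[OF U(1) that U(4)] by auto
  ultimately show "iter_deriv bs f differentiable at x"
    using U(1,2) unfolding differentiable_def by (metis has_derivative_transform_within_open)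
qed

lemma iter_deriv_add:
  "smooth f \<Longrightarrow> smooth g \<Longrightarrow> bs \<in> lists Basis \<Longrightarrow>
   iter_deriv bs (\<lambda>x. f x + g x) = (\<lambda>x. iter_deriv bs f x + iter_deriv bs g x)"
  by (induction bs) (auto simp: iter_deriv_Cons partial_add smooth_differentiable smooth_iter_deriv
    simp del: iter_deriv.simps(2))

lemma iter_deriv_const: "iter_deriv bs (\<lambda>x. c) = (\<lambda>x. if bs = [] then c else 0)"
  by (induction bs) (auto simp: iter_deriv_Cons partial_const simp del: iter_deriv.simps(2))

lemma iter_deriv_cmult:
  "smooth f \<Longrightarrow> bs \<in> lists Basis \<Longrightarrow> iter_deriv bs (\<lambda>x. c * f x) = (\<lambda>x. c * iter_deriv bs f x)"
  by (induction bs) (auto simp: iter_deriv_Cons partial_mult partial_const smooth_differentiable smooth_iter_deriv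
    simp del: iter_deriv.simps(2))

lemma iter_deriv_diff:
  "smooth f \<Longrightarrow> smooth g \<Longrightarrow> bs \<in> lists Basis \<Longrightarrow>
   iter_deriv bs (\<lambda>x. f x - g x) = (\<lambda>x. iter_deriv bs f x - iter_deriv bs g x)"
  using iter_deriv_add[OF _ smooth_minus, of f g bs] iter_deriv_cmult[of g bs "-1"] by simp

lemma smooth_line_deriv:
  assumes "smooth f"
  shows "((\<lambda>t. f (x + t *\<^sub>R v)) has_real_derivative partial v f (x + t *\<^sub>R v)) (at t)"
proof -
  have 1: "((\<lambda>t. x + t *\<^sub>R v) has_derivative (\<lambda>s. s *\<^sub>R v)) (at t)"
    by (auto intro!: derivative_eq_intros)
  note 2 = smooth_has_derivative[OF assms, of "x + t *\<^sub>R v"]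
  have "((\<lambda>t. f (x + t *\<^sub>R v)) has_derivative (\<lambda>s. frechet_derivative f (at (x + t *\<^sub>R v)) (s *\<^sub>R v))) (at t)"
    using has_derivative_compose[OF 1 2] .
  then show ?thesis
    using linear_cmul[OF has_derivative_linear[OF 2]]
    by (simp add: has_field_derivative_def partial_def mult.commute[of "frechet_derivative f _ v"] mult_commute_abs)
qed

text \<open>Symmetry of second derivatives: two applications of the mean value theorem to a second difference
  of step \<open>h\<close>, in either order, give \<open>h\<^sup>2\<close> times each of the mixed derivatives at points near \<open>x\<close>.\<close>

lemma partial_commute:
  assumes f: "smooth f" and a: "a \<in> Basis" and b: "b \<in> Basis"
  shows "partial a (partial b f) = partial b (partial a f)"
proof
  have ex: "\<exists>s t. 0 < s \<and> s < h \<and> 0 < t \<and> t < h \<and>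
      f (x + h *\<^sub>R a + h *\<^sub>R b) - f (x + h *\<^sub>R a) - f (x + h *\<^sub>R b) + f x
        = h * h * partial b (partial a f) (x + s *\<^sub>R a + t *\<^sub>R b)"
    if h: "h > 0" and a: "a \<in> Basis" and b: "b \<in> Basis" for x h a b
  proof -
    have d: "((\<lambda>s. f ((x + h *\<^sub>R b) + s *\<^sub>R a) - f (x + s *\<^sub>R a)) has_real_derivative
       (partial a f ((x + h *\<^sub>R b) + s *\<^sub>R a) - partial a f (x + s *\<^sub>R a))) (at s)" for s
      by (intro DERIV_diff smooth_line_deriv f)
    obtain s where s: "0 < s" "s < h" and s2:
      "f ((x + h *\<^sub>R b) + h *\<^sub>R a) - f (x + h *\<^sub>R a) - (f ((x + h *\<^sub>R b) + 0 *\<^sub>R a) - f (x + 0 *\<^sub>R a))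
        = (h - 0) * (partial a f ((x + h *\<^sub>R b) + s *\<^sub>R a) - partial a f (x + s *\<^sub>R a))"
      using MVT2[OF \<open>h > 0\<close> d] by blast
    obtain t where t: "0 < t" "t < h" and t2:
      "partial a f (x + s *\<^sub>R a + h *\<^sub>R b) - partial a f (x + s *\<^sub>R a + 0 *\<^sub>R b)
        = (h - 0) * partial b (partial a f) (x + s *\<^sub>R a + t *\<^sub>R b)"
      using MVT2[OF \<open>h > 0\<close> smooth_line_deriv[OF smooth_partial[OF f a]]] by blast
    show ?thesis
      using s t s2 t2 by (intro exI[of _ s] exI[of _ t]) (simp add: algebra_simps)
  qed
  fix x
  let ?p = "partial a (partial b f)" and ?q = "partial b (partial a f)"
  have "\<bar>?p x - ?q x\<bar> \<le> 0 + e" if "e > 0" for e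
  proof -
    have "isCont ?p x" "isCont ?q x"
      using f a b by (auto intro!: differentiable_imp_continuous_within smooth_differentiable smooth_partial)
    then obtain d1 d2 where d1: "d1 > 0" "\<And>y. dist y x < d1 \<Longrightarrow> dist (?p y) (?p x) < e / 2"
      and d2: "d2 > 0" "\<And>y. dist y x < d2 \<Longrightarrow> dist (?q y) (?q x) < e / 2"
      using \<open>e > 0\<close> unfolding continuous_at_eps_delta by (metis half_gt_zero)
    define h where "h = min d1 d2 / 2"
    have h: "h > 0" using d1 d2 by (simp add: h_def)
    have near: "dist (x + s *\<^sub>R a + t *\<^sub>R b) x < d1" "dist (x + s *\<^sub>R a + t *\<^sub>R b) x < d2"
       if "0 < s" "s < h" "0 < t" "t < h" "a \<in> Basis" "b \<in> Basis" for s t a b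
    proof -
      have "norm (s *\<^sub>R a + t *\<^sub>R b) \<le> s + t"
        using norm_triangle_ineq[of "s *\<^sub>R a" "t *\<^sub>R b"] that by simp
      then have "dist (x + s *\<^sub>R a + t *\<^sub>R b) x < 2 * h" using that by (simp add: dist_norm add.assoc)
      then show "dist (x + s *\<^sub>R a + t *\<^sub>R b) x < d1" "dist (x + s *\<^sub>R a + t *\<^sub>R b) x < d2"
        by (auto simp: h_def)
    qed
    obtain s t where 1: "0 < s" "s < h" "0 < t" "t < h" 
      "f (x + h *\<^sub>R a + h *\<^sub>R b) - f (x + h *\<^sub>R a) - f (x + h *\<^sub>R b) + f x
        = h * h * ?q (x + s *\<^sub>R a + t *\<^sub>R b)"
      using ex[OF h a b] by blast
    obtain s' t' where 2: "0 < s'" "s' < h" "0 < t'" "t' < h"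
      "f (x + h *\<^sub>R b + h *\<^sub>R a) - f (x + h *\<^sub>R b) - f (x + h *\<^sub>R a) + f x
        = h * h * ?p (x + s' *\<^sub>R b + t' *\<^sub>R a)"
      using ex[OF h b a] by blast
    have "?q (x + s *\<^sub>R a + t *\<^sub>R b) = ?p (x + s' *\<^sub>R b + t' *\<^sub>R a)"
      using 1(5) 2(5) h by (simp add: algebra_simps)
    then show ?thesis
      using d1(2)[OF near(1)[of s' t' b a]] d2(2)[OF near(2)[of s t a b]] 1 2 a b
      unfolding dist_real_def by linarith
  qed
  then have "\<bar>?p x - ?q x\<bar> \<le> 0" by (rule field_le_epsilon)
  then show "?p x = ?q x" by simp
qed

lemma iter_deriv_partial_commute:
  assumes "smooth f" "b \<in> Basis" "bs \<in> lists Basis"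
  shows "iter_deriv bs (partial b f) = partial b (iter_deriv bs f)"
  using assms(3)
proof (induction bs)
  case (Cons c bs)
  then have "iter_deriv (c # bs) (partial b f) = partial c (partial b (iter_deriv bs f))"
    by (simp add: iter_deriv_Cons del: iter_deriv.simps(2))
  also have "\<dots> = partial b (partial c (iter_deriv bs f))"
    using Cons assms by (intro partial_commute smooth_iter_deriv) auto
  finally show ?case by (simp add: iter_deriv_Cons del: iter_deriv.simps(2))
qed simp

lemma iter_deriv_perm:
  assumes "smooth f" "bs \<in> lists Basis" "mset bs = mset cs"
  shows "iter_deriv bs f = iter_deriv cs f"
  using assms(2,3)
proof (induction bs arbitrary: cs rule: list.induct)
  case (Cons b bs)
  obtain c1 c2 where cs: "cs = c1 @ b # c2"
    using Cons.prems(2) by (metis split_list list.set_intros(1) mset_eq_setD)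
  have bas: "set cs \<subseteq> Basis" using mset_eq_setD[OF Cons.prems(2)] Cons.prems(1) by auto
  then have L: "c1 \<in> lists Basis" "c2 \<in> lists Basis" "b \<in> Basis" using cs by auto
  have "iter_deriv cs f = iter_deriv c1 (partial b (iter_deriv c2 f))"
    by (simp add: cs iter_deriv_append partial_def)
  also have "\<dots> = partial b (iter_deriv (c1 @ c2) f)"
    using L assms(1) by (simp add: iter_deriv_partial_commute smooth_iter_deriv iter_deriv_append)
  also have "iter_deriv (c1 @ c2) f = iter_deriv bs f"
    using Cons.prems by (intro Cons.IH[symmetric]) (auto simp: cs)
  finally show ?case by (simp add: partial_def)
qed simp

section \<open>Test functions, cut-offs and weights\<close>

lemma test_functions_iff: "f \<in> test_functions \<longleftrightarrow> smooth f \<and> (\<exists>R. \<forall>x. f x \<noteq> 0 \<longrightarrow> norm x \<le> R)"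
  by (auto simp: test_functions_def bounded_iff)

lemma test_functionsI: "smooth f \<Longrightarrow> (\<And>x. f x \<noteq> 0 \<Longrightarrow> norm x \<le> R) \<Longrightarrow> f \<in> test_functions"
  by (auto simp: test_functions_iff)

lemma test_functions_smooth: "f \<in> test_functions \<Longrightarrow> smooth f"
  by (simp add: test_functions_iff)

lemma test_functions_boundE:
  assumes "f \<in> test_functions" obtains R where "R > 0" "\<And>x. norm x > R \<Longrightarrow> f x = 0"
proof -
  obtain R where "\<And>x. f x \<noteq> 0 \<Longrightarrow> norm x \<le> R" using assms by (auto simp: test_functions_iff)
  then have "\<And>x. norm x > max R 1 \<Longrightarrow> f x = 0" by fastforce
  then show ?thesis by (intro that[of "max R 1"]) auto
qed

lemma test_functions_zero: "(\<lambda>x. 0) \<in> test_functions"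
  by (rule test_functionsI[where R=0]) (auto simp: smooth_const)

lemma test_functions_mult: "f \<in> test_functions \<Longrightarrow> smooth g \<Longrightarrow> (\<lambda>x. f x * g x) \<in> test_functions"
  unfolding test_functions_iff by (auto intro: smooth_mult)

lemma test_functions_cmult: "f \<in> test_functions \<Longrightarrow> (\<lambda>x. c * f x) \<in> test_functions"
  using test_functions_mult[OF _ smooth_const[of c]] by (simp add: mult.commute)

lemma test_functions_add:
  assumes "f \<in> test_functions" "g \<in> test_functions" shows "(\<lambda>x. f x + g x) \<in> test_functions"
proof -
  obtain R where R: "\<And>x. norm x > R \<Longrightarrow> f x = 0" using test_functions_boundE[OF assms(1)] by blast
  obtain S where S: "\<And>x. norm x > S \<Longrightarrow> g x = 0" using test_functions_boundE[OF assms(2)] by blast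
  show ?thesis
  proof (rule test_functionsI[where R="max R S"])
    show "smooth (\<lambda>x. f x + g x)" using assms by (intro smooth_add test_functions_smooth)
    show "norm x \<le> max R S" if "f x + g x \<noteq> 0" for x
      using R[of x] S[of x] that by (metis add.right_neutral le_max_iff_disj linorder_not_le)
  qed
qed

lemma test_functions_diff: "f \<in> test_functions \<Longrightarrow> g \<in> test_functions \<Longrightarrow> (\<lambda>x. f x - g x) \<in> test_functions"
  using test_functions_add[OF _ test_functions_cmult[of _ "-1"]] by simp

lemma test_functions_sum: "(\<And>i. i \<in> I \<Longrightarrow> f i \<in> test_functions) \<Longrightarrow> (\<lambda>x. \<Sum>i\<in>I. f i x) \<in> test_functions"
  by (induction I rule: infinite_finite_induct) (auto intro: test_functions_add test_functions_zero)

lemma test_functions_power: "f \<in> test_functions \<Longrightarrow> k > 0 \<Longrightarrow> (\<lambda>x. f x ^ k) \<in> test_functions"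
  using test_functions_mult[OF _ smooth_power[OF test_functions_smooth], of f f "k - 1"] by (cases k) auto

lemma iter_deriv_outside:
  assumes "\<And>x. norm x > R \<Longrightarrow> f x = 0" "norm x > R"
  shows "iter_deriv bs f x = 0"
proof -
  have "iter_deriv bs f x = iter_deriv bs (\<lambda>x. 0) x"
    using assms by (intro iter_deriv_cong_open[of "{x. norm x > R}"]) (auto intro: open_Collect_less continuous_intros)
  then show ?thesis by (simp add: iter_deriv_const)
qed

lemma test_functions_iter_deriv:
  assumes "f \<in> test_functions" "bs \<in> lists Basis" shows "iter_deriv bs f \<in> test_functions"
proof -
  obtain R where R: "\<And>x. norm x > R \<Longrightarrow> f x = 0" using test_functions_boundE[OF assms(1)] by blast
  show ?thesis
  proof (rule test_functionsI)
    show "smooth (iter_deriv bs f)" using assms by (intro smooth_iter_deriv test_functions_smooth)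
    show "norm x \<le> R" if "iter_deriv bs f x \<noteq> 0" for x
      using iter_deriv_outside[of R f x bs, OF R] that by fastforce
  qed
qed

lemma partial_linear:
  assumes "smooth f" "linear L"
  shows "partial b (\<lambda>x. f (L x)) = (\<lambda>x. partial (L b) f (L x))"
proof -
  have "((\<lambda>x. f (L x)) has_derivative (\<lambda>y. frechet_derivative f (at (L x)) (L y))) (at x)" for x
    using has_derivative_compose[OF linear_imp_has_derivative[OF assms(2)] smooth_has_derivative[OF assms(1)]] .
  from partial_eqI[OF this] show ?thesis by (simp add: partial_def)
qed

text \<open>Only linear maps that send basis vectors to basis vectors or to zero are needed: projections to a
  block of coordinates and permutations of blocks.\<close>

lemma smooth_linear_compose:
  fixes f :: "'a::euclidean_space \<Rightarrow> real" and L :: "'b::euclidean_space \<Rightarrow> 'a"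
  assumes "smooth f" "linear L" and L: "\<And>b. b \<in> Basis \<Longrightarrow> L b \<in> insert 0 Basis"
  shows "smooth (\<lambda>x. f (L x))"
proof (rule smooth_coinduct[of _ "{\<lambda>x. g (L x) | g. smooth g}"])
  show "(\<lambda>x. f (L x)) \<in> {\<lambda>x. g (L x) | g. smooth g}" using assms(1) by blast
next
  fix h x assume "h \<in> {\<lambda>x. g (L x) | g. smooth g}"
  then obtain g where g: "smooth g" "h = (\<lambda>x. g (L x))" by blast
  show "h differentiable at x"
    using has_derivative_compose[OF linear_imp_has_derivative[OF assms(2)] smooth_has_derivative[OF g(1)]] g(2)
    by (auto intro: differentiableI)
next
  fix h b assume "h \<in> {\<lambda>x. g (L x) | g. smooth g}" and b: "b \<in> (Basis :: 'b set)"
  then obtain g where g: "smooth g" "h = (\<lambda>x. g (L x))" by blast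
  have "partial b h = (\<lambda>x. partial (L b) g (L x))" unfolding g(2) by (rule partial_linear[OF g(1) assms(2)])
  moreover have "smooth (partial (L b) g)"
  proof (cases "L b = 0")
    case True
    then have "partial (L b) g = (\<lambda>x. 0)"
      using linear_0[OF has_derivative_linear[OF smooth_has_derivative[OF g(1)]]] by (simp add: partial_def)
    then show ?thesis by (simp add: smooth_const)
  next
    case False then show ?thesis using L[OF b] g(1) smooth_partial by blast
  qed
  ultimately show "partial b h \<in> {\<lambda>x. g (L x) | g. smooth g}" by blast
qed

lemma iter_deriv_linear_compose:
  fixes f :: "'a::euclidean_space \<Rightarrow> real" and L :: "'b::euclidean_space \<Rightarrow> 'a"
  assumes "smooth f" "linear L" and L: "\<And>b. b \<in> Basis \<Longrightarrow> L b \<in> Basis" and "bs \<in> lists Basis"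
  shows "iter_deriv bs (\<lambda>x. f (L x)) = (\<lambda>x. iter_deriv (map L bs) f (L x))"
  using assms(4)
proof (induction bs rule: list.induct)
  case (Cons b bs)
  have "iter_deriv (b # bs) (\<lambda>x. f (L x)) = partial b (\<lambda>x. iter_deriv (map L bs) f (L x))"
    using Cons by (simp add: partial_def)
  also have "\<dots> = (\<lambda>x. partial (L b) (iter_deriv (map L bs) f) (L x))"
    using Cons.prems L by (intro partial_linear smooth_iter_deriv assms) auto
  finally show ?case by (simp add: partial_def)
qed simp

lemma linear_vec_nth_real: "linear (\<lambda>x::'a::real_vector^'n. x $ i)"
  by (rule linearI) auto

lemma Basis_vec_nth: "b \<in> (Basis :: ('a::euclidean_space^'n) set) \<Longrightarrow> b $ i \<in> insert 0 Basis"
  by (auto simp: Basis_vec_def axis_def)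

lemma smooth_nth: "smooth f \<Longrightarrow> smooth (\<lambda>x::'a::euclidean_space^'n. f (x $ i))"
  using smooth_linear_compose[OF _ linear_vec_nth_real] Basis_vec_nth by blast

lemma fun_tensor_test:
  assumes "\<And>i. \<xi> i \<in> test_functions" shows "fun_tensor \<xi> \<in> test_functions"
proof -
  have "\<exists>R. \<forall>i x. norm x > R \<longrightarrow> \<xi> i x = 0"
  proof -
    have "\<exists>R. \<forall>x. norm x > R \<longrightarrow> \<xi> i x = 0" for i using test_functions_boundE[OF assms[of i]] by metis
    then obtain R where "\<And>i x. norm x > R i \<Longrightarrow> \<xi> i x = 0" by metis
    moreover have "R i \<le> Max (range R)" for i by simp
    ultimately show ?thesis by (intro exI[of _ "Max (range R)"]) (meson le_less_trans)
  qed
  then obtain R where R: "\<And>i x. norm x > R \<Longrightarrow> \<xi> i x = 0" by blast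
  show ?thesis
  proof (rule test_functionsI[where R="real CARD('a) * R"])
    show "smooth (fun_tensor \<xi>)"
      unfolding fun_tensor_def using assms by (intro smooth_prod smooth_nth test_functions_smooth)
    fix x assume "fun_tensor \<xi> x \<noteq> 0"
    then have "norm (x $ i) \<le> R" for i using R[of "x $ i" i] by (fastforce simp: fun_tensor_def)
    then have "(\<Sum>i\<in>UNIV. norm (x $ i)) \<le> (\<Sum>i\<in>(UNIV::'a set). R)" by (intro sum_mono)
    then show "norm x \<le> real CARD('a) * R"
      using L2_set_le_sum[of UNIV "\<lambda>i. norm (x $ i)"] by (simp add: norm_vec_def)
  qed
qed

text \<open>A smooth function of \<open>norm y\<close> that equals one for \<open>(norm y)\<^sup>2 \<le> R\<close> and vanishes for
  \<open>(norm y)\<^sup>2 \<ge> R + 1\<close>.\<close>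

definition cutoff :: "real \<Rightarrow> 'a::euclidean_space \<Rightarrow> real" where
  "cutoff R y = flat_exp 0 (R + 1 - (norm y)\<^sup>2) * inverse (flat_exp 0 (R + 1 - (norm y)\<^sup>2) + flat_exp 0 ((norm y)\<^sup>2 - R))"

lemma flat0_pos: "s > 0 \<Longrightarrow> flat_exp 0 s > 0" and flat0_nonneg: "flat_exp 0 s \<ge> 0" and flat0_zero: "s \<le> 0 \<Longrightarrow> flat_exp 0 s = 0"
  by (auto simp: flat_exp_def)

lemma smooth_cutoff: "smooth (cutoff R :: 'a::euclidean_space \<Rightarrow> real)"
proof -
  have "flat_exp 0 (R + 1 - t) + flat_exp 0 (t - R) > 0" for t
    using flat0_pos[of "R + 1 - t"] flat0_pos[of "t - R"] flat0_nonneg[of "R + 1 - t"] flat0_nonneg[of "t - R"]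
    by (cases "t > R") linarith+
  then show ?thesis unfolding cutoff_def
    by (intro smooth_mult smooth_inverse smooth_add smooth_flat smooth_diff smooth_const smooth_norm_sq)
qed

lemma cutoff_eq_1: "(norm y)\<^sup>2 \<le> R \<Longrightarrow> cutoff R y = 1"
  using flat0_pos[of "R + 1 - (norm y)\<^sup>2"] by (simp add: cutoff_def flat0_zero)

lemma cutoff_eq_0: "(norm y)\<^sup>2 \<ge> R + 1 \<Longrightarrow> cutoff R y = 0"
  by (simp add: cutoff_def flat0_zero)

lemma cutoff_test: "cutoff R \<in> test_functions"
proof (rule test_functionsI[where R = "sqrt (R + 1)"])
  fix y :: 'a assume "cutoff R y \<noteq> 0"
  then have "(norm y)\<^sup>2 \<le> R + 1" using cutoff_eq_0[of R y] by linarith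
  then show "norm y \<le> sqrt (R + 1)" by (rule real_le_rsqrt)
qed (rule smooth_cutoff)

text \<open>Weights grow as fast as desired.  The witness is a locally finite sum of flat functions
  of \<open>(norm y)\<^sup>2\<close>, the \<open>k\<close>-th of which is supported in \<open>(norm y)\<^sup>2 \<ge> k - 1\<close>.\<close>

lemma weight_dominating:
  fixes A :: "nat \<Rightarrow> real"
  shows "\<exists>\<phi> \<in> weights. \<forall>y::'a::euclidean_space. \<forall>k. real k \<le> (norm y)\<^sup>2 \<and> (norm y)\<^sup>2 \<le> real (Suc k) \<longrightarrow> A k \<le> \<phi> y"
proof -
  define T where "T = (\<lambda>k (y::'a). \<bar>A k\<bar> * exp 1 * flat_exp 0 ((norm y)\<^sup>2 - real k + 1))"
  define \<phi> where "\<phi> = (\<lambda>y. 1 + (\<Sum>k<nat \<lceil>(norm y)\<^sup>2\<rceil> + 2. T k y))"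
  have T0: "T k y = 0" if "(norm y)\<^sup>2 + 1 \<le> real k" for k y
    using that by (simp add: T_def flat0_zero)
  have Tnn: "T k y \<ge> 0" for k y by (simp add: T_def flat0_nonneg)
  \<comment> \<open>the upper limit of summation in \<open>\<phi>\<close> depends on \<open>y\<close>, but may be enlarged at will\<close>
  have eq: "\<phi> y = 1 + (\<Sum>k<K. T k y)" if "(norm y)\<^sup>2 + 1 \<le> real K" for K y
  proof -
    define M where "M = nat \<lceil>(norm y)\<^sup>2\<rceil> + 2"
    have M: "(norm y)\<^sup>2 + 1 \<le> real M" unfolding M_def by linarith
    have "(\<Sum>k<M. T k y) = (\<Sum>k<max M K. T k y)"
      by (rule sum.mono_neutral_left) (use M in \<open>auto intro!: T0\<close>)
    moreover have "(\<Sum>k<K. T k y) = (\<Sum>k<max M K. T k y)"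
      by (rule sum.mono_neutral_left) (use that in \<open>auto intro!: T0\<close>)
    ultimately show ?thesis by (simp add: \<phi>_def M_def)
  qed
  have "smooth \<phi>"
  proof (rule smooth_local)
    fix x :: 'a
    obtain K where K: "(norm x)\<^sup>2 + 1 < real K" using reals_Archimedean2 by blast
    let ?U = "{y. (norm y)\<^sup>2 + 1 < real K}"
    have "open ?U" by (intro open_Collect_less continuous_intros)
    moreover have "smooth (\<lambda>y. 1 + (\<Sum>k<K. T k y))"
      unfolding T_def by (intro smooth_add smooth_sum smooth_mult smooth_const smooth_flat smooth_diff smooth_norm_sq)
    ultimately show "\<exists>U g. open U \<and> x \<in> U \<and> smooth g \<and> (\<forall>y\<in>U. \<phi> y = g y)"
      using K eq by (intro exI[of _ ?U] exI[of _ "\<lambda>y. 1 + (\<Sum>k<K. T k y)"]) auto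
  qed
  moreover have "1 \<le> \<phi> y" for y unfolding \<phi>_def by (simp add: sum_nonneg Tnn)
  moreover have "A k \<le> \<phi> y" if k: "real k \<le> (norm y)\<^sup>2" for y k
  proof -
    obtain K where K: "(norm y)\<^sup>2 + 1 \<le> real K" using real_arch_simple by blast
    have "exp (-1) \<le> flat_exp 0 ((norm y)\<^sup>2 - real k + 1)"
      using k by (auto simp: flat_exp_def field_simps)
    then have "\<bar>A k\<bar> * (exp 1 * exp (-1)) \<le> \<bar>A k\<bar> * (exp 1 * flat_exp 0 ((norm y)\<^sup>2 - real k + 1))"
      by (intro mult_left_mono) auto
    then have "A k \<le> T k y" unfolding T_def mult_exp_exp by simp
    also have "T k y \<le> (\<Sum>k<K. T k y)"
      using k K by (intro member_le_sum) (auto simp: Tnn)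
    finally show ?thesis using eq[OF K] by linarith
  qed
  ultimately show ?thesis unfolding weights_def by (intro bexI[of _ \<phi>]) auto
qed

section \<open>A Sobolev inequality by integration over orthants\<close>

text \<open>The half-line with end point \<open>a\<close> that leads away from the origin.\<close>

definition half_line :: "real \<Rightarrow> real set" where
  "half_line a = (if a \<ge> 0 then {a..} else {..a})"

lemma half_line_borel [measurable]: "half_line a \<in> sets borel"
  by (simp add: half_line_def)

lemma half_line_abs: "t \<in> half_line a \<Longrightarrow> \<bar>a\<bar> \<le> \<bar>t\<bar>"
  by (auto simp: half_line_def split: if_splits)

lemma abs_le_half_line_integral:
  fixes f :: "'a::euclidean_space \<Rightarrow> real"
  assumes f: "smooth f" and R: "\<And>x. norm x > R \<Longrightarrow> f x = 0" and b: "b \<in> Basis"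
  shows "ennreal \<bar>f q\<bar> \<le> (\<integral>\<^sup>+ t. indicator (half_line (q \<bullet> b)) t * ennreal \<bar>partial b f (q + (t - q \<bullet> b) *\<^sub>R b)\<bar> \<partial>lborel)"
proof -
  define g where "g = (\<lambda>t. f (q + (t - q \<bullet> b) *\<^sub>R b))"
  define g' where "g' = (\<lambda>t. partial b f (q + (t - q \<bullet> b) *\<^sub>R b))"
  have d: "(g has_real_derivative g' t) (at t)" for t
  proof -
    have "((\<lambda>t. f ((q - (q \<bullet> b) *\<^sub>R b) + t *\<^sub>R b)) has_real_derivative partial b f ((q - (q \<bullet> b) *\<^sub>R b) + t *\<^sub>R b)) (at t)"
      by (rule smooth_line_deriv[OF f])
    then show ?thesis by (simp add: g_def g'_def algebra_simps)
  qed
  have cont: "isCont g' t" for t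
  proof -
    have 1: "isCont (partial b f) y" for y
      by (rule differentiable_imp_continuous_within[OF smooth_differentiable[OF smooth_partial[OF f b]]])
    have 2: "isCont (\<lambda>t. q + (t - q \<bullet> b) *\<^sub>R b) t" by (intro continuous_intros)
    show ?thesis unfolding g'_def by (rule isCont_o2[OF 2 1])
  qed
  have g0: "g t = 0" if "\<bar>t\<bar> > R" for t
  proof -
    have "(q + (t - q \<bullet> b) *\<^sub>R b) \<bullet> b = t" using b by (simp add: inner_add_left)
    then have "norm (q + (t - q \<bullet> b) *\<^sub>R b) > R"
      using Basis_le_norm[OF b, of "q + (t - q \<bullet> b) *\<^sub>R b"] that by linarith
    then show ?thesis using R by (simp add: g_def)
  qed
  have key: "ennreal \<bar>g v - g u\<bar> \<le> (\<integral>\<^sup>+ t. indicator {u..v} t * ennreal \<bar>g' t\<bar> \<partial>lborel)" if "u \<le> v" for u v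
  proof -
    have "has_bochner_integral lborel (\<lambda>x. g' x * indicator {u..v} x) (g v - g u)"
      using that d cont by (intro has_bochner_integral_FTC_Icc_real) auto
    then have i: "integrable lborel (\<lambda>x. g' x * indicator {u..v} x)"
      and e: "(\<integral>x. g' x * indicator {u..v} x \<partial>lborel) = g v - g u"
      by (auto simp: has_bochner_integral_iff)
    have "ennreal \<bar>g v - g u\<bar> \<le> (\<integral>\<^sup>+ x. norm (g' x * indicator {u..v} x) \<partial>lborel)"
      using integral_norm_bound_ennreal[OF i] by (simp add: e)
    also have "\<dots> = (\<integral>\<^sup>+ t. indicator {u..v} t * ennreal \<bar>g' t\<bar> \<partial>lborel)"
      by (intro nn_integral_cong) (auto split: split_indicator)
    finally show ?thesis .
  qed
  define a where "a = q \<bullet> b"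
  have ga: "g a = f q" by (simp add: g_def a_def)
  \<comment> \<open>one end is \<open>a\<close>, the other lies so far out that \<open>g\<close> vanishes there\<close>
  obtain u v where uv: "u \<le> v" "{u..v} \<subseteq> half_line a" "\<bar>f q\<bar> = \<bar>g v - g u\<bar>"
  proof (cases "a \<ge> 0")
    case True
    have "g (max a (\<bar>R\<bar> + 1)) = 0" by (rule g0) linarith
    with True ga show ?thesis by (intro that[of a "max a (\<bar>R\<bar> + 1)"]) (auto simp: half_line_def)
  next
    case False
    have "g (min a (- \<bar>R\<bar> - 1)) = 0" by (rule g0) linarith
    with False ga show ?thesis by (intro that[of "min a (- \<bar>R\<bar> - 1)" a]) (auto simp: half_line_def)
  qed
  have "ennreal \<bar>f q\<bar> \<le> (\<integral>\<^sup>+ t. indicator {u..v} t * ennreal \<bar>g' t\<bar> \<partial>lborel)"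
    using key[OF uv(1)] uv(3) by simp
  also have "\<dots> \<le> (\<integral>\<^sup>+ t. indicator (half_line a) t * ennreal \<bar>g' t\<bar> \<partial>lborel)"
    using uv(2) by (intro nn_integral_mono mult_right_mono) (auto split: split_indicator)
  finally show ?thesis by (simp add: a_def g'_def)
qed

interpretation lborel_product: product_sigma_finite "\<lambda>_. lborel :: real measure"
  by standard

text \<open>The point with coordinates \<open>t b\<close> for \<open>b \<in> S\<close> and the coordinates of \<open>p\<close> elsewhere.\<close>

definition mix :: "'a::euclidean_space \<Rightarrow> 'a set \<Rightarrow> ('a \<Rightarrow> real) \<Rightarrow> 'a" where
  "mix p S t = (\<Sum>b\<in>Basis. (if b \<in> S then t b else p \<bullet> b) *\<^sub>R b)"

lemma mix_inner: "b \<in> Basis \<Longrightarrow> mix p S t \<bullet> b = (if b \<in> S then t b else p \<bullet> b)"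
  unfolding mix_def by (subst inner_sum_left_Basis) auto

lemma mix_measurable [measurable]:
  "mix p S \<in> borel_measurable (Pi\<^sub>M S (\<lambda>_. lborel))"
  unfolding mix_def
proof (intro borel_measurable_sum borel_measurable_scaleR measurable_const)
  fix b show "(\<lambda>x. if b \<in> S then x b else p \<bullet> b) \<in> borel_measurable (Pi\<^sub>M S (\<lambda>_. lborel))"
    by (cases "b \<in> S") (auto intro: measurable_component_singleton)
qed auto

text \<open>Integration along one coordinate direction after the other; the remaining coordinates stay at
  those of \<open>p\<close>.\<close>

lemma abs_le_partial_orthant_integral:
  fixes f :: "'a::euclidean_space \<Rightarrow> real"
  assumes f: "smooth f" and R: "\<And>x. norm x > R \<Longrightarrow> f x = 0"
    and "distinct bs" "set bs \<subseteq> Basis"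
  shows "ennreal \<bar>f p\<bar> \<le>
    (\<integral>\<^sup>+ t. (\<Prod>b\<in>set bs. indicator (half_line (p \<bullet> b)) (t b)) * ennreal \<bar>iter_deriv bs f (mix p (set bs) t)\<bar> \<partial>Pi\<^sub>M (set bs) (\<lambda>_. lborel))"
  using assms(3,4)
proof (induction bs)
  case Nil
  then show ?case by (simp add: PiM_empty nn_integral_count_space_finite mix_def euclidean_representation)
next
  case (Cons b bs)
  let ?S = "set bs" and ?g = "iter_deriv bs f"
  let ?h = "partial b ?g"
  have b: "b \<in> Basis" "b \<notin> ?S" and bs: "bs \<in> lists Basis" using Cons.prems by auto
  have g: "smooth ?g" and h: "smooth ?h" using f bs b by (auto intro: smooth_iter_deriv smooth_partial)
  have [measurable]: "?h \<in> borel_measurable borel" by (rule smooth_measurable[OF h])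
  have mix: "mix p ?S t + (s - p \<bullet> b) *\<^sub>R b = mix p (insert b ?S) (t(b := s))" for t s
    by (rule euclidean_eqI) (use b in \<open>auto simp: mix_inner inner_add_left inner_Basis\<close>)
  have "ennreal \<bar>f p\<bar> \<le>
    (\<integral>\<^sup>+ t. (\<Prod>b\<in>?S. indicator (half_line (p \<bullet> b)) (t b)) * ennreal \<bar>?g (mix p ?S t)\<bar> \<partial>Pi\<^sub>M ?S (\<lambda>_. lborel))"
    using Cons by simp
  also have "\<dots> \<le> (\<integral>\<^sup>+ t. (\<Prod>b\<in>?S. indicator (half_line (p \<bullet> b)) (t b)) *
      (\<integral>\<^sup>+ s. indicator (half_line (p \<bullet> b)) s * ennreal \<bar>?h (mix p (insert b ?S) (t(b := s)))\<bar> \<partial>lborel) \<partial>Pi\<^sub>M ?S (\<lambda>_. lborel))"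
    using abs_le_half_line_integral[OF g iter_deriv_outside[OF R] b(1), where q = "mix p ?S t" for t] b
    by (intro nn_integral_mono mult_left_mono) (auto simp: mix_inner mix)
  also have "\<dots> = (\<integral>\<^sup>+ t. (\<integral>\<^sup>+ s. (\<Prod>c\<in>insert b ?S. indicator (half_line (p \<bullet> c)) ((t(b := s)) c)) *
      ennreal \<bar>?h (mix p (insert b ?S) (t(b := s)))\<bar> \<partial>lborel) \<partial>Pi\<^sub>M ?S (\<lambda>_. lborel))"
  proof (rule nn_integral_cong)
    fix t assume t: "t \<in> space (Pi\<^sub>M ?S (\<lambda>_. lborel :: real measure))"
    have [measurable]: "(\<lambda>s. mix p (insert b ?S) (t(b := s))) \<in> borel_measurable lborel"
      unfolding mix[symmetric] by measurable
    have pr: "(\<Prod>c\<in>?S. indicator (half_line (p \<bullet> c)) ((t(b := s)) c)) = (\<Prod>c\<in>?S. indicator (half_line (p \<bullet> c)) (t c) :: ennreal)" for s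
      using b by (intro prod.cong) auto
    show "(\<Prod>b\<in>?S. indicator (half_line (p \<bullet> b)) (t b)) *
      (\<integral>\<^sup>+ s. indicator (half_line (p \<bullet> b)) s * ennreal \<bar>?h (mix p (insert b ?S) (t(b := s)))\<bar> \<partial>lborel)
      = (\<integral>\<^sup>+ s. (\<Prod>c\<in>insert b ?S. indicator (half_line (p \<bullet> c)) ((t(b := s)) c)) *
        ennreal \<bar>?h (mix p (insert b ?S) (t(b := s)))\<bar> \<partial>lborel)"
      using b by (subst nn_integral_cmult[symmetric]) (auto simp: pr mult_ac fun_upd_same simp del: fun_upd_apply)
  qed
  also have "\<dots> = (\<integral>\<^sup>+ t. (\<Prod>c\<in>insert b ?S. indicator (half_line (p \<bullet> c)) (t c)) *
      ennreal \<bar>?h (mix p (insert b ?S) t)\<bar> \<partial>Pi\<^sub>M (insert b ?S) (\<lambda>_. lborel))"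
    using b by (intro lborel_product.product_nn_integral_insert[symmetric]) measurable
  finally show ?case by (simp add: partial_def)
qed

text \<open>The orthant with corner \<open>p\<close> in which every coordinate leads away from the origin.\<close>

definition orthant :: "'a::euclidean_space \<Rightarrow> 'a set" where
  "orthant p = {x. \<forall>b\<in>Basis. x \<bullet> b \<in> half_line (p \<bullet> b)}"

lemma orthant_norm: "x \<in> orthant p \<Longrightarrow> norm p \<le> norm x"
  by (rule norm_le_componentwise) (auto simp: orthant_def intro: half_line_abs)

lemma indicator_orthant: "indicator (orthant p) x = (\<Prod>b\<in>Basis. indicator (half_line (p \<bullet> b)) (x \<bullet> b) :: ennreal)"
proof (cases "x \<in> orthant p")
  case True then show ?thesis by (auto simp: orthant_def intro!: prod.neutral[symmetric])
next
  case False
  then obtain b where "b \<in> Basis" "x \<bullet> b \<notin> half_line (p \<bullet> b)" by (auto simp: orthant_def)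
  then have "(\<Prod>b\<in>Basis. indicator (half_line (p \<bullet> b)) (x \<bullet> b) :: ennreal) = 0"
    by (intro prod_zero bexI[of _ b]) auto
  then show ?thesis using False by simp
qed

lemma orthant_borel [measurable]: "orthant p \<in> sets borel"
proof -
  have "orthant p = (\<Inter>b\<in>Basis. (\<lambda>x. x \<bullet> b) -` half_line (p \<bullet> b) \<inter> space borel)"
    by (auto simp: orthant_def)
  also have "\<dots> \<in> sets borel"
    by (intro sets.countable_INT'' measurable_sets[OF _ half_line_borel] sets.finite_INT) auto
  finally show ?thesis .
qed

lemma abs_le_orthant_integral:
  fixes f :: "'a::euclidean_space \<Rightarrow> real"
  assumes f: "f \<in> test_functions" and bs: "distinct bs" "set bs = Basis"
  shows "ennreal \<bar>f p\<bar> \<le> (\<integral>\<^sup>+ x. indicator (orthant p) x * ennreal \<bar>iter_deriv bs f x\<bar> \<partial>lborel)"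
proof -
  obtain R where R: "\<And>x. norm x > R \<Longrightarrow> f x = 0" using test_functions_boundE[OF f] by blast
  have sm: "smooth (iter_deriv bs f)" using f bs by (intro smooth_iter_deriv test_functions_smooth) auto
  have [measurable]: "iter_deriv bs f \<in> borel_measurable borel" by (rule smooth_measurable[OF sm])
  have mixB: "mix p Basis t = (\<Sum>b\<in>Basis. t b *\<^sub>R b)" for t by (simp add: mix_def)
  have "ennreal \<bar>f p\<bar> \<le> (\<integral>\<^sup>+ t. (\<Prod>b\<in>Basis. indicator (half_line (p \<bullet> b)) (t b)) *
      ennreal \<bar>iter_deriv bs f (mix p Basis t)\<bar> \<partial>Pi\<^sub>M Basis (\<lambda>_. lborel))"
    using abs_le_partial_orthant_integral[OF test_functions_smooth[OF f] R bs(1)] bs(2) by simp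
  also have "\<dots> = (\<integral>\<^sup>+ t. indicator (orthant p) (mix p Basis t) *
      ennreal \<bar>iter_deriv bs f (mix p Basis t)\<bar> \<partial>Pi\<^sub>M Basis (\<lambda>_. lborel))"
    by (intro nn_integral_cong) (simp add: indicator_orthant mix_inner)
  also have "\<dots> = (\<integral>\<^sup>+ x. indicator (orthant p) x * ennreal \<bar>iter_deriv bs f x\<bar> \<partial>lborel)"
    unfolding mixB by (subst lborel_eq) (subst nn_integral_distr, auto)
  finally show ?thesis .
qed

lemma nn_integral_inverse_1_plus_square_finite:
  "(\<integral>\<^sup>+ t. ennreal (inverse (1 + t\<^sup>2)) \<partial>lborel) < \<infinity>"
proof -
  have "integrable lborel (\<lambda>x::real. inverse (1 + x\<^sup>2))"
    using integrable_inverse_1_plus_square by (simp add: set_integrable_def)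
  then show ?thesis by (subst (asm) integrable_iff_bounded) auto
qed

text \<open>A positive integrable function that factorizes over the coordinates.\<close>

definition decay :: "'a::euclidean_space \<Rightarrow> real" where
  "decay x = (\<Prod>b\<in>Basis. inverse (1 + (x \<bullet> b)\<^sup>2))"

lemma decay_pos: "decay x > 0"
  unfolding decay_def by (intro prod_pos) (simp add: add_pos_nonneg)

lemma decay_borel [measurable]: "decay \<in> borel_measurable borel"
  unfolding decay_def by measurable

lemma nn_integral_decay_finite: "(\<integral>\<^sup>+ x. ennreal (decay (x::'a::euclidean_space)) \<partial>lborel) < \<infinity>"
proof -
  have "(\<integral>\<^sup>+ x. ennreal (decay (x::'a)) \<partial>lborel)
     = (\<integral>\<^sup>+ x. (\<Prod>b\<in>Basis. (\<lambda>t. ennreal (inverse (1 + t\<^sup>2))) (x \<bullet> b)) \<partial>(lborel :: 'a measure))"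
    unfolding decay_def by (intro nn_integral_cong) (simp add: prod_ennreal)
  also have "\<dots> = (\<Prod>b\<in>(Basis::'a set). (\<integral>\<^sup>+ t. ennreal (inverse (1 + t\<^sup>2)) \<partial>lborel))"
    by (rule nn_integral_lborel_prod[where f = "\<lambda>_ t. ennreal (inverse (1 + t\<^sup>2))"]) auto
  also have "\<dots> < \<infinity>"
    using nn_integral_inverse_1_plus_square_finite by (simp add: power_less_top_ennreal)
  finally show ?thesis .
qed

text \<open>\<open>N\<close> bounds the number of points \<open>p j\<close> whose orthant contains \<open>x\<close>.  The constant does not depend
  on \<open>J\<close>, so the inequality also controls infinite families of points.\<close>

lemma sum_abs_le_weighted_norm:
  fixes p :: "'j \<Rightarrow> 'a::euclidean_space" and N w :: "'a \<Rightarrow> real"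
  assumes J: "finite J"
    and N: "\<And>x. real (card {j \<in> J. x \<in> orthant (p j)}) \<le> N x" 
    and w: "smooth w" "\<And>x. w x > 0" "\<And>x. (N x)\<^sup>2 \<le> w x * decay x"
    and L: "finite L" "bs \<in> L" "distinct bs" "set bs = Basis"
    and f: "f \<in> test_functions"
  shows "(\<Sum>j\<in>J. \<bar>f (p j)\<bar>) \<le> sqrt (enn2real (\<integral>\<^sup>+ x. ennreal (decay (x::'a)) \<partial>lborel)) * weighted_norm L w f"
proof -
  let ?h = "iter_deriv bs f"
  let ?D = "\<integral>\<^sup>+ x. ennreal (decay (x::'a)) \<partial>lborel"
  have bs: "bs \<in> lists Basis" using L by auto
  have h: "?h \<in> test_functions" using f bs by (rule test_functions_iter_deriv)
  have [measurable]: "?h \<in> borel_measurable borel" "w \<in> borel_measurable borel"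
    using smooth_measurable[OF test_functions_smooth[OF h]] smooth_measurable[OF w(1)] by auto
  have int: "integrable lborel (\<lambda>x. (?h x)\<^sup>2 * w x)"
  proof -
    obtain R where R: "\<And>x. norm x > R \<Longrightarrow> ?h x = 0" using test_functions_boundE[OF h] by blast
    have "smooth (\<lambda>x. (?h x)\<^sup>2 * w x)" by (rule smooth_mult[OF smooth_power[OF test_functions_smooth[OF h]] w(1)])
    then have "integrable lborel (\<lambda>x. indicator (cball 0 R) x *\<^sub>R ((?h x)\<^sup>2 * w x))"
      by (intro borel_integrable_compact smooth_continuous) auto
    moreover have "(\<lambda>x. indicator (cball 0 R) x *\<^sub>R ((?h x)\<^sup>2 * w x)) = (\<lambda>x. (?h x)\<^sup>2 * w x)"
      using R by (auto simp: fun_eq_iff not_le[symmetric] split: split_indicator)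
    ultimately show ?thesis by (simp only:)
  qed
  define I where "I = (\<integral>x. (?h x)\<^sup>2 * w x \<partial>lborel)"
  have I0: "I \<ge> 0" unfolding I_def using w(2) by (intro Bochner_Integration.integral_nonneg mult_nonneg_nonneg) (auto simp: less_imp_le)
  have nnI: "(\<integral>\<^sup>+ x. ennreal ((?h x)\<^sup>2 * w x) \<partial>lborel) = ennreal I"
    unfolding I_def using w(2) by (intro nn_integral_eq_integral int) (simp add: less_imp_le)
  have "ennreal (\<Sum>j\<in>J. \<bar>f (p j)\<bar>) = (\<Sum>j\<in>J. ennreal \<bar>f (p j)\<bar>)" by simp
  also have "\<dots> \<le> (\<Sum>j\<in>J. \<integral>\<^sup>+ x. indicator (orthant (p j)) x * ennreal \<bar>?h x\<bar> \<partial>lborel)"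
    by (intro sum_mono abs_le_orthant_integral f L)
  also have "\<dots> = (\<integral>\<^sup>+ x. (\<Sum>j\<in>J. indicator (orthant (p j)) x * ennreal \<bar>?h x\<bar>) \<partial>lborel)"
    by (intro nn_integral_sum[symmetric]) measurable
  also have "\<dots> \<le> (\<integral>\<^sup>+ x. ennreal (sqrt (decay x)) * ennreal (\<bar>?h x\<bar> * sqrt (w x)) \<partial>lborel)"
  proof (rule nn_integral_mono)
    fix x
    have "(\<Sum>j\<in>J. indicator (orthant (p j)) x) = ennreal (real (card {j \<in> J. x \<in> orthant (p j)}))"
      using J by (simp add: indicator_def sum.If_cases Int_def ennreal_of_nat_eq_real_of_nat)
    also have "\<dots> \<le> ennreal (sqrt (w x * decay x))"
      using N[of x] w(3)[of x] by (intro ennreal_leI) (meson order_trans real_le_rsqrt)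
    finally have "(\<Sum>j\<in>J. indicator (orthant (p j)) x) * ennreal \<bar>?h x\<bar> \<le> ennreal (sqrt (w x * decay x)) * ennreal \<bar>?h x\<bar>"
      by (rule mult_right_mono) simp
    then show "(\<Sum>j\<in>J. indicator (orthant (p j)) x * ennreal \<bar>?h x\<bar>) \<le> ennreal (sqrt (decay x)) * ennreal (\<bar>?h x\<bar> * sqrt (w x))"
      using w(2)[of x] decay_pos[of x] by (simp add: sum_distrib_right[symmetric] real_sqrt_mult ennreal_mult'[symmetric] mult_ac less_imp_le)
  qed
  finally have 1: "ennreal (\<Sum>j\<in>J. \<bar>f (p j)\<bar>) \<le> \<dots>" .
  have "(ennreal (\<Sum>j\<in>J. \<bar>f (p j)\<bar>))\<^sup>2 \<le> (\<integral>\<^sup>+ x. ennreal (sqrt (decay x)) * ennreal (\<bar>?h x\<bar> * sqrt (w x)) \<partial>lborel)\<^sup>2"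
    using 1 by (rule power_mono) simp
  also have "\<dots> \<le> (\<integral>\<^sup>+ x. (ennreal (sqrt (decay (x::'a))))\<^sup>2 \<partial>lborel) * (\<integral>\<^sup>+ x. (ennreal (\<bar>?h x\<bar> * sqrt (w x)))\<^sup>2 \<partial>lborel)"
    using Cauchy_Schwarz_nn_integral[of "\<lambda>x. ennreal (sqrt (decay x))" lborel "\<lambda>x. ennreal (\<bar>?h x\<bar> * sqrt (w x))"]
    by measurable
  also have "(\<integral>\<^sup>+ x. (ennreal (sqrt (decay (x::'a))))\<^sup>2 \<partial>lborel) = ?D"
    by (intro nn_integral_cong) (simp add: ennreal_power less_imp_le[OF decay_pos])
  also have "(\<integral>\<^sup>+ x. (ennreal (\<bar>?h x\<bar> * sqrt (w x)))\<^sup>2 \<partial>lborel) = ennreal I"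
    unfolding nnI[symmetric] using w(2) 
    by (intro nn_integral_cong) (simp add: ennreal_power power_mult_distrib less_imp_le)
  also have "?D = ennreal (enn2real ?D)" using nn_integral_decay_finite[where 'a='a] by simp
  finally have "ennreal ((\<Sum>j\<in>J. \<bar>f (p j)\<bar>)\<^sup>2) \<le> ennreal (enn2real ?D * I)"
    using I0 by (simp add: ennreal_power ennreal_mult' sum_nonneg)
  then have "(\<Sum>j\<in>J. \<bar>f (p j)\<bar>)\<^sup>2 \<le> enn2real ?D * I"
    using I0 by (subst (asm) ennreal_le_iff) auto
  then have "(\<Sum>j\<in>J. \<bar>f (p j)\<bar>) \<le> sqrt (enn2real ?D) * sqrt I"
    unfolding real_sqrt_mult[symmetric] by (rule real_le_rsqrt)
  also have "sqrt I \<le> weighted_norm L w f"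
    unfolding weighted_norm_def I_def using L w(2)
    by (intro real_sqrt_le_mono member_le_sum[of bs L "\<lambda>bs. \<integral>x. (iter_deriv bs f x)\<^sup>2 * w x \<partial>lborel"] Bochner_Integration.integral_nonneg)
      (auto simp: less_imp_le)
  finally show ?thesis by (simp add: mult_left_mono)
qed

section \<open>Density of tensor products of test functions\<close>

text \<open>The divided power \<open>(t + R)\<^sup>k / k!\<close>, centred at the lower end \<open>- R\<close> of the interval from \<open>- R\<close> to \<open>R\<close>.
  Its derivative is the divided power of exponent \<open>k - 1\<close>, so antiderivatives that vanish at \<open>- R\<close>
  are index shifts.\<close>

definition divided_power :: "real \<Rightarrow> nat \<Rightarrow> real \<Rightarrow> real" where
  "divided_power R k t = (t + R) ^ k / fact k"

text \<open>The product over the coordinates of divided powers; \<open>k b\<close> is the exponent in direction \<open>b\<close>.\<close>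

definition divided_monomial :: "real \<Rightarrow> ('a::euclidean_space \<Rightarrow> nat) \<Rightarrow> 'a \<Rightarrow> real" where
  "divided_monomial R k x = (\<Prod>b\<in>Basis. divided_power R (k b) (x \<bullet> b))"

lemma smooth_divided_power_inner: "smooth (\<lambda>x. divided_power R k (x \<bullet> b))"
  unfolding divided_power_def divide_inverse by (intro smooth_mult smooth_power smooth_add smooth_inner smooth_const)

lemma smooth_divided_monomial: "smooth (divided_monomial R k)"
  unfolding divided_monomial_def by (intro smooth_prod smooth_divided_power_inner)

lemma divided_power_deriv: "(divided_power R (Suc k) has_real_derivative divided_power R k t) (at t)"
proof -
  have 1: "((\<lambda>t. (t + R) ^ Suc k * inverse (fact (Suc k))) has_real_derivative
      ((1 + real k) * (1 * (t + R) ^ k)) * inverse (fact (Suc k))) (at t)"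
    by (intro DERIV_cmult_right DERIV_power_Suc) (auto intro!: derivative_eq_intros)
  have 2: "((1 + real k) * (1 * (t + R) ^ k)) * inverse (fact (Suc k)) = (t + R) ^ k * inverse (fact k)"
    by (simp add: divide_simps)
  show ?thesis
    unfolding divided_power_def[abs_def] divide_inverse using 1 unfolding 2 .
qed

lemma partial_divided_monomial:
  assumes c: "c \<in> Basis" and k: "k c > 0"
  shows "partial c (divided_monomial R k) = divided_monomial R (k(c := k c - 1))"
proof
  fix x
  let ?P = "\<Prod>b\<in>Basis - {c}. divided_power R (k b) (x \<bullet> b)"
  obtain j where j: "k c = Suc j" using k by (cases "k c") auto
  have split: "divided_monomial R l (x + t *\<^sub>R c) = divided_power R (l c) (x \<bullet> c + t) * (\<Prod>b\<in>Basis - {c}. divided_power R (l b) (x \<bullet> b))" for t l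
  proof -
    have "(\<Prod>b\<in>Basis - {c}. divided_power R (l b) ((x + t *\<^sub>R c) \<bullet> b)) = (\<Prod>b\<in>Basis - {c}. divided_power R (l b) (x \<bullet> b))"
      using c by (intro prod.cong) (auto simp: inner_add_left inner_Basis)
    then show ?thesis
      unfolding divided_monomial_def using c by (subst prod.remove[of _ c]) (auto simp: inner_add_left)
  qed
  have "((\<lambda>t. divided_power R (k c) (x \<bullet> c + t) * ?P) has_real_derivative divided_power R j (x \<bullet> c + 0) * 1 * ?P) (at 0)"
    unfolding j by (intro DERIV_cmult_right DERIV_chain2[OF divided_power_deriv]) (auto intro!: derivative_eq_intros)
  moreover have "((\<lambda>t. divided_monomial R k (x + t *\<^sub>R c)) has_real_derivative partial c (divided_monomial R k) (x + 0 *\<^sub>R c)) (at 0)"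
    by (rule smooth_line_deriv[OF smooth_divided_monomial])
  ultimately have "partial c (divided_monomial R k) x = divided_power R j (x \<bullet> c) * ?P"
    unfolding split by (metis (no_types, lifting) DERIV_unique add.right_neutral mult.right_neutral scaleR_zero_left)
  also have "\<dots> = divided_monomial R (k(c := k c - 1)) x"
    using split[of "k(c := k c - 1)" 0] j by simp
  finally show "partial c (divided_monomial R k) x = divided_monomial R (k(c := k c - 1)) x" .
qed

lemma iter_deriv_divided_monomial:
  "bs \<in> lists Basis \<Longrightarrow> (\<And>b. b \<in> Basis \<Longrightarrow> count_list bs b \<le> k b) \<Longrightarrow>
   iter_deriv bs (divided_monomial R k) = divided_monomial R (\<lambda>b. k b - count_list bs b)"
proof (induction bs rule: list.induct)
  case (Cons c bs)
  have c: "c \<in> Basis" "count_list bs c < k c" using Cons.prems(1) Cons.prems(2)[of c] by auto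
  have "count_list bs b \<le> k b" if "b \<in> Basis" for b
    using Cons.prems(2)[OF that] by (auto split: if_splits)
  then have "iter_deriv (c # bs) (divided_monomial R k) = partial c (divided_monomial R (\<lambda>b. k b - count_list bs b))"
    using Cons by (simp add: partial_def)
  also have "\<dots> = divided_monomial R ((\<lambda>b. k b - count_list bs b)(c := k c - count_list bs c - 1))"
    using c by (subst partial_divided_monomial) auto
  also have "(\<lambda>b. k b - count_list bs b)(c := k c - count_list bs c - 1) = (\<lambda>b. k b - count_list (c # bs) b)"
    by auto
  finally show ?case .
qed simp

text \<open>Polynomials that vanish to order at least \<open>m\<close> on each hyperplane \<open>x \<bullet> b = - R\<close>.\<close>

inductive_set poly_span :: "real \<Rightarrow> nat \<Rightarrow> ('a::euclidean_space \<Rightarrow> real) set" for R m where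
  mono: "divided_monomial R (\<lambda>b. k b + m) \<in> poly_span R m"
| scale: "f \<in> poly_span R m \<Longrightarrow> (\<lambda>x. c * f x) \<in> poly_span R m"
| add: "f \<in> poly_span R m \<Longrightarrow> g \<in> poly_span R m \<Longrightarrow> (\<lambda>x. f x + g x) \<in> poly_span R m"

lemma smooth_poly_span: "f \<in> poly_span R m \<Longrightarrow> smooth f"
  by (induction rule: poly_span.induct) (auto intro: smooth_divided_monomial smooth_mult smooth_const smooth_add)

lemma poly_span_face:
  assumes "f \<in> poly_span R m" "bs \<in> lists Basis" "\<And>b. b \<in> Basis \<Longrightarrow> count_list bs b \<le> m"
    and b: "b \<in> Basis" "count_list bs b < m" and x: "x \<bullet> b = - R"
  shows "iter_deriv bs f x = 0"
  using assms(1)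
proof (induction rule: poly_span.induct)
  case (mono k)
  have "iter_deriv bs (divided_monomial R (\<lambda>b. k b + m)) = divided_monomial R (\<lambda>b. k b + m - count_list bs b)"
    using assms(3) by (intro iter_deriv_divided_monomial assms(2)) (simp add: trans_le_add2)
  moreover have "divided_monomial R (\<lambda>b. k b + m - count_list bs b) x = 0"
    unfolding divided_monomial_def using b x by (intro prod_zero bexI[of _ b]) (auto simp: divided_power_def)
  ultimately show ?case by simp
qed (use assms(2) in \<open>simp_all add: iter_deriv_cmult iter_deriv_add smooth_poly_span\<close>)

lemma ex_full_list: "\<exists>M\<in>lists (Basis :: 'a::euclidean_space set). \<forall>b\<in>Basis. count_list M b = m"
proof (induction m)
  case 0 show ?case by (intro bexI[of _ "[]"]) auto
next
  case (Suc m)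
  then obtain M where M: "M \<in> lists (Basis :: 'a set)" "\<forall>b\<in>Basis. count_list M b = m" by blast
  obtain B where B: "set B = (Basis :: 'a set)" "distinct B" using finite_distinct_list finite_Basis by blast
  have "count_list B b = 1" if "b \<in> Basis" for b using that B
    by (metis count_mset distinct_count_atmost_1)
  then show ?case using M B by (intro bexI[of _ "B @ M"]) (auto simp: )
qed

lemma divided_monomial_mult: "divided_monomial R k x * divided_monomial R l x = (\<Prod>b\<in>Basis. fact (k b + l b) / (fact (k b) * fact (l b))) * divided_monomial R (\<lambda>b. k b + l b) x"
  unfolding divided_monomial_def prod.distrib[symmetric] by (intro prod.cong) (auto simp: divided_power_def power_add divide_simps)

text \<open>The derivatives of order \<open>m\<close> in every coordinate of the members of \<open>poly_span R m\<close> are all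
  polynomials, hence uniformly dense on compact sets.\<close>

lemma poly_span_dense:
  fixes g :: "'a::euclidean_space \<Rightarrow> real"
  assumes S: "compact S" and g: "continuous_on S g" and e: "e > 0"
    and M: "M \<in> lists Basis" "\<And>b. b \<in> Basis \<Longrightarrow> count_list M b = m"
  shows "\<exists>Q\<in>poly_span R m. \<forall>x\<in>S. \<bar>g x - iter_deriv M Q x\<bar> < e"
proof -
  let ?P = "\<lambda>p. \<exists>Q\<in>poly_span R m. p = iter_deriv M Q"
  have dm: "iter_deriv M (divided_monomial R (\<lambda>b. k b + m)) = divided_monomial R k" for k :: "'a \<Rightarrow> nat"
  proof -
    have "iter_deriv M (divided_monomial R (\<lambda>b. k b + m)) = divided_monomial R (\<lambda>b. k b + m - count_list M b)"
      using M by (intro iter_deriv_divided_monomial) auto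
    also have "\<dots> = divided_monomial R k" unfolding divided_monomial_def using M(2) by (intro ext prod.cong) auto
    finally show ?thesis .
  qed
  have Pm: "?P (divided_monomial R k)" for k by (intro bexI[of _ "divided_monomial R (\<lambda>b. k b + m)"] poly_span.mono dm[symmetric])
  have Ps: "?P (\<lambda>x. c * p x)" if Pp: "?P p" for c p
  proof -
    obtain Q where Q: "Q \<in> poly_span R m" "p = iter_deriv M Q" using Pp by blast
    then show ?thesis
      using iter_deriv_cmult[OF smooth_poly_span[OF Q(1)] M(1), of c]
      by (intro bexI[OF _ poly_span.scale[OF Q(1), of c]]) simp
  qed
  have Pa: "?P (\<lambda>x. p x + q x)" if Pp: "?P p" and Pq: "?P q" for p q
  proof -
    obtain Q Q' where Q: "Q \<in> poly_span R m" "p = iter_deriv M Q" and Q': "Q' \<in> poly_span R m" "q = iter_deriv M Q'"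
      using Pp Pq by blast
    then show ?thesis
      using iter_deriv_add[OF smooth_poly_span[OF Q(1)] smooth_poly_span[OF Q'(1)] M(1)]
      by (intro bexI[OF _ poly_span.add[OF Q(1) Q'(1)]]) simp
  qed
  have Pmult1: "?P (\<lambda>x. divided_monomial R k x * iter_deriv M Q x)" if "Q \<in> poly_span R m" for k Q
    using that
  proof (induction rule: poly_span.induct)
    case (mono l)
    show ?case unfolding dm divided_monomial_mult by (rule Ps[OF Pm])
  next
    case (scale f c)
    from Ps[OF scale.IH, of c] scale(1) show ?case
      using M(1) by (simp add: iter_deriv_cmult smooth_poly_span mult_ac)
  next
    case (add f h)
    from Pa[OF add.IH] add(1,2) show ?case
      using M(1) by (simp add: iter_deriv_add smooth_poly_span algebra_simps)
  qed
  have Pmult2: "?P (\<lambda>x. iter_deriv M Q x * iter_deriv M Q' x)"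
    if "Q \<in> poly_span R m" "Q' \<in> poly_span R m" for Q Q'
    using that(1)
  proof (induction rule: poly_span.induct)
    case (mono l)
    show ?case unfolding dm by (rule Pmult1[OF that(2)])
  next
    case (scale f c)
    from Ps[OF scale.IH, of c] scale(1) show ?case
      using M(1) by (simp add: iter_deriv_cmult smooth_poly_span mult_ac)
  next
    case (add f h)
    from Pa[OF add.IH] add(1,2) show ?case
      using M(1) by (simp add: iter_deriv_add smooth_poly_span algebra_simps)
  qed
  have "\<exists>p. ?P p \<and> (\<forall>x\<in>S. \<bar>g x - p x\<bar> < e)"
  proof (rule Stone_Weierstrass_HOL[OF S _ _ _ _ _ g e])
    fix c :: real
    have "(\<lambda>x. c) = (\<lambda>x::'a. c * divided_monomial R (\<lambda>_. 0) x)" by (simp add: divided_monomial_def divided_power_def)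
    then show "?P (\<lambda>x. c)" using Ps[OF Pm] by metis
  next
    fix p assume "?P p"
    then obtain Q where Q: "Q \<in> poly_span R m" "p = iter_deriv M Q" by blast
    then show "continuous_on S p"
      using smooth_continuous[OF smooth_iter_deriv[OF smooth_poly_span[OF Q(1)] M(1)]] by simp
  next
    fix p q :: "'a \<Rightarrow> real" assume "?P p \<and> ?P q"
    then show "?P (\<lambda>x. p x + q x)" using Pa by blast
  next
    fix p q :: "'a \<Rightarrow> real" assume "?P p \<and> ?P q"
    then show "?P (\<lambda>x. p x * q x)" using Pmult2 by auto
  next
    fix x y :: 'a assume "x \<in> S \<and> y \<in> S \<and> x \<noteq> y"
    then obtain b where b: "b \<in> Basis" "x \<bullet> b \<noteq> y \<bullet> b" by (auto simp: euclidean_eq_iff[of x y])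
    have *: "divided_monomial R (\<lambda>c. if c = b then 1 else 0) z = z \<bullet> b + R" for z
    proof -
      have "divided_monomial R (\<lambda>c. if c = b then 1 else 0) z = (\<Prod>c\<in>Basis. if c = b then z \<bullet> b + R else 1)"
        unfolding divided_monomial_def by (intro prod.cong) (auto simp: divided_power_def)
      then show ?thesis using b by (simp add: prod.delta)
    qed
    show "\<exists>p. ?P p \<and> p x \<noteq> p y"
      using b by (intro exI[of _ "divided_monomial R (\<lambda>c. if c = b then 1 else 0)"] conjI Pm) (simp add: *)
  qed
  then show ?thesis by auto
qed

lemma mset_eq_of_count_list:
  assumes "as \<in> lists Basis" "bs \<in> lists Basis" "\<And>b. b \<in> Basis \<Longrightarrow> count_list as b = count_list bs b"
  shows "mset as = mset bs"
proof (rule multiset_eqI)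
  fix a
  have "count_list as a = count_list bs a"
  proof (cases "a \<in> Basis")
    case False
    then have "a \<notin> set as" "a \<notin> set bs" using assms by auto
    then show ?thesis by (simp add: count_notin)
  qed (use assms in auto)
  then show "count (mset as) a = count (mset bs) a" by (simp add: count_mset)
qed

text \<open>A function whose derivatives vanish on the faces \<open>x \<bullet> b = - R\<close> of a cube is controlled, together
  with its lower derivatives, by its derivative of order \<open>m\<close> in every coordinate: the mean value
  theorem raises the order in one coordinate at a time, at the cost of a factor depending on the side length.\<close>

lemma face_bound:
  fixes u :: "'a::euclidean_space \<Rightarrow> real"
  defines "S R \<equiv> {x. \<forall>b\<in>Basis. \<bar>x \<bullet> b\<bar> \<le> R}"
  assumes u: "smooth u" and R: "R > 0" and M: "M \<in> lists Basis" "\<And>b. b \<in> Basis \<Longrightarrow> count_list M b = m"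
    and face: "\<And>bs b x. bs \<in> lists Basis \<Longrightarrow> (\<And>c. c \<in> Basis \<Longrightarrow> count_list bs c \<le> m) \<Longrightarrow> b \<in> Basis \<Longrightarrow>
        count_list bs b < m \<Longrightarrow> x \<bullet> b = - R \<Longrightarrow> iter_deriv bs u x = 0"
    and top: "\<And>x. x \<in> S R \<Longrightarrow> \<bar>iter_deriv M u x\<bar> \<le> e"
    and bs: "bs \<in> lists Basis" "\<And>c. c \<in> Basis \<Longrightarrow> count_list bs c \<le> m" and x: "x \<in> S R"
  shows "\<bar>iter_deriv bs u x\<bar> \<le> (2 * R + 1) ^ (m * DIM('a)) * e"
proof -
  have e: "e \<ge> 0" using top[OF x] by linarith
  have *: "\<bar>iter_deriv bs u x\<bar> \<le> (2 * R + 1) ^ n * e"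
    if "n = (\<Sum>c\<in>Basis. m - count_list bs c)" "bs \<in> lists Basis" "\<And>c. c \<in> Basis \<Longrightarrow> count_list bs c \<le> m" "x \<in> S R" for n bs x
    using that
  proof (induction n arbitrary: bs x)
    case 0
    then have "count_list bs c = count_list M c" if "c \<in> Basis" for c using M(2) that by (simp add: le_antisym)
    then have "iter_deriv bs u = iter_deriv M u"
      using u 0 M by (intro iter_deriv_perm mset_eq_of_count_list) auto
    then show ?case using top[OF 0(4)] by simp
  next
    case (Suc n)
    \<comment> \<open>the induction is on the number of derivatives still missing\<close>
    have "\<exists>b\<in>Basis. m - count_list bs b \<noteq> 0" using Suc.prems(1) by (metis nat.distinct(1) sum.neutral)
    then obtain b where b: "b \<in> Basis" "count_list bs b < m" by auto
    have n: "n = (\<Sum>c\<in>Basis. m - count_list (b # bs) c)"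
    proof -
      have "Suc n = (m - count_list bs b) + (\<Sum>c\<in>Basis - {b}. m - count_list bs c)"
        using Suc.prems(1) b by (simp add: sum.remove)
      moreover have "(\<Sum>c\<in>Basis. m - count_list (b # bs) c) = (m - count_list bs b - 1) + (\<Sum>c\<in>Basis - {b}. m - count_list bs c)"
      proof -
        have "(\<Sum>c\<in>Basis - {b}. m - count_list (b # bs) c) = (\<Sum>c\<in>Basis - {b}. m - count_list bs c)"
          by (intro sum.cong) auto
        then show ?thesis using b by (subst sum.remove[of _ b]) auto
      qed
      ultimately show ?thesis using b by linarith
    qed
    \<comment> \<open>the projection of \<open>x\<close> to the face \<open>x \<bullet> b = - R\<close>\<close>
    define y where "y = x - (x \<bullet> b + R) *\<^sub>R b"
    have yb: "y \<bullet> b = - R" using b by (simp add: y_def inner_diff_left)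
    have yc: "y \<bullet> c = x \<bullet> c" if "c \<in> Basis" "c \<noteq> b" for c
      using b that by (simp add: y_def inner_diff_left inner_Basis)
    have IH: "\<bar>partial b (iter_deriv bs u) z\<bar> \<le> (2 * R + 1) ^ n * e" if "z \<in> S R" for z
    proof -
      have "count_list (b # bs) c \<le> m" if "c \<in> Basis" for c
        using Suc.prems(3)[OF that] b by auto
      from Suc.IH[OF n _ this \<open>z \<in> S R\<close>] show ?thesis
        using Suc.prems(2) b by (simp add: partial_def)
    qed
    show ?case
    proof (cases "x \<bullet> b = - R")
      case True
      then have "iter_deriv bs u x = 0" using face[of bs b x] b Suc.prems by blast
      then show ?thesis using e R by simp
    next
      case False
      have xb: "\<bar>x \<bullet> b\<bar> \<le> R" using Suc.prems b by (auto simp: S_def)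
      define h where "h = x \<bullet> b + R"
      have h: "h > 0" "h \<le> 2 * R" using False xb by (auto simp: h_def)
      have "smooth (iter_deriv bs u)" using u Suc.prems by (intro smooth_iter_deriv)
      from MVT2[OF h(1) smooth_line_deriv[OF this, of y b]] obtain t where t: "0 < t" "t < h"
        "iter_deriv bs u (y + h *\<^sub>R b) - iter_deriv bs u (y + 0 *\<^sub>R b) = (h - 0) * partial b (iter_deriv bs u) (y + t *\<^sub>R b)"
        by blast
      have "y + h *\<^sub>R b = x" by (simp add: y_def h_def)
      moreover have "iter_deriv bs u y = 0" using face[of bs b y] b Suc.prems yb by blast
      ultimately have eq: "iter_deriv bs u x = h * partial b (iter_deriv bs u) (y + t *\<^sub>R b)" using t by simp
      have "y + t *\<^sub>R b \<in> S R"
      proof -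
        have "\<bar>(y + t *\<^sub>R b) \<bullet> c\<bar> \<le> R" if "c \<in> Basis" for c
        proof (cases "c = b")
          case True
          then show ?thesis using t h xb yb b by (simp add: inner_add_left h_def)
        next
          case False
          then show ?thesis using yc[OF that False] that b Suc.prems(4) by (simp add: inner_add_left inner_Basis S_def)
        qed
        then show ?thesis by (simp add: S_def)
      qed
      from IH[OF this] have "\<bar>iter_deriv bs u x\<bar> \<le> (2 * R + 1) * ((2 * R + 1) ^ n * e)"
        unfolding eq abs_mult using h by (intro mult_mono) auto
      then show ?thesis by simp
    qed
  qed
  have "(\<Sum>c\<in>(Basis::'a set). m - count_list bs c) \<le> (\<Sum>c\<in>(Basis::'a set). m)" by (intro sum_mono) simp
  then have "(\<Sum>c\<in>(Basis::'a set). m - count_list bs c) \<le> m * DIM('a)" by (simp add: mult.commute)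
  then have "(2 * R + 1) ^ (\<Sum>c\<in>(Basis::'a set). m - count_list bs c) \<le> (2 * R + 1) ^ (m * DIM('a))"
    using R by (intro power_increasing) auto
  from mult_right_mono[OF this e] show ?thesis
    using *[OF refl bs x] by linarith
qed

text \<open>The Leibniz rule in the form of an estimate.\<close>

lemma iter_deriv_mult_bound:
  assumes "smooth X" "smooth u" "bs \<in> lists Basis" "A \<ge> 0" "B \<ge> 0"
    and "\<And>cs. cs \<in> lists Basis \<Longrightarrow> length cs \<le> length bs \<Longrightarrow> \<bar>iter_deriv cs X x\<bar> \<le> A"
    and "\<And>cs. cs \<in> lists Basis \<Longrightarrow> length cs \<le> length bs \<Longrightarrow> \<bar>iter_deriv cs u x\<bar> \<le> B"
  shows "\<bar>iter_deriv bs (\<lambda>x. X x * u x) x\<bar> \<le> 2 ^ length bs * (A * B)"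
  using assms(1-3,6,7)
proof (induction bs arbitrary: X u rule: rev_induct)
  case Nil
  have "\<bar>X x\<bar> \<le> A" "\<bar>u x\<bar> \<le> B" using Nil(4)[of "[]"] Nil(5)[of "[]"] by auto
  then show ?case using assms(4) by (simp add: abs_mult mult_mono)
next
  case (snoc b bs)
  have b: "b \<in> Basis" "bs \<in> lists Basis" using snoc.prems by auto
  have sm: "smooth (partial b X)" "smooth (partial b u)" using snoc.prems b by (auto intro: smooth_partial)
  have "iter_deriv (bs @ [b]) (\<lambda>x. X x * u x) = iter_deriv bs (\<lambda>x. X x * partial b u x + partial b X x * u x)"
    using snoc.prems by (simp add: iter_deriv_snoc partial_mult smooth_differentiable)
  also have "\<dots> = (\<lambda>x. iter_deriv bs (\<lambda>x. X x * partial b u x) x + iter_deriv bs (\<lambda>x. partial b X x * u x) x)"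
    using snoc.prems b sm by (intro iter_deriv_add smooth_mult) auto
  finally have eq: "iter_deriv (bs @ [b]) (\<lambda>x. X x * u x) x = iter_deriv bs (\<lambda>x. X x * partial b u x) x + iter_deriv bs (\<lambda>x. partial b X x * u x) x"
    by simp
  have "\<bar>iter_deriv bs (\<lambda>x. X x * partial b u x) x\<bar> \<le> 2 ^ length bs * (A * B)"
    using snoc.prems(4,5) b by (intro snoc.IH snoc.prems sm) (auto simp: iter_deriv_snoc[symmetric])
  moreover have "\<bar>iter_deriv bs (\<lambda>x. partial b X x * u x) x\<bar> \<le> 2 ^ length bs * (A * B)"
    using snoc.prems(4,5) b by (intro snoc.IH snoc.prems sm) (auto simp: iter_deriv_snoc[symmetric])
  ultimately show ?case unfolding eq by simp
qed

lemma test_functions_bounded: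
  assumes "f \<in> test_functions" shows "\<exists>A. \<forall>x. \<bar>f x\<bar> \<le> A"
proof -
  obtain R where R: "R > 0" "\<And>x. norm x > R \<Longrightarrow> f x = 0" using test_functions_boundE[OF assms] by blast
  have "bounded (f ` cball 0 R)"
    using assms by (intro compact_imp_bounded compact_continuous_image smooth_continuous test_functions_smooth) auto
  then obtain A where "\<forall>y\<in>f ` cball 0 R. norm y \<le> A" unfolding bounded_iff by blast
  then have A: "norm x \<le> R \<Longrightarrow> \<bar>f x\<bar> \<le> A" for x by auto
  have "\<bar>f x\<bar> \<le> \<bar>A\<bar>" for x using R(2)[of x] A[of x] by (cases "norm x \<le> R") auto
  then show ?thesis by blast
qed

lemma finite_lists_le: "finite {bs \<in> lists (Basis :: 'a::euclidean_space set). length bs \<le> m}"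
  using finite_lists_length_le[OF finite_Basis[where 'a='a], of m] by (simp add: lists_eq_set conj_commute)

lemma test_functions_derivs_bounded:
  assumes "f \<in> test_functions"
  shows "\<exists>A\<ge>0. \<forall>bs\<in>lists Basis. length bs \<le> m \<longrightarrow> (\<forall>x. \<bar>iter_deriv bs f x\<bar> \<le> A)"
proof -
  let ?L = "{bs \<in> lists Basis. length bs \<le> m}"
  obtain A where A: "\<And>bs x. bs \<in> ?L \<Longrightarrow> \<bar>iter_deriv bs f x\<bar> \<le> A bs"
    using test_functions_bounded[OF test_functions_iter_deriv[OF assms]] by (metis mem_Collect_eq)
  have nn: "bs \<in> ?L \<Longrightarrow> A bs \<ge> 0" for bs using A[of bs undefined] by linarith
  have "\<bar>iter_deriv bs f x\<bar> \<le> sum A ?L" if "bs \<in> ?L" for bs x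
  proof -
    have "A bs \<le> sum A ?L"
      by (rule member_le_sum[OF that nn finite_lists_le]) simp
    with A[OF that, of x] show ?thesis by linarith
  qed
  moreover have "sum A ?L \<ge> 0" by (rule sum_nonneg) (rule nn)
  ultimately show ?thesis by (intro exI[of _ "sum A ?L"]) auto
qed

text \<open>The algebraic tensor power of the space of test functions.\<close>

inductive_set tensor_span :: "((real^'d)^'n \<Rightarrow> real) set" where
  tensor: "(\<And>i. \<xi> i \<in> test_functions) \<Longrightarrow> fun_tensor \<xi> \<in> tensor_span"
| scale: "f \<in> tensor_span \<Longrightarrow> (\<lambda>x. c * f x) \<in> tensor_span"
| add: "f \<in> tensor_span \<Longrightarrow> g \<in> tensor_span \<Longrightarrow> (\<lambda>x. f x + g x) \<in> tensor_span"

lemma tensor_span_test: "f \<in> tensor_span \<Longrightarrow> f \<in> test_functions"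
  by (induction rule: tensor_span.induct) (auto intro: fun_tensor_test test_functions_cmult test_functions_add)

lemma prod_Basis_vec:
  "(\<Prod>c\<in>(Basis :: ('a::euclidean_space^'n) set). g c) = (\<Prod>i\<in>UNIV. \<Prod>u\<in>Basis. g (axis i u))"
proof -
  have inj: "inj_on (\<lambda>(i, u). axis i u) (UNIV \<times> (Basis :: 'a set))"
    by (auto simp: inj_on_def axis_eq_axis)
  have "(Basis :: ('a^'n) set) = (\<lambda>(i, u). axis i u) ` (UNIV \<times> Basis)"
    by (auto simp: Basis_vec_def)
  also have "prod g \<dots> = (\<Prod>(i, u)\<in>UNIV \<times> Basis. g (axis i u))"
    by (subst prod.reindex[OF inj]) (simp add: case_prod_unfold o_def)
  finally show ?thesis by (simp add: prod.cartesian_product)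
qed

lemma divided_monomial_vec: "divided_monomial R k (x :: (real^'d)^'n) = (\<Prod>i\<in>UNIV. \<Prod>u\<in>Basis. divided_power R (k (axis i u)) (x $ i \<bullet> u))"
  by (simp add: divided_monomial_def prod_Basis_vec inner_axis)

text \<open>Approximation of \<open>f\<close> in all derivatives up to order \<open>m\<close>, with supports in a set that depends on the
  support of \<open>f\<close> only.\<close>

lemma tensor_approx:
  fixes f :: "(real^'d)^'n \<Rightarrow> real"
  assumes f: "smooth f" and R0: "R0 > 0" "\<And>x. norm x > R0 \<Longrightarrow> f x = 0" and d: "\<delta> > 0"
  shows "\<exists>q\<in>tensor_span. (\<forall>x. (\<exists>i. norm (x $ i) > R0 + 1) \<longrightarrow> q x = 0) \<and>
     (\<forall>bs\<in>lists Basis. length bs \<le> m \<longrightarrow> (\<forall>x. \<bar>iter_deriv bs (\<lambda>x. f x - q x) x\<bar> \<le> \<delta>))"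
proof -
  define X :: "(real^'d)^'n \<Rightarrow> real" where "X = fun_tensor (\<lambda>_. cutoff (R0\<^sup>2))"
  define R where "R = R0 + 1"
  let ?S = "{x :: (real^'d)^'n. \<forall>b\<in>Basis. \<bar>x \<bullet> b\<bar> \<le> R}"
  have Xt: "X \<in> test_functions" unfolding X_def by (intro fun_tensor_test cutoff_test)
  have X1: "X x = 1" if "norm x \<le> R0" for x
  proof -
    have "norm (x $ i) \<le> R0" for i
      using Finite_Cartesian_Product.norm_nth_le[of x i] that by linarith
    then have "(norm (x $ i))\<^sup>2 \<le> R0\<^sup>2" for i by (intro power_mono) auto
    then show ?thesis by (simp add: X_def fun_tensor_def cutoff_eq_1)
  qed
  have X0: "X x = 0" if "norm (x $ i) > R" for x i
  proof -
    have "R0\<^sup>2 + 1 \<le> R\<^sup>2" using R0 by (simp add: R_def power2_eq_square algebra_simps)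
    also have "R\<^sup>2 \<le> (norm (x $ i))\<^sup>2" using that R0 by (intro power_mono) (auto simp: R_def)
    finally have "cutoff (R0\<^sup>2) (x $ i) = 0" by (rule cutoff_eq_0)
    then show ?thesis unfolding X_def fun_tensor_def by (intro prod_zero) auto
  qed
  have X0S: "X x = 0" if xS: "x \<notin> ?S" for x
  proof -
    obtain b where b: "b \<in> Basis" "\<bar>x \<bullet> b\<bar> > R" using xS unfolding mem_Collect_eq by (meson not_le)
    obtain i u where iu: "b = axis i u" "u \<in> Basis" using b by (auto simp: Basis_vec_def)
    have "\<bar>x $ i \<bullet> u\<bar> > R" using b by (simp add: iu inner_axis)
    then have "norm (x $ i) > R" using Basis_le_norm[OF iu(2), of "x $ i"] by linarith
    then show ?thesis by (rule X0)
  qed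
  have S: "compact ?S"
  proof -
    have "?S = cbox (- (\<Sum>b\<in>Basis. R *\<^sub>R b)) (\<Sum>b\<in>Basis. R *\<^sub>R b)"
      by (auto simp: mem_box inner_sum_left_Basis abs_le_iff minus_le_iff)
    then show ?thesis by simp
  qed
  obtain M where M: "M \<in> lists (Basis :: ((real^'d)^'n) set)" "\<And>b. b \<in> Basis \<Longrightarrow> count_list M b = m"
    using ex_full_list by blast
  obtain A where A: "A \<ge> 0" "\<And>bs x. bs \<in> lists Basis \<Longrightarrow> length bs \<le> m \<Longrightarrow> \<bar>iter_deriv bs X x\<bar> \<le> A"
    using test_functions_derivs_bounded[OF Xt, of m] by blast
  define K where "K = (2 * R + 1) ^ (m * DIM((real^'d)^'n))"
  \<comment> \<open>\<open>K\<close> comes from the mean value estimate, \<open>2\<^sup>m\<close> and \<open>A\<close> from the Leibniz rule; \<open>A\<close> may be \<open>0\<close>\<close>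
  define e where "e = \<delta> / (2 ^ m * ((A + 1) * K))"
  have K: "K > 0" using R0 by (simp add: K_def R_def)
  have e: "e > 0" using d K A by (simp add: e_def)
  obtain Q where Q: "Q \<in> poly_span R m" "\<And>x. x \<in> ?S \<Longrightarrow> \<bar>iter_deriv M f x - iter_deriv M Q x\<bar> < e"
    using poly_span_dense[OF S smooth_continuous[OF smooth_iter_deriv[OF f M(1)]] e M, where R = R] by blast
  have Qs: "smooth Q" by (rule smooth_poly_span[OF Q(1)])
  define u where "u = (\<lambda>x. f x - Q x)"
  have us: "smooth u" unfolding u_def by (intro smooth_diff f Qs)
  have u_bound: "\<bar>iter_deriv bs u x\<bar> \<le> K * e"
    if "bs \<in> lists Basis" "length bs \<le> m" "x \<in> ?S" for bs x
    unfolding K_def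
  proof (rule face_bound[OF us _ M])
    show "R > 0" using R0 by (simp add: R_def)
    show "\<bar>iter_deriv M u x\<bar> \<le> e" if "x \<in> ?S" for x
      using Q(2)[OF that] unfolding u_def by (subst iter_deriv_diff[OF f Qs M(1)]) simp
    show "count_list bs c \<le> m" for c using count_le_length[of bs c] that by linarith
    fix cs :: "((real^'d)^'n) list" and b y assume cs: "cs \<in> lists Basis" "\<And>c. c \<in> Basis \<Longrightarrow> count_list cs c \<le> m"
      and b: "b \<in> Basis" "count_list cs b < m" and y: "y \<bullet> b = - R"
    have "norm y > R0" using Basis_le_norm[OF b(1), of y] y R0 by (simp add: R_def)
    then have "iter_deriv cs f y = 0" using iter_deriv_outside[of R0 f y cs, OF R0(2)] by blast
    moreover have "iter_deriv cs Q y = 0" using poly_span_face[OF Q(1) cs b y] .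
    ultimately show "iter_deriv cs u y = 0" unfolding u_def by (subst iter_deriv_diff[OF f Qs cs(1)]) simp
  qed (use that in auto)
  define q where "q = (\<lambda>x. X x * Q x)"
  have fq: "(\<lambda>x. f x - q x) = (\<lambda>x. X x * u x)"
  proof
    fix x show "f x - q x = X x * u x"
      using R0(2)[of x] X1[of x] by (cases "norm x \<le> R0") (auto simp: q_def u_def algebra_simps)
  qed
  have "\<bar>iter_deriv bs (\<lambda>x. f x - q x) x\<bar> \<le> \<delta>" if bs: "bs \<in> lists Basis" "length bs \<le> m" for bs x
  proof (cases "x \<in> ?S")
    case True
    have "\<bar>iter_deriv bs (\<lambda>x. X x * u x) x\<bar> \<le> 2 ^ length bs * (A * (K * e))"
      using A u_bound[OF _ _ True] bs K e
      by (intro iter_deriv_mult_bound us test_functions_smooth[OF Xt]) (auto intro: order_trans)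
    also have "\<dots> \<le> 2 ^ m * ((A + 1) * (K * e))"
      using bs A K e by (intro mult_mono power_increasing) auto
    also have "\<dots> = \<delta>" using A K by (simp add: e_def)
    finally show ?thesis by (simp add: fq)
  next
    case False
    have "open (- ?S)" using S compact_imp_closed by blast
    then have "iter_deriv bs (\<lambda>x. X x * u x) x = iter_deriv bs (\<lambda>x. 0) x"
      using False X0S by (intro iter_deriv_cong_open[of "- ?S"]) auto
    then show ?thesis using d by (simp add: fq iter_deriv_const)
  qed
  moreover have "q \<in> tensor_span"
    unfolding q_def using Q(1)
  proof (induction rule: poly_span.induct)
    case (mono k)
    have "(\<lambda>x. X x * divided_monomial R (\<lambda>b. k b + m) x) =
      fun_tensor (\<lambda>i y. cutoff (R0\<^sup>2) y * (\<Prod>u\<in>Basis. divided_power R (k (axis i u) + m) (y \<bullet> u)))"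
      by (simp add: X_def fun_tensor_def divided_monomial_vec prod.distrib)
    then show ?case
      by (simp only:) (intro tensor_span.tensor test_functions_mult cutoff_test smooth_prod smooth_divided_power_inner)
  next
    case (scale f c)
    from tensor_span.scale[OF scale.IH, of c] show ?case by (simp add: mult_ac)
  next
    case (add f g)
    from tensor_span.add[OF add.IH] show ?case by (simp add: algebra_simps)
  qed
  moreover have "q x = 0" if "norm (x $ i) > R0 + 1" for x i
    using X0[of x i] that by (simp add: q_def R_def)
  ultimately show ?thesis by (intro bexI[of _ q]) auto
qed

section \<open>Limits and continuity in the projective limit topologies\<close>

lemma topspace_projective:
  fixes N :: "nat \<Rightarrow> ('b::euclidean_space \<Rightarrow> real) \<Rightarrow> ('a \<Rightarrow> real) \<Rightarrow> real"
  assumes "\<And>l \<phi>. N l \<phi> (\<lambda>x. 0) = 0"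
  shows "topspace (projective_topology V N) = V"
proof -
  have "f \<in> \<Union> {{g \<in> V. N l \<phi> (\<lambda>x. g x - f x) < r} | l \<phi> f r. \<phi> \<in> weights \<and> f \<in> V \<and> 0 < r}" if "f \<in> V" for f
  proof -
    have "(\<lambda>_. 1) \<in> (weights :: ('b \<Rightarrow> real) set)" by (simp add: weights_def smooth_const)
    moreover have "f \<in> {g \<in> V. N 0 (\<lambda>_. 1) (\<lambda>x. g x - f x) < 1}" using that assms by simp
    ultimately show ?thesis using that
      by (intro UnionI[of "{g \<in> V. N 0 (\<lambda>_. 1) (\<lambda>x. g x - f x) < 1}"] CollectI exI[of _ 0] exI[of _ "\<lambda>_. 1"] exI[of _ f] exI[of _ "1::real"]) auto
  qed
  then show ?thesis
    unfolding projective_topology_def topology_generated_by_topspace by blast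
qed

text \<open>A linear functional dominated by a single one of the defining norms is continuous.  No triangle
  inequality for the norms is needed, as the subbasic neighbourhoods may be centred at any point.\<close>

lemma continuous_dualI:
  assumes N0: "\<And>l \<phi>. N l \<phi> (\<lambda>x. 0) = 0"
    and Vdiff: "\<And>f g. f \<in> V \<Longrightarrow> g \<in> V \<Longrightarrow> (\<lambda>x. f x - g x) \<in> V"
    and F: "F \<in> extensional V" "\<And>f g. f \<in> V \<Longrightarrow> g \<in> V \<Longrightarrow> F (\<lambda>x. f x + g x) = F f + F g"
      "\<And>c f. f \<in> V \<Longrightarrow> F (\<lambda>x. c * f x) = c * F f"
    and bound: "\<phi> \<in> weights" "C \<ge> 0" "\<And>f. f \<in> V \<Longrightarrow> \<bar>F f\<bar> \<le> C * N l \<phi> f"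
  shows "F \<in> continuous_dual (projective_topology V N)"
proof -
  let ?T = "projective_topology V N"
  have top: "topspace ?T = V" by (rule topspace_projective[of N V, OF N0])
  have Fdiff: "F (\<lambda>x. g x - f x) = F g - F f" if "f \<in> V" "g \<in> V" for f g
    using F(2)[OF Vdiff[OF that(2,1)] that(1)] by simp
  have "openin ?T {f \<in> V. F f \<in> U}" if U: "open U" for U
  proof (subst openin_subopen, intro ballI)
    fix f assume f: "f \<in> {f \<in> V. F f \<in> U}"
    then obtain e where e: "e > 0" "\<And>y. \<bar>y - F f\<bar> < e \<Longrightarrow> y \<in> U"
      using U by (auto simp: open_dist dist_real_def)
    let ?r = "e / (C + 1)"
    let ?B = "{g \<in> V. N l \<phi> (\<lambda>x. g x - f x) < ?r}"
    have r: "?r > 0" using e bound by simp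
    have "openin ?T ?B"
      unfolding projective_topology_def
      by (rule topology_generated_by_Basis) (use f bound r in blast)
    moreover have "f \<in> ?B" using f r N0 by simp
    moreover have "?B \<subseteq> {f \<in> V. F f \<in> U}"
    proof
      fix g assume g: "g \<in> ?B"
      have "\<bar>F g - F f\<bar> \<le> C * N l \<phi> (\<lambda>x. g x - f x)"
        using f g bound(3)[OF Vdiff, of g f] by (simp add: Fdiff)
      also have "\<dots> \<le> C * ?r" using g bound(2) by (intro mult_left_mono) auto
      also have "\<dots> < e" using e bound(2) by (simp add: divide_simps)
      finally show "g \<in> {f \<in> V. F f \<in> U}" using g e(2) by simp
    qed
    ultimately show "\<exists>B. openin ?T B \<and> f \<in> B \<and> B \<subseteq> {f \<in> V. F f \<in> U}" by blast
  qed
  then have "continuous_map ?T euclideanreal F"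
    by (simp add: continuous_map_def top)
  then show ?thesis using F by (simp add: continuous_dual_def top)
qed

text \<open>Convergence of the norms of all differences with fixed elements of \<open>V\<close> is what the subbasis of the
  topology asks for.\<close>

lemma continuous_dual_tendsto:
  assumes N0: "\<And>l \<phi>. N l \<phi> (\<lambda>x. 0) = 0"
    and F: "F \<in> continuous_dual (projective_topology V N)"
    and V: "\<And>k. q k \<in> V" "f \<in> V"
    and lim: "\<And>l \<phi> g. \<phi> \<in> weights \<Longrightarrow> g \<in> V \<Longrightarrow> (\<lambda>k. N l \<phi> (\<lambda>x. q k x - g x)) \<longlonglongrightarrow> N l \<phi> (\<lambda>x. f x - g x)"
  shows "(\<lambda>k. F (q k)) \<longlonglongrightarrow> F f"
proof -
  let ?T = "projective_topology V N"
  let ?S = "{{g \<in> V. N l \<phi> (\<lambda>x. g x - f x) < r} | l \<phi> f r. \<phi> \<in> weights \<and> f \<in> V \<and> 0 < r}"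
  have top: "topspace ?T = V" by (rule topspace_projective[of N V, OF N0])
  have "generate_topology_on ?S U \<Longrightarrow> f \<in> U \<Longrightarrow> \<forall>\<^sub>F k in sequentially. q k \<in> U" for U
  proof (induction rule: generate_topology_on.induct)
    case (Int a b)
    then show ?case by (auto intro: eventually_conj)
  next
    case (UN K)
    then obtain k where k: "k \<in> K" "f \<in> k" by blast
    from UN.IH[OF this] show ?case by (rule eventually_mono) (use k in blast)
  next
    case (Basis s)
    then obtain l \<phi> g r where s: "s = {h \<in> V. N l \<phi> (\<lambda>x. h x - g x) < r}" "\<phi> \<in> weights" "g \<in> V" by blast
    have "N l \<phi> (\<lambda>x. f x - g x) < r" using Basis s by auto
    from order_tendstoD(2)[OF lim[OF s(2,3)] this] show ?case
      using V by (simp add: s(1))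
  qed simp
  then have "limitin ?T q f sequentially"
    unfolding limitin_def top using V(2)
    by (simp add: projective_topology_def openin_topology_generated_by_iff)
  moreover have "continuous_map ?T euclideanreal F" using F by (simp add: continuous_dual_def)
  ultimately have "limitin euclideanreal (F \<circ> q) (F f) sequentially"
    by (rule continuous_map_limit[rotated])
  then show ?thesis by (simp add: o_def)
qed

text \<open>Convergence of test functions: a common bounded support, and uniform convergence of all derivatives.
  The rate \<open>1 / (k + 1)\<close> for derivatives up to order \<open>k\<close> is a normalization.\<close>

definition test_converges :: "(nat \<Rightarrow> 'a::euclidean_space \<Rightarrow> real) \<Rightarrow> ('a \<Rightarrow> real) \<Rightarrow> bool" where
  "test_converges q f \<longleftrightarrow> (\<exists>R. \<forall>k x. norm x > R \<longrightarrow> q k x = 0) \<and>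
     (\<forall>k. \<forall>bs\<in>lists Basis. length bs \<le> k \<longrightarrow> (\<forall>x. \<bar>iter_deriv bs (\<lambda>x. f x - q k x) x\<bar> \<le> inverse (real (Suc k))))"

lemma integral_square_tendsto:
  fixes u :: "nat \<Rightarrow> 'a::euclidean_space \<Rightarrow> real"
  assumes v: "continuous_on UNIV v" and u: "\<And>k. u k \<in> borel_measurable borel" and w: "continuous_on UNIV w" "\<And>x. w x \<ge> 0"
    and supp: "\<And>k x. norm x > R \<Longrightarrow> u k x = 0"
    and conv: "\<And>k x. k \<ge> K \<Longrightarrow> \<bar>u k x - v x\<bar> \<le> inverse (real (Suc k))"
  shows "(\<lambda>k. \<integral>x. (u k x)\<^sup>2 * w x \<partial>lborel) \<longlonglongrightarrow> (\<integral>x. (v x)\<^sup>2 * w x \<partial>lborel)"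
proof (rule LIMSEQ_offset[of _ K], rule integral_dominated_convergence)
  have [measurable]: "v \<in> borel_measurable borel" "w \<in> borel_measurable borel" "\<And>k. u k \<in> borel_measurable borel"
    using v w u by (auto intro: borel_measurable_continuous_onI)
  show "(\<lambda>x. (v x)\<^sup>2 * w x) \<in> borel_measurable lborel" "(\<lambda>x. (u (k + K) x)\<^sup>2 * w x) \<in> borel_measurable lborel" for k
    by measurable
  show "integrable lborel (\<lambda>x. indicator (cball 0 R) x *\<^sub>R ((\<bar>v x\<bar> + 1)\<^sup>2 * w x))"
    by (intro borel_integrable_compact continuous_intros continuous_on_subset[OF v] continuous_on_subset[OF w(1)]) auto
  have ptw: "(\<lambda>k. u k x) \<longlonglongrightarrow> v x" for x
  proof (rule LIM_zero_cancel, rule Lim_null_comparison)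
    show "\<forall>\<^sub>F k in sequentially. norm (u k x - v x) \<le> inverse (real (Suc k))"
      using conv by (auto simp: eventually_sequentially)
    show "(\<lambda>k. inverse (real (Suc k))) \<longlonglongrightarrow> 0" by (rule LIMSEQ_inverse_real_of_nat)
  qed
  have "(\<lambda>k. (u (k + K) x)\<^sup>2 * w x) \<longlonglongrightarrow> (v x)\<^sup>2 * w x" for x
    by (intro tendsto_intros LIMSEQ_ignore_initial_segment ptw)
  then show "AE x in lborel. (\<lambda>k. (u (k + K) x)\<^sup>2 * w x) \<longlonglongrightarrow> (v x)\<^sup>2 * w x" by simp
  have "norm ((u (k + K) x)\<^sup>2 * w x) \<le> indicator (cball 0 R) x *\<^sub>R ((\<bar>v x\<bar> + 1)\<^sup>2 * w x)" for k x
  proof (cases "norm x \<le> R")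
    case True
    have "inverse (real (Suc (k + K))) \<le> 1" by (simp add: field_simps)
    then have "\<bar>u (k + K) x\<bar> \<le> \<bar>v x\<bar> + 1" using conv[of "k + K" x] by linarith
    then have "\<bar>u (k + K) x\<bar>\<^sup>2 \<le> (\<bar>v x\<bar> + 1)\<^sup>2" by (intro power_mono) auto
    then show ?thesis using True w(2)[of x] by (simp add: mult_right_mono)
  next
    case False then show ?thesis using supp[of x "k + K"] by simp
  qed
  then show "AE x in lborel. norm ((u (k + K) x)\<^sup>2 * w x) \<le> indicator (cball 0 R) x *\<^sub>R ((\<bar>v x\<bar> + 1)\<^sup>2 * w x)" for k by simp
qed

lemma weighted_norm_tendsto:
  assumes q: "\<And>k. q k \<in> test_functions" and f: "f \<in> test_functions" and g: "g \<in> test_functions"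
    and tc: "test_converges q f" and w: "smooth w" "\<And>x. w x > 0" and L: "finite L" "L \<subseteq> lists Basis"
  shows "(\<lambda>k. weighted_norm L w (\<lambda>x. q k x - g x)) \<longlonglongrightarrow> weighted_norm L w (\<lambda>x. f x - g x)"
  unfolding weighted_norm_def
proof (intro tendsto_real_sqrt tendsto_sum)
  fix bs assume "bs \<in> L"
  then have bs: "bs \<in> lists Basis" using L by blast
  note sm = test_functions_smooth[OF q] test_functions_smooth[OF f] test_functions_smooth[OF g]
  obtain R1 where R1: "\<And>k x. norm x > R1 \<Longrightarrow> q k x = 0" using tc by (auto simp: test_converges_def)
  obtain R2 where R2: "\<And>x. norm x > R2 \<Longrightarrow> g x = 0" using test_functions_boundE[OF g] by blast
  show "(\<lambda>k. \<integral>x. (iter_deriv bs (\<lambda>x. q k x - g x) x)\<^sup>2 * w x \<partial>lborel)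
     \<longlonglongrightarrow> (\<integral>x. (iter_deriv bs (\<lambda>x. f x - g x) x)\<^sup>2 * w x \<partial>lborel)"
  proof (rule integral_square_tendsto[where R = "max R1 R2" and K = "length bs"])
    show "continuous_on UNIV (iter_deriv bs (\<lambda>x. f x - g x))"
      by (intro smooth_continuous smooth_iter_deriv smooth_diff sm bs)
    show "iter_deriv bs (\<lambda>x. q k x - g x) \<in> borel_measurable borel" for k
      by (intro smooth_measurable smooth_iter_deriv smooth_diff sm bs)
    show "continuous_on UNIV w" "w x \<ge> 0" for x using w by (auto intro: smooth_continuous less_imp_le)
    show "iter_deriv bs (\<lambda>x. q k x - g x) x = 0" if "norm x > max R1 R2" for k x
      by (rule iter_deriv_outside[OF _ that]) (use R1 R2 in auto)
    show "\<bar>iter_deriv bs (\<lambda>x. q k x - g x) x - iter_deriv bs (\<lambda>x. f x - g x) x\<bar> \<le> inverse (real (Suc k))"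
      if "k \<ge> length bs" for k x
    proof -
      have "\<bar>iter_deriv bs (\<lambda>x. f x - q k x) x\<bar> \<le> inverse (real (Suc k))"
        using tc that bs unfolding test_converges_def by blast
      then show ?thesis
        by (simp add: iter_deriv_diff sm bs abs_minus_commute)
    qed
  qed
qed

text \<open>A basis vector has a nonzero block, so a bound on the number of derivatives in each block bounds the
  length of the list.\<close>

lemma finite_tensor_indices:
  "finite {bs \<in> lists (Basis :: ((real^'d)^'n) set). \<forall>i. length (filter (\<lambda>b. b $ i \<noteq> 0) bs) \<le> l}"
proof (rule finite_subset[OF _ finite_lists_le[of "CARD('n) * l"]], rule subsetI)
  fix bs assume "bs \<in> {bs \<in> lists (Basis :: ((real^'d)^'n) set). \<forall>i. length (filter (\<lambda>b. b $ i \<noteq> 0) bs) \<le> l}"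
  then have bs: "bs \<in> lists (Basis :: ((real^'d)^'n) set)" and l: "\<forall>i. length (filter (\<lambda>b. b $ i \<noteq> 0) bs) \<le> l"
    by auto
  have "length bs \<le> (\<Sum>i\<in>UNIV. length (filter (\<lambda>b. b $ i \<noteq> 0) bs))"
    using bs
  proof (induction bs rule: list.induct)
    case (Cons b bs)
    then have "b \<noteq> 0" using nonzero_Basis by auto
    then obtain i where i: "b $ i \<noteq> 0" by (auto simp: vec_eq_iff)
    have "1 = (\<Sum>j\<in>UNIV. if j = i then 1 else 0 :: nat)" by simp
    also have "\<dots> \<le> (\<Sum>j\<in>UNIV. if b $ j \<noteq> 0 then 1 else 0)"
      by (intro sum_mono) (use i in auto)
    finally have 1: "1 \<le> (\<Sum>j\<in>UNIV. if b $ j \<noteq> 0 then 1 else 0 :: nat)" .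
    have 2: "length (filter (\<lambda>b. b $ j \<noteq> 0) (b # bs)) = (if b $ j \<noteq> 0 then 1 else 0) + length (filter (\<lambda>b. b $ j \<noteq> 0) bs)" for j
      by simp
    show ?case unfolding 2 sum.distrib using 1 Cons by simp
  qed simp
  also have "\<dots> \<le> (\<Sum>i\<in>(UNIV::'n set). l)" using l by (intro sum_mono) auto
  finally show "bs \<in> {bs \<in> lists Basis. length bs \<le> CARD('n) * l}" using bs by simp
qed

lemma tensor_weight:
  assumes "\<phi> \<in> weights"
  shows "smooth (\<lambda>x::(real^'d)^'n. \<Prod>i\<in>UNIV. \<phi> (x $ i))" "(\<Prod>i\<in>(UNIV::'n set). \<phi> (x $ i)) > 0"
proof -
  have \<phi>: "smooth \<phi>" "\<And>y. \<phi> y > 0"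
    using assms by (auto simp: weights_def intro: less_le_trans[OF zero_less_one])
  show "smooth (\<lambda>x::(real^'d)^'n. \<Prod>i\<in>UNIV. \<phi> (x $ i))" by (intro smooth_prod smooth_nth \<phi>)
  show "(\<Prod>i\<in>(UNIV::'n set). \<phi> (x $ i)) > 0" by (intro prod_pos) (simp add: \<phi>)
qed

lemma H_tensor_norm_0: "H_tensor_norm l \<phi> (\<lambda>x. 0) = 0" and H_norm_0: "H_norm l \<phi> (\<lambda>x. 0) = 0"
  by (auto simp: H_tensor_norm_def H_norm_def weighted_norm_def iter_deriv_const if_distrib cong: if_cong)

lemma continuous_dual_eq_limit:
  fixes V :: "((real^'d)^'n \<Rightarrow> real) set"
  assumes V: "V \<subseteq> test_functions"
    and F: "F \<in> continuous_dual (projective_topology V H_tensor_norm)"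
      "G \<in> continuous_dual (projective_topology V H_tensor_norm)"
    and q: "\<And>k. q k \<in> V" "f \<in> V" "test_converges q f" "\<And>k. F (q k) = G (q k)"
  shows "F f = G f"
proof -
  have lim: "(\<lambda>k. H (q k)) \<longlonglongrightarrow> H f" if "H \<in> continuous_dual (projective_topology V H_tensor_norm)" for H
  proof (rule continuous_dual_tendsto[of H_tensor_norm, OF H_tensor_norm_0 that q(1,2)])
    fix l and \<phi> :: "real^'d \<Rightarrow> real" and g assume "\<phi> \<in> weights" "g \<in> V"
    then show "(\<lambda>k. H_tensor_norm l \<phi> (\<lambda>x. q k x - g x)) \<longlonglongrightarrow> H_tensor_norm l \<phi> (\<lambda>x. f x - g x)"
      unfolding H_tensor_norm_def using V q
      by (intro weighted_norm_tendsto tensor_weight finite_tensor_indices) auto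
  qed
  show ?thesis using LIMSEQ_unique[OF lim[OF F(1)]] lim[OF F(2)] q(4) by simp
qed

lemma topspace_tensor: "topspace (projective_topology V H_tensor_norm) = V"
  by (rule topspace_projective[of H_tensor_norm, OF H_tensor_norm_0])

lemma norm_vec_le: "(\<And>i. norm ((x :: 'a::real_normed_vector^'n) $ i) \<le> R) \<Longrightarrow> norm x \<le> real CARD('n) * R"
proof -
  assume "\<And>i. norm (x $ i) \<le> R"
  then have "(\<Sum>i\<in>UNIV. norm (x $ i)) \<le> (\<Sum>i\<in>(UNIV::'n set). R)" by (intro sum_mono)
  then show ?thesis using L2_set_le_sum[of UNIV "\<lambda>i. norm (x $ i)"] by (simp add: norm_vec_def)
qed

lemma tensor_span_dense:
  fixes f :: "(real^'d)^'n \<Rightarrow> real"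
  assumes f: "f \<in> test_functions"
  obtains R q where "\<And>k. q k \<in> tensor_span" "\<And>k x. (\<exists>i. norm (x $ i) > R) \<Longrightarrow> q k x = 0"
    "\<And>k bs x. bs \<in> lists Basis \<Longrightarrow> length bs \<le> k \<Longrightarrow> \<bar>iter_deriv bs (\<lambda>x. f x - q k x) x\<bar> \<le> inverse (real (Suc k))"
proof -
  obtain R0 where R0: "R0 > 0" "\<And>x. norm x > R0 \<Longrightarrow> f x = 0" using test_functions_boundE[OF f] by blast
  have "\<exists>q. q \<in> tensor_span \<and> (\<forall>x. (\<exists>i. norm (x $ i) > R0 + 1) \<longrightarrow> q x = 0) \<and>
     (\<forall>bs\<in>lists Basis. length bs \<le> k \<longrightarrow> (\<forall>x. \<bar>iter_deriv bs (\<lambda>x. f x - q x) x\<bar> \<le> inverse (real (Suc k))))" for k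
  proof -
    have "inverse (real (Suc k)) > 0" by simp
    from tensor_approx[OF test_functions_smooth[OF f] R0 this, of k] show ?thesis unfolding Bex_def .
  qed
  then obtain q where q: "\<And>k. q k \<in> tensor_span \<and> (\<forall>x. (\<exists>i. norm (x $ i) > R0 + 1) \<longrightarrow> q k x = 0) \<and>
     (\<forall>bs\<in>lists Basis. length bs \<le> k \<longrightarrow> (\<forall>x. \<bar>iter_deriv bs (\<lambda>x. f x - q k x) x\<bar> \<le> inverse (real (Suc k))))"
    by metis
  show ?thesis by (rule that[of q "R0 + 1"]) (use q in blast)+
qed

lemma test_converges_of_dense:
  assumes "\<And>k x. (\<exists>i. norm ((x :: (real^'d)^'n) $ i) > R) \<Longrightarrow> q k x = 0"
    and "\<And>k bs x. bs \<in> lists Basis \<Longrightarrow> length bs \<le> k \<Longrightarrow> \<bar>iter_deriv bs (\<lambda>x. f x - q k x) x\<bar> \<le> inverse (real (Suc k))"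
  shows "test_converges q f"
  unfolding test_converges_def
proof (intro conjI exI[of _ "real CARD('n) * R"] allI impI ballI)
  fix k and x :: "(real^'d)^'n" assume "norm x > real CARD('n) * R"
  then have "\<exists>i. norm (x $ i) > R" using norm_vec_le[of x R] by (meson not_le)
  then show "q k x = 0" by (rule assms(1))
qed (use assms(2) in auto)

lemma continuous_dual_linear:
  assumes "F \<in> continuous_dual (projective_topology V H_tensor_norm)"
  shows "f \<in> V \<Longrightarrow> g \<in> V \<Longrightarrow> F (\<lambda>x. f x + g x) = F f + F g" "f \<in> V \<Longrightarrow> F (\<lambda>x. c * f x) = c * F f"
    "F \<in> extensional V"
  using assms by (auto simp: continuous_dual_def topspace_tensor)

text \<open>A distribution in several variables is determined by its values on tensor products.\<close>

lemma tensor_distributions_eqI: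
  fixes S T :: "((real^'d)^'n \<Rightarrow> real) \<Rightarrow> real"
  assumes S: "S \<in> tensor_distributions" and T: "T \<in> tensor_distributions"
    and eq: "\<And>\<xi>. (\<And>i. \<xi> i \<in> test_functions) \<Longrightarrow> S (fun_tensor \<xi>) = T (fun_tensor \<xi>)"
  shows "S = T"
proof (rule extensionalityI)
  note SL = continuous_dual_linear[OF S[unfolded tensor_distributions_def]]
  note TL = continuous_dual_linear[OF T[unfolded tensor_distributions_def]]
  show "S \<in> extensional test_functions" "T \<in> extensional test_functions" by (fact SL TL)+
  have span: "S q = T q" if "q \<in> tensor_span" for q
    using that
    by (induction rule: tensor_span.induct) (simp_all add: eq SL TL tensor_span_test)
  fix f :: "(real^'d)^'n \<Rightarrow> real" assume f: "f \<in> test_functions"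
  obtain R q where q: "\<And>k. q k \<in> tensor_span" "\<And>k x. (\<exists>i. norm (x $ i) > R) \<Longrightarrow> q k x = 0"
     "\<And>k bs x. bs \<in> lists Basis \<Longrightarrow> length bs \<le> k \<Longrightarrow> \<bar>iter_deriv bs (\<lambda>x. f x - q k x) x\<bar> \<le> inverse (real (Suc k))"
    by (rule tensor_span_dense[OF f], rule that)
  show "S f = T f"
    by (rule continuous_dual_eq_limit[OF subset_refl S[unfolded tensor_distributions_def] T[unfolded tensor_distributions_def]
          tensor_span_test[OF q(1)] f test_converges_of_dense[OF q(2,3)] span[OF q(1)]])
qed

section \<open>Symmetric tensors and polarization\<close>

lemma sum_supersets_alternating:
  fixes U :: "'n::finite set"
  shows "(\<Sum>S\<in>UNIV. if U \<subseteq> S then (-1) ^ (CARD('n) + card S) else 0) = (if U = UNIV then 1 else (0::real))"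
proof -
  have "(\<Sum>S\<in>UNIV. if U \<subseteq> S then (-1) ^ (CARD('n) + card S) else 0 :: real)
      = (-1) ^ CARD('n) * (\<Sum>S\<in>{S. U \<subseteq> S}. (-1) ^ card S)"
    by (simp add: sum.If_cases power_add sum_distrib_left)
  also have "(\<Sum>S\<in>{S. U \<subseteq> S}. (-1) ^ card S) = (if U = UNIV then (-1) ^ CARD('n) else (0::real))"
  proof (cases "U = UNIV")
    case True
    then have "{S. U \<subseteq> S} = {UNIV}" by auto
    then show ?thesis using True by simp
  next
    case False
    then have "U \<subset> UNIV" by auto
    from card_subsupersets_even_odd[OF _ this] False show ?thesis
      by (simp add: sum_alternating_cancels)
  qed
  finally show ?thesis by (auto simp flip: power_add)
qed

text \<open>Ryser's formula for the permanent.  Expanding the product gives a sum over all maps \<open>e\<close> from columns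
  to rows, and the alternating sum over the sets \<open>S\<close> that contain the range of \<open>e\<close> leaves the surjective
  maps only.\<close>

lemma permanent_polarization:
  fixes a :: "'n::finite \<Rightarrow> 'n \<Rightarrow> real"
  shows "(\<Sum>\<sigma> | \<sigma> permutes UNIV. \<Prod>i\<in>UNIV. a i (\<sigma> i)) =
    (\<Sum>S\<in>UNIV. (-1) ^ (CARD('n) + card S) * (\<Prod>j\<in>UNIV. \<Sum>i\<in>S. a i j))"
proof -
  have "(\<Prod>j\<in>UNIV. \<Sum>i\<in>S. a i j) = (\<Sum>e\<in>UNIV. if range e \<subseteq> S then \<Prod>j\<in>UNIV. a (e j) j else 0)" for S
  proof -
    have "(\<Prod>j\<in>UNIV. \<Sum>i\<in>S. a i j) = (\<Sum>e\<in>Pi\<^sub>E UNIV (\<lambda>_. S). \<Prod>j\<in>UNIV. a (e j) j)"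
      by (rule prod_sum_PiE) auto
    also have "Pi\<^sub>E UNIV (\<lambda>_. S) = {e. range e \<subseteq> S}" by (auto simp: PiE_def)
    finally show ?thesis by (simp add: sum.If_cases)
  qed
  then have "(\<Sum>S\<in>UNIV. (-1) ^ (CARD('n) + card S) * (\<Prod>j\<in>UNIV. \<Sum>i\<in>S. a i j)) =
    (\<Sum>S\<in>UNIV. \<Sum>e\<in>UNIV. (if range e \<subseteq> S then (-1) ^ (CARD('n) + card S) else 0) * (\<Prod>j\<in>UNIV. a (e j) j))"
    by (simp add: sum_distrib_left if_distrib if_distribR cong: if_cong)
  also have "\<dots> = (\<Sum>e\<in>UNIV. (\<Sum>S\<in>UNIV. if range e \<subseteq> S then (-1) ^ (CARD('n) + card S) else 0) * (\<Prod>j\<in>UNIV. a (e j) j))"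
    by (subst sum.swap) (simp add: sum_distrib_right)
  also have "\<dots> = (\<Sum>e\<in>UNIV. if range e = UNIV then \<Prod>j\<in>UNIV. a (e j) j else 0)"
    unfolding sum_supersets_alternating by (intro sum.cong) auto
  also have "\<dots> = (\<Sum>e | range e = UNIV. \<Prod>j\<in>UNIV. a (e j) j)"
    by (simp add: sum.If_cases)
  also have "{e :: 'n \<Rightarrow> 'n. range e = UNIV} = {\<sigma>. \<sigma> permutes UNIV}"
    by (auto simp: permutes_surj intro!: bij_imp_permutes finite_UNIV_surj_inj bijI)
  also have "(\<Sum>\<sigma> | \<sigma> permutes UNIV. \<Prod>j\<in>UNIV. a (\<sigma> j) j) = (\<Sum>\<sigma> | \<sigma> permutes UNIV. \<Prod>j\<in>UNIV. a (inv \<sigma> j) j)"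
    by (rule sum_permutations_inverse)
  also have "\<dots> = (\<Sum>\<sigma> | \<sigma> permutes UNIV. \<Prod>i\<in>UNIV. a i (\<sigma> i))"
  proof (rule sum.cong)
    fix \<sigma> :: "'n \<Rightarrow> 'n" assume "\<sigma> \<in> {\<sigma>. \<sigma> permutes UNIV}"
    then have p: "\<sigma> permutes UNIV" by simp
    show "(\<Prod>j\<in>UNIV. a (inv \<sigma> j) j) = (\<Prod>i\<in>UNIV. a i (\<sigma> i))"
      using prod.permute[OF p, of "\<lambda>j. a (inv \<sigma> j) j"] permutes_inverses(2)[OF p] by (simp add: o_def)
  qed simp
  finally show ?thesis by simp
qed

lemma sym_test_functions_add: "f \<in> sym_test_functions \<Longrightarrow> g \<in> sym_test_functions \<Longrightarrow> (\<lambda>x. f x + g x) \<in> sym_test_functions"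
  and sym_test_functions_cmult: "f \<in> sym_test_functions \<Longrightarrow> (\<lambda>x. c * f x) \<in> sym_test_functions"
  and sym_test_functions_diff: "f \<in> sym_test_functions \<Longrightarrow> g \<in> sym_test_functions \<Longrightarrow> (\<lambda>x. f x - g x) \<in> sym_test_functions"
  and sym_test_functions_zero: "(\<lambda>x. 0) \<in> sym_test_functions"
  by (auto simp: sym_test_functions_def symmetric_function_def test_functions_add test_functions_cmult
    test_functions_diff test_functions_zero)

lemma sym_test_functions_sum: "(\<And>i. i \<in> I \<Longrightarrow> f i \<in> sym_test_functions) \<Longrightarrow> (\<lambda>x. \<Sum>i\<in>I. f i x) \<in> sym_test_functions"
  by (induction I rule: infinite_finite_induct) (auto intro: sym_test_functions_add sym_test_functions_zero)

lemma fun_tensor_diagonal_sym: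
  fixes \<xi> :: "real^'d \<Rightarrow> real"
  assumes "\<xi> \<in> test_functions"
  shows "(fun_tensor (\<lambda>_. \<xi>) :: (real^'d)^'n \<Rightarrow> real) \<in> sym_test_functions"
proof -
  have "(\<Prod>i\<in>UNIV. \<xi> (x $ \<sigma> i)) = (\<Prod>i\<in>UNIV. \<xi> (x $ i))" if "\<sigma> permutes UNIV" for \<sigma> and x :: "(real^'d)^'n"
    using prod.permute[OF that, of "\<lambda>i. \<xi> (x $ i)"] by (simp add: o_def)
  then show ?thesis
    using fun_tensor_test[of "\<lambda>_. \<xi>"] assms by (simp add: sym_test_functions_def symmetric_function_def fun_tensor_def)
qed

text \<open>The action of a map of the index set on vectors.\<close>

definition permute_vec :: "('n \<Rightarrow> 'n) \<Rightarrow> 'a^'n \<Rightarrow> 'a^'n" where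
  "permute_vec \<sigma> x = (\<chi> i. x $ \<sigma> i)"

lemma linear_permute_vec: "linear (permute_vec \<sigma> :: 'a::real_vector^'n \<Rightarrow> 'a^'n)"
  by (rule linearI) (auto simp: permute_vec_def vec_eq_iff)

lemma permute_vec_Basis:
  assumes "\<sigma> permutes UNIV" "b \<in> Basis" shows "permute_vec \<sigma> b \<in> (Basis :: ('a::euclidean_space^'n) set)"
proof -
  obtain i u where b: "b = axis i u" "u \<in> Basis" using assms(2) by (auto simp: Basis_vec_def)
  have "permute_vec \<sigma> b = axis (inv \<sigma> i) u"
    using permutes_inverses[OF assms(1)] by (auto simp: permute_vec_def axis_def b vec_eq_iff)
  then show ?thesis using b by (auto simp: Basis_vec_def)
qed

text \<open>The average of \<open>f\<close> over all permutations of its arguments.\<close>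

definition symmetrize :: "('a^'n \<Rightarrow> real) \<Rightarrow> 'a^'n \<Rightarrow> real" where
  "symmetrize f x = (\<Sum>\<sigma> | \<sigma> permutes UNIV. f (permute_vec \<sigma> x)) / fact CARD('n)"

lemma card_perms: "card {\<sigma>. \<sigma> permutes (UNIV :: 'n::finite set)} = fact CARD('n)"
  by (simp add: card_permutations)

lemma finite_perms: "finite {\<sigma>. \<sigma> permutes (UNIV :: 'n::finite set)}"
  by (simp add: finite_permutations)

lemma symmetrize_fixed:
  fixes f :: "(real^'d)^'n \<Rightarrow> real"
  assumes "symmetric_function f" shows "symmetrize f = f"
proof
  fix x
  have "(\<Sum>\<sigma> | \<sigma> permutes (UNIV::'n set). f (permute_vec \<sigma> x)) = (\<Sum>\<sigma> | \<sigma> permutes (UNIV::'n set). f x)"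
    using assms by (intro sum.cong) (auto simp: symmetric_function_def permute_vec_def)
  then show "symmetrize f x = f x" by (simp add: symmetrize_def card_perms)
qed

text \<open>Polarization: the symmetrization of a tensor product is a linear combination of tensor powers.\<close>

lemma symmetrize_fun_tensor:
  "symmetrize (fun_tensor \<xi>) = (\<lambda>x::(real^'d)^'n. \<Sum>S\<in>UNIV. ((-1) ^ (CARD('n) + card S) / fact CARD('n)) *
      fun_tensor (\<lambda>_ y. \<Sum>i\<in>S. \<xi> i y) x)"
proof
  fix x :: "(real^'d)^'n"
  have "symmetrize (fun_tensor \<xi>) x = (\<Sum>\<sigma> | \<sigma> permutes UNIV. \<Prod>i\<in>UNIV. \<xi> i (x $ \<sigma> i)) / fact CARD('n)"
    by (simp add: symmetrize_def fun_tensor_def permute_vec_def)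
  also have "\<dots> = (\<Sum>S\<in>UNIV. (-1) ^ (CARD('n) + card S) * (\<Prod>j\<in>UNIV. \<Sum>i\<in>S. \<xi> i (x $ j))) / fact CARD('n)"
    by (subst permanent_polarization[of "\<lambda>i j. \<xi> i (x $ j)"]) simp
  finally show "symmetrize (fun_tensor \<xi>) x = (\<Sum>S\<in>UNIV. ((-1) ^ (CARD('n) + card S) / fact CARD('n)) *
      fun_tensor (\<lambda>_ y. \<Sum>i\<in>S. \<xi> i y) x)"
    by (simp add: fun_tensor_def sum_divide_distrib)
qed

lemma symmetrize_add: "symmetrize (\<lambda>x. f x + g x) = (\<lambda>x. symmetrize f x + symmetrize g x)"
  and symmetrize_diff: "symmetrize (\<lambda>x. f x - g x) = (\<lambda>x. symmetrize f x - symmetrize g x)"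
  and symmetrize_cmult: "symmetrize (\<lambda>x. c * f x) = (\<lambda>x. c * symmetrize f x)"
  by (auto simp: symmetrize_def sum.distrib sum_subtractf add_divide_distrib diff_divide_distrib sum_distrib_left)

lemma tensor_span_symmetrize:
  "f \<in> tensor_span \<Longrightarrow> symmetrize f \<in> sym_test_functions"
proof (induction rule: tensor_span.induct)
  case (tensor \<xi>)
  show ?case unfolding symmetrize_fun_tensor
    by (intro sym_test_functions_sum sym_test_functions_cmult fun_tensor_diagonal_sym test_functions_sum tensor)
qed (simp_all add: symmetrize_add symmetrize_cmult sym_test_functions_add sym_test_functions_cmult)

text \<open>Permutations of the blocks permute the derivatives of a given order.\<close>

lemma iter_deriv_symmetrize_bound:
  fixes f :: "(real^'d)^'n \<Rightarrow> real"
  assumes f: "smooth f" and bs: "bs \<in> lists Basis"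
    and bound: "\<And>cs x. cs \<in> lists Basis \<Longrightarrow> length cs = length bs \<Longrightarrow> \<bar>iter_deriv cs f x\<bar> \<le> \<delta>"
  shows "\<bar>iter_deriv bs (symmetrize f) x\<bar> \<le> \<delta>"
proof -
  let ?P = "{\<sigma>. \<sigma> permutes (UNIV :: 'n set)}"
  have perm_Basis: "permute_vec \<sigma> b \<in> Basis" if "\<sigma> \<in> ?P" "b \<in> Basis" for \<sigma> and b :: "(real^'d)^'n"
    using that by (intro permute_vec_Basis) auto
  have sm: "smooth (\<lambda>x. f (permute_vec \<sigma> x))" if "\<sigma> \<in> ?P" for \<sigma>
    by (rule smooth_linear_compose[OF f linear_permute_vec]) (use perm_Basis[OF that] in blast)
  have 1: "iter_deriv bs (\<lambda>x. \<Sum>\<sigma>\<in>A. f (permute_vec \<sigma> x)) = (\<lambda>x. \<Sum>\<sigma>\<in>A. iter_deriv (map (permute_vec \<sigma>) bs) f (permute_vec \<sigma> x))"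
    if "finite A" "A \<subseteq> ?P" for A
    using that
  proof (induction A rule: finite_induct)
    case (insert \<sigma> A)
    have "smooth (\<lambda>x. \<Sum>\<sigma>\<in>A. f (permute_vec \<sigma> x))" using insert.prems sm by (intro smooth_sum) auto
    moreover have "iter_deriv bs (\<lambda>x. f (permute_vec \<sigma> x)) = (\<lambda>x. iter_deriv (map (permute_vec \<sigma>) bs) f (permute_vec \<sigma> x))"
      by (rule iter_deriv_linear_compose[OF f linear_permute_vec _ bs]) (use insert.prems perm_Basis in blast)
    ultimately show ?case using insert sm[of \<sigma>] by (simp add: iter_deriv_add bs)
  qed (simp add: iter_deriv_const)
  have "iter_deriv bs (symmetrize f) x = inverse (fact CARD('n)) * iter_deriv bs (\<lambda>x. \<Sum>\<sigma>\<in>?P. f (permute_vec \<sigma> x)) x"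
    unfolding symmetrize_def[abs_def] divide_inverse
    using iter_deriv_cmult[OF smooth_sum[OF sm] bs, of ?P "\<lambda>i. i" "inverse (fact CARD('n))"] by (simp add: mult.commute)
  also have "\<dots> = inverse (fact CARD('n)) * (\<Sum>\<sigma>\<in>?P. iter_deriv (map (permute_vec \<sigma>) bs) f (permute_vec \<sigma> x))"
    by (subst 1[OF finite_perms]) auto
  finally have eq: "iter_deriv bs (symmetrize f) x = inverse (fact CARD('n)) * (\<Sum>\<sigma>\<in>?P. iter_deriv (map (permute_vec \<sigma>) bs) f (permute_vec \<sigma> x))" .
  have "\<bar>\<Sum>\<sigma>\<in>?P. iter_deriv (map (permute_vec \<sigma>) bs) f (permute_vec \<sigma> x)\<bar> \<le> (\<Sum>\<sigma>\<in>?P. \<delta>)"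
  proof (intro order_trans[OF sum_abs] sum_mono bound)
    fix \<sigma> assume "\<sigma> \<in> ?P"
    then have "permute_vec \<sigma> b \<in> Basis" if "b \<in> set bs" for b
      using perm_Basis that bs by auto
    then show "map (permute_vec \<sigma>) bs \<in> lists Basis" by auto
  qed simp
  also have "\<dots> = fact CARD('n) * \<delta>" by (simp add: card_perms)
  finally show ?thesis unfolding eq abs_mult by (simp add: field_simps)
qed

text \<open>A symmetric distribution is determined by its values on the powers \<open>\<xi>\<^sup>\<otimes>\<^sup>n\<close>.\<close>

lemma sym_tensor_distributions_eqI:
  fixes F G :: "((real^'d)^'n \<Rightarrow> real) \<Rightarrow> real"
  assumes F: "F \<in> sym_tensor_distributions" and G: "G \<in> sym_tensor_distributions"
    and eq: "\<And>\<xi>. \<xi> \<in> test_functions \<Longrightarrow> F (fun_tensor (\<lambda>_. \<xi>)) = G (fun_tensor (\<lambda>_. \<xi>))"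
  shows "F = G"
proof (rule extensionalityI)
  note FL = continuous_dual_linear[OF F[unfolded sym_tensor_distributions_def]]
  note GL = continuous_dual_linear[OF G[unfolded sym_tensor_distributions_def]]
  show "F \<in> extensional sym_test_functions" "G \<in> extensional sym_test_functions" by (fact FL GL)+
  have sum: "F (\<lambda>x. \<Sum>i\<in>I. c i * h i x) = G (\<lambda>x. \<Sum>i\<in>I. c i * h i x)"
    if "finite I" "\<And>i. i \<in> I \<Longrightarrow> h i \<in> sym_test_functions" "\<And>i. i \<in> I \<Longrightarrow> F (h i) = G (h i)" for I :: "'n set set" and c h
    using that
  proof (induction I rule: finite_induct)
    case empty
    then show ?case using FL(2)[OF sym_test_functions_zero, of 0] GL(2)[OF sym_test_functions_zero, of 0] by simp
  next
    case (insert i I)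
    have "(\<lambda>x. \<Sum>i\<in>I. c i * h i x) \<in> sym_test_functions" "(\<lambda>x. c i * h i x) \<in> sym_test_functions"
      using insert.prems by (auto intro!: sym_test_functions_sum sym_test_functions_cmult)
    then show ?case using insert by (simp add: FL GL)
  qed
  have span: "F (symmetrize q) = G (symmetrize q)" if "q \<in> tensor_span" for q
    using that
  proof (induction rule: tensor_span.induct)
    case (tensor \<xi>)
    show ?case unfolding symmetrize_fun_tensor
      by (intro sum fun_tensor_diagonal_sym eq test_functions_sum tensor finite)
  qed (simp_all add: symmetrize_add symmetrize_cmult tensor_span_symmetrize FL GL)
  fix f :: "(real^'d)^'n \<Rightarrow> real" assume f: "f \<in> sym_test_functions"
  then have ft: "f \<in> test_functions" and fs: "symmetric_function f" by (auto simp: sym_test_functions_def)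
  obtain R q where q: "\<And>k. q k \<in> tensor_span" "\<And>k x. (\<exists>i. norm (x $ i) > R) \<Longrightarrow> q k x = 0"
     "\<And>k bs x. bs \<in> lists Basis \<Longrightarrow> length bs \<le> k \<Longrightarrow> \<bar>iter_deriv bs (\<lambda>x. f x - q k x) x\<bar> \<le> inverse (real (Suc k))"
    by (rule tensor_span_dense[OF ft], rule that)
  have "test_converges (\<lambda>k. symmetrize (q k)) f"
  proof (rule test_converges_of_dense)
    fix k and x :: "(real^'d)^'n" assume "\<exists>i. norm (x $ i) > R"
    then obtain i where i: "norm (x $ i) > R" by blast
    have "q k (permute_vec \<sigma> x) = 0" if "\<sigma> permutes UNIV" for \<sigma>
      using i permutes_inverses(1)[OF that, of i] by (intro q(2) exI[of _ "inv \<sigma> i"]) (simp add: permute_vec_def)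
    then show "symmetrize (q k) x = 0" by (simp add: symmetrize_def)
  next
    fix k and bs :: "((real^'d)^'n) list" and x assume bs: "bs \<in> lists Basis" "length bs \<le> k"
    have "(\<lambda>x. f x - symmetrize (q k) x) = symmetrize (\<lambda>x. f x - q k x)"
      by (simp add: symmetrize_diff symmetrize_fixed[OF fs])
    moreover have "\<bar>iter_deriv bs (symmetrize (\<lambda>x. f x - q k x)) x\<bar> \<le> inverse (real (Suc k))"
      using bs q(3)
      by (intro iter_deriv_symmetrize_bound smooth_diff test_functions_smooth ft tensor_span_test q(1)) auto
    ultimately show "\<bar>iter_deriv bs (\<lambda>x. f x - symmetrize (q k) x) x\<bar> \<le> inverse (real (Suc k))" by simp
  qed
  from continuous_dual_eq_limit[OF _ F[unfolded sym_tensor_distributions_def] G[unfolded sym_tensor_distributions_def]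
      tensor_span_symmetrize[OF q(1)] f this span[OF q(1)]]
  show "F f = G f" by (auto simp: sym_test_functions_def)
qed

section \<open>Weighted bounds for locally finite configurations\<close>

text \<open>The weight absorbs the square of the counting function of the configuration and the reciprocal of
  \<open>decay\<close>, both of which are bounded on bounded sets.\<close>

lemma configuration_weight:
  fixes x :: "nat \<Rightarrow> 'a::euclidean_space"
  assumes fin: "\<And>r. finite {i. norm (x i) \<le> r}"
  shows "\<exists>\<phi>\<in>weights. \<forall>y::'a. (real (card {i. norm (x i) \<le> norm y}))\<^sup>2 \<le> \<phi> y * decay y"
proof -
  define A where "A = (\<lambda>k. (real (card {i. norm (x i) \<le> sqrt (real (Suc k))}))\<^sup>2 * (1 + real (Suc k)) ^ DIM('a))"
  obtain \<phi> where \<phi>: "\<phi> \<in> weights" "\<And>y::'a. \<And>k. real k \<le> (norm y)\<^sup>2 \<and> (norm y)\<^sup>2 \<le> real (Suc k) \<Longrightarrow> A k \<le> \<phi> y"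
    using weight_dominating[of A, where 'a='a] by blast
  have "(real (card {i. norm (x i) \<le> norm y}))\<^sup>2 \<le> \<phi> y * decay y" for y :: 'a
  proof -
    define k where "k = nat \<lfloor>(norm y)\<^sup>2\<rfloor>"
    have k: "real k \<le> (norm y)\<^sup>2" "(norm y)\<^sup>2 \<le> real (Suc k)" unfolding k_def by (simp_all add: of_nat_nat) linarith
    have "norm y \<le> sqrt (real (Suc k))" using k(2) by (rule real_le_rsqrt)
    then have c: "card {i. norm (x i) \<le> norm y} \<le> card {i. norm (x i) \<le> sqrt (real (Suc k))}"
      by (intro card_mono fin) auto
    have *: "(\<Prod>b\<in>(Basis::'a set). 1 + (y \<bullet> b)\<^sup>2) \<le> (\<Prod>b\<in>(Basis::'a set). 1 + real (Suc k))"
    proof (intro prod_mono conjI)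
      fix b :: 'a assume "b \<in> Basis"
      then have "\<bar>y \<bullet> b\<bar>\<^sup>2 \<le> (norm y)\<^sup>2" by (intro power_mono Basis_le_norm) auto
      then show "1 + (y \<bullet> b)\<^sup>2 \<le> 1 + real (Suc k)" using k by simp
    qed simp
    have d: "1 \<le> (1 + real (Suc k)) ^ DIM('a) * decay y"
    proof -
      have "decay y = inverse (\<Prod>b\<in>Basis. 1 + (y \<bullet> b)\<^sup>2)"
        using prod_inversef[of "\<lambda>b. 1 + (y \<bullet> b)\<^sup>2" Basis] by (simp add: decay_def o_def)
      moreover have "(\<Prod>b\<in>Basis. 1 + (y \<bullet> b)\<^sup>2) > 0"
        by (intro prod_pos) (simp add: add_pos_nonneg)
      ultimately have "(\<Prod>b\<in>Basis. 1 + (y \<bullet> b)\<^sup>2) * decay y = 1" by (metis less_irrefl right_inverse)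
      then show ?thesis using mult_right_mono[OF *, of "decay y"] decay_pos[of y] by simp
    qed
    have "(real (card {i. norm (x i) \<le> norm y}))\<^sup>2 \<le> (real (card {i. norm (x i) \<le> sqrt (real (Suc k))}))\<^sup>2"
      using c by (intro power_mono) auto
    also have "\<dots> \<le> (real (card {i. norm (x i) \<le> sqrt (real (Suc k))}))\<^sup>2 * ((1 + real (Suc k)) ^ DIM('a) * decay y)"
      using mult_left_mono[OF d, of "(real (card {i. norm (x i) \<le> sqrt (real (Suc k))}))\<^sup>2"] by simp
    also have "\<dots> = A k * decay y" by (simp add: A_def)
    also have "\<dots> \<le> \<phi> y * decay y" using \<phi>(2)[of k y] k decay_pos[of y] by (intro mult_right_mono) auto
    finally show ?thesis .
  qed
  then show ?thesis using \<phi>(1) by blast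
qed

lemma configuration_bound:
  fixes x :: "nat \<Rightarrow> real^'d"
  assumes fin: "\<And>r. finite {i. norm (x i) \<le> r}"
  shows "\<exists>C \<phi> l. C \<ge> 0 \<and> \<phi> \<in> weights \<and>
    (\<forall>f\<in>test_functions. \<forall>J. finite J \<longrightarrow> (\<Sum>i\<in>J. \<bar>f (x i)\<bar>) \<le> C * H_norm l \<phi> f)"
proof -
  obtain \<phi> where \<phi>: "\<phi> \<in> weights" "\<And>y :: real^'d. (real (card {i. norm (x i) \<le> norm y}))\<^sup>2 \<le> \<phi> y * decay y"
    using configuration_weight[OF fin] by blast
  obtain bs where bs: "set bs = (Basis :: (real^'d) set)" "distinct bs" using finite_distinct_list finite_Basis by blast
  have "(\<Sum>i\<in>J. \<bar>f (x i)\<bar>) \<le> sqrt (enn2real (\<integral>\<^sup>+ x. ennreal (decay (x::real^'d)) \<partial>lborel)) * H_norm (length bs) \<phi> f"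
    if "f \<in> test_functions" "finite J" for f J
    unfolding H_norm_def
  proof (rule sum_abs_le_weighted_norm[where N = "\<lambda>y. real (card {i. norm (x i) \<le> norm y})" and bs = bs])
    show "real (card {j \<in> J. y \<in> orthant (x j)}) \<le> real (card {i. norm (x i) \<le> norm y})" for y
      by (simp, intro card_mono fin) (auto intro: orthant_norm)
    show "\<phi> y > 0" for y using \<phi>(1) by (auto simp: weights_def intro: less_le_trans[OF zero_less_one])
  qed (use that \<phi> bs finite_lists_le in \<open>auto simp: weights_def\<close>)
  then show ?thesis using \<phi>(1)
    by (intro exI[of _ "sqrt (enn2real (\<integral>\<^sup>+ x. ennreal (decay (x::real^'d)) \<partial>lborel))"] exI[of _ \<phi>] exI[of _ "length bs"]) auto
qed

lemma orthant_vec: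
  assumes "(y :: (real^'d)^'n) \<in> orthant p" shows "y $ j \<in> orthant (p $ j)"
proof -
  have "y $ j \<bullet> b \<in> half_line (p $ j \<bullet> b)" if "b \<in> Basis" for b
  proof -
    have "axis j b \<in> (Basis :: ((real^'d)^'n) set)" using that by (auto simp: Basis_vec_def)
    then have "y \<bullet> axis j b \<in> half_line (p \<bullet> axis j b)" using assms by (simp add: orthant_def)
    then show ?thesis by (simp add: inner_axis)
  qed
  then show ?thesis by (simp add: orthant_def)
qed

lemma decay_vec: "decay (y :: (real^'d)^'n) = (\<Prod>j\<in>UNIV. decay (y $ j))"
  by (simp add: decay_def prod_Basis_vec inner_axis)

text \<open>Here \<open>E\<close> ranges over all finite sets of index maps, injective or not: the number of maps \<open>e\<close> for which
  the orthant of \<open>(x (e j))\<^sub>j\<close> contains \<open>y\<close> is at most the product of the counting functions of the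
  blocks of \<open>y\<close>.\<close>

lemma configuration_tensor_bound:
  fixes x :: "nat \<Rightarrow> real^'d"
  assumes fin: "\<And>r. finite {i. norm (x i) \<le> r}"
  shows "\<exists>C \<phi> l. C \<ge> 0 \<and> \<phi> \<in> weights \<and>
    (\<forall>f\<in>test_functions. \<forall>E :: ('n \<Rightarrow> nat) set. finite E \<longrightarrow>
        (\<Sum>e\<in>E. \<bar>f (\<chi> j. x (e j) :: (real^'d)^'n)\<bar>) \<le> C * H_tensor_norm l \<phi> f)"
proof -
  define cnt where "cnt = (\<lambda>y. real (card {i. norm (x i) \<le> norm (y :: real^'d)}))"
  obtain \<phi> where \<phi>: "\<phi> \<in> weights" "\<And>y. (cnt y)\<^sup>2 \<le> \<phi> y * decay y"
    using configuration_weight[OF fin] unfolding cnt_def by blast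
  obtain B where B: "set B = (Basis :: ((real^'d)^'n) set)" "distinct B" using finite_distinct_list finite_Basis by blast
  let ?p = "\<lambda>e. (\<chi> j. x (e j)) :: (real^'d)^'n"
  have "(\<Sum>e\<in>E. \<bar>f (?p e)\<bar>) \<le> sqrt (enn2real (\<integral>\<^sup>+ x. ennreal (decay (x::(real^'d)^'n)) \<partial>lborel)) * H_tensor_norm (length B) \<phi> f"
    if "f \<in> test_functions" "finite E" for f and E :: "('n \<Rightarrow> nat) set"
    unfolding H_tensor_norm_def
  proof (rule sum_abs_le_weighted_norm[where N = "\<lambda>y. \<Prod>j\<in>UNIV. cnt (y $ j)" and bs = B])
    show "real (card {e \<in> E. y \<in> orthant (?p e)}) \<le> (\<Prod>j\<in>UNIV. cnt (y $ j))" for y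
    proof -
      have "{e \<in> E. y \<in> orthant (?p e)} \<subseteq> Pi\<^sub>E UNIV (\<lambda>j. {i. norm (x i) \<le> norm (y $ j)})"
        using orthant_vec[THEN orthant_norm, of y] by fastforce
      then have "card {e \<in> E. y \<in> orthant (?p e)} \<le> card (Pi\<^sub>E (UNIV :: 'n set) (\<lambda>j. {i. norm (x i) \<le> norm (y $ j)}))"
        by (intro card_mono finite_PiE fin) auto
      then show ?thesis by (simp add: card_PiE cnt_def flip: of_nat_prod)
    qed
    show "(\<Prod>j\<in>UNIV. cnt (y $ j))\<^sup>2 \<le> (\<Prod>i\<in>UNIV. \<phi> (y $ i)) * decay y" for y :: "(real^'d)^'n"
      unfolding decay_vec prod.distrib[symmetric] prod_power_distrib
      by (intro prod_mono) (use \<phi>(2) in auto)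
    show "B \<in> {bs \<in> lists Basis. \<forall>i. length (filter (\<lambda>b. b $ i \<noteq> 0) bs) \<le> length B}"
      using B by auto
  qed (use that B tensor_weight[OF \<phi>(1)] finite_tensor_indices in auto)
  then show ?thesis using \<phi>(1)
    by (intro exI[of _ "sqrt (enn2real (\<integral>\<^sup>+ x. ennreal (decay (x::(real^'d)^'n)) \<partial>lborel))"] exI[of _ \<phi>] exI[of _ "length B"]) auto
qed

section \<open>The generating function of a configuration\<close>

text \<open>Both sides \<open>F\<close> solve \<open>F' = F * (\<Sum>i\<in>A. c i / (1 + c i t))\<close> with constant term one.\<close>

lemma exp_log_series_eq_prod:
  fixes c :: "'i \<Rightarrow> real"
  assumes A: "finite A"
  shows "fps_compose (fps_exp 1) (Abs_fps (\<lambda>k. if k = 0 then 0 else (-1) ^ (k + 1) / real k * (\<Sum>i\<in>A. c i ^ k)))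
    = (\<Prod>i\<in>A. 1 + fps_const (c i) * fps_X)"
proof -
  define L where "L = Abs_fps (\<lambda>k. if k = 0 then 0 else (-1) ^ (k + 1) / real k * (\<Sum>i\<in>A. c i ^ k))"
  define E where "E = fps_compose (fps_exp 1) L"
  define g where "g = (\<lambda>i. Abs_fps (\<lambda>k. (-1) ^ k * c i ^ Suc k))"
  define P where "P = (\<lambda>A. \<Prod>i\<in>A. 1 + fps_const (c i) * fps_X)"
  have L0: "fps_nth L 0 = 0" by (simp add: L_def)
  have L': "fps_deriv L = (\<Sum>i\<in>A. g i)"
  proof (rule fps_ext)
    fix k
    have "fps_nth (fps_deriv L) k = (-1) ^ k * (\<Sum>i\<in>A. c i ^ Suc k)" by (simp add: L_def del: of_nat_Suc)
    then show "fps_nth (fps_deriv L) k = fps_nth (\<Sum>i\<in>A. g i) k"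
      by (simp add: fps_sum_nth g_def sum_distrib_left)
  qed
  have E': "fps_deriv E = E * (\<Sum>i\<in>A. g i)"
    using fps_compose_deriv[OF L0, of "fps_exp 1"] by (simp add: E_def L')
  have g: "(1 + fps_const (c i) * fps_X) * g i = fps_const (c i)" for i
  proof (rule fps_ext)
    fix k show "fps_nth ((1 + fps_const (c i) * fps_X) * g i) k = fps_nth (fps_const (c i)) k"
      by (cases k) (simp_all add: distrib_right mult.assoc g_def)
  qed
  have P': "fps_deriv (P B) = P B * (\<Sum>i\<in>B. g i)" if "finite B" for B
    using that
  proof (induction B rule: finite_induct)
    case (insert i B)
    have P_insert: "P (insert i B) = (1 + fps_const (c i) * fps_X) * P B"
      using insert.hyps by (simp add: P_def)
    have "fps_deriv (P (insert i B)) = fps_const (c i) * P B + (1 + fps_const (c i) * fps_X) * fps_deriv (P B)"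
      unfolding P_insert by simp
    also have "\<dots> = ((1 + fps_const (c i) * fps_X) * g i) * P B + (1 + fps_const (c i) * fps_X) * (P B * (\<Sum>i\<in>B. g i))"
      by (simp only: g insert.IH)
    also have "\<dots> = ((1 + fps_const (c i) * fps_X) * P B) * (g i + (\<Sum>i\<in>B. g i))"
      by (simp only: algebra_simps)
    finally show ?case using insert.hyps by (simp add: P_insert)
  qed (simp add: P_def)
  have P0: "fps_nth (P B) 0 = 1" for B
    unfolding P_def by (induction B rule: infinite_finite_induct) auto
  have "fps_deriv (E * inverse (P A)) = 0"
  proof -
    have "fps_deriv (E * inverse (P A)) = E * (- fps_deriv (P A) * (inverse (P A))\<^sup>2) + fps_deriv E * inverse (P A)"
      using P0 by (simp add: fps_inverse_deriv)
    also have "\<dots> = E * (\<Sum>i\<in>A. g i) * inverse (P A) * (1 - inverse (P A) * P A)"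
      by (simp add: E' P'[OF A] algebra_simps power2_eq_square)
    also have "inverse (P A) * P A = 1" using P0 by (simp add: inverse_mult_eq_1)
    finally show ?thesis by simp
  qed
  then have "E * inverse (P A) = fps_const (fps_nth (E * inverse (P A)) 0)" by (rule iffD1[OF fps_deriv_eq_0_iff])
  also have "fps_nth (E * inverse (P A)) 0 = 1" using P0 by (simp add: E_def)
  finally have 1: "E * inverse (P A) = 1" by simp
  have "E = E * (inverse (P A) * P A)" using P0 by (simp add: inverse_mult_eq_1)
  also have "\<dots> = P A" by (simp only: mult.assoc[symmetric] 1 mult_1)
  finally show ?thesis unfolding E_def L_def P_def .
qed

lemma prod_one_plus_nth:
  fixes c :: "'i \<Rightarrow> real"
  assumes A: "finite A"
  shows "fps_nth (\<Prod>i\<in>A. 1 + fps_const (c i) * fps_X) n = (\<Sum>I | I \<subseteq> A \<and> card I = n. \<Prod>i\<in>I. c i)"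
proof -
  have "(\<Prod>i\<in>A. 1 + fps_const (c i) * fps_X) = (\<Sum>I\<in>Pow A. (\<Prod>i\<in>I. fps_const (c i) * fps_X) * (\<Prod>i\<in>A - I. 1))"
    using prod_add[OF A, of "\<lambda>i. fps_const (c i) * fps_X" "\<lambda>_. 1"] by (simp add: add.commute)
  also have "\<dots> = (\<Sum>I\<in>Pow A. fps_const (\<Prod>i\<in>I. c i) * fps_X ^ card I)"
  proof (rule sum.cong)
    fix I assume "I \<in> Pow A"
    have "(\<Prod>i\<in>I. fps_const (c i)) = fps_const (\<Prod>i\<in>I. c i)"
      by (induction I rule: infinite_finite_induct) auto
    then show "(\<Prod>i\<in>I. fps_const (c i) * fps_X) * (\<Prod>i\<in>A - I. 1) = fps_const (\<Prod>i\<in>I. c i) * fps_X ^ card I"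
      by (simp add: prod.distrib)
  qed simp
  finally have "fps_nth (\<Prod>i\<in>A. 1 + fps_const (c i) * fps_X) n = (\<Sum>I\<in>Pow A. if card I = n then \<Prod>i\<in>I. c i else 0)"
    by (simp add: fps_sum_nth if_distrib eq_commute cong: if_cong)
  also have "\<dots> = (\<Sum>I | I \<in> Pow A \<and> card I = n. \<Prod>i\<in>I. c i)"
    using sum.inter_filter[of "Pow A" "\<lambda>I. prod c I" "\<lambda>I. card I = n"] A by simp
  finally show ?thesis by simp
qed

section \<open>Sums of Dirac measures\<close>

lemma dirac_sum_eq_distr: "dirac_sum x = distr (count_space UNIV) borel x"
proof -
  have "(\<Sum>i. emeasure (dirac (x i)) A) = emeasure (count_space UNIV) (x -` A \<inter> space (count_space UNIV))"
    if "A \<in> sigma_sets UNIV (sets borel)" for A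
  proof -
    have A: "A \<in> sets borel" using that by (metis sets.sigma_sets_eq space_borel)
    have "emeasure (count_space UNIV) (x -` A) = (\<integral>\<^sup>+ i. indicator (x -` A) i \<partial>count_space UNIV)" by simp
    also have "\<dots> = (\<Sum>i. indicator (x -` A) i)" by (rule nn_integral_count_space_nat)
    also have "\<dots> = (\<Sum>i. emeasure (dirac (x i)) A)" using A by (simp add: dirac_def indicator_def)
    finally show ?thesis by simp
  qed
  then show ?thesis
    unfolding dirac_sum_def distr_def space_borel by (intro measure_of_eq) auto
qed

lemma configuration_locally_finite:
  assumes "dirac_sum x \<in> configuration_space"
  shows "finite {i. norm (x i) \<le> r}"
proof -
  have "emeasure (dirac_sum x) (cball 0 r) < \<infinity>"
    using assms by (auto simp: configuration_space_def)
  then have "emeasure (count_space UNIV) (x -` cball 0 r) < \<infinity>"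
    by (simp add: dirac_sum_eq_distr emeasure_distr)
  moreover have "x -` cball 0 r = {i. norm (x i) \<le> r}" by auto
  ultimately show ?thesis by (auto simp: emeasure_count_space split: if_splits)
qed

lemma measure_dist_dirac: "measure_dist (dirac y) = (\<lambda>f\<in>test_functions. f y)"
  unfolding measure_dist_def dirac_def
  by (intro restrict_ext integral_return) (auto intro: smooth_measurable test_functions_smooth)

lemma measure_dist_dirac_sum:
  assumes f: "f \<in> test_functions" and A: "finite A" "\<And>i. f (x i) \<noteq> 0 \<Longrightarrow> i \<in> A"
  shows "measure_dist (dirac_sum x) f = (\<Sum>i\<in>A. f (x i))"
proof -
  have m: "f \<in> borel_measurable borel" using f by (intro smooth_measurable test_functions_smooth)
  have "measure_dist (dirac_sum x) f = (\<integral>i. f (x i) \<partial>count_space UNIV)"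
    using f m by (simp add: measure_dist_def dirac_sum_eq_distr integral_distr)
  also have "\<dots> = (\<Sum>i | i \<in> UNIV \<and> f (x i) \<noteq> 0. f (x i))"
    by (rule lebesgue_integral_count_space_finite_support) (use A in \<open>auto intro: finite_subset\<close>)
  also have "\<dots> = (\<Sum>i\<in>A. f (x i))"
    by (rule sum.mono_neutral_left) (use A in auto)
  finally show ?thesis .
qed

section \<open>Functionals attached to a locally finite sequence\<close>

text \<open>Sequences of points with finitely many terms in each ball.\<close>

locale locally_finite_sequence =
  fixes x :: "nat \<Rightarrow> real^'d"
  assumes fin: "\<And>r. finite {i. norm (x i) \<le> r}"
begin

lemma finite_support:
  assumes "f \<in> test_functions" shows "finite {i. f (x i) \<noteq> 0}"
proof -
  obtain R where "\<And>y. norm y > R \<Longrightarrow> f y = 0" using test_functions_boundE[OF assms] by blast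
  then have "{i. f (x i) \<noteq> 0} \<subseteq> {i. norm (x i) \<le> R}" by (auto simp: not_less[symmetric])
  then show ?thesis using fin finite_subset by blast
qed

lemma measure_dist_distribution: "measure_dist (dirac_sum x) \<in> distributions"
proof -
  obtain C \<phi> l where C: "C \<ge> 0" "\<phi> \<in> weights"
    "\<And>f J. f \<in> test_functions \<Longrightarrow> finite J \<Longrightarrow> (\<Sum>i\<in>J. \<bar>f (x i)\<bar>) \<le> C * H_norm l \<phi> f"
    using configuration_bound[of x, OF fin] by blast
  have eq: "measure_dist (dirac_sum x) f = (\<Sum>i\<in>A. f (x i))" if "f \<in> test_functions" "finite A" "{i. f (x i) \<noteq> 0} \<subseteq> A" for f A
    using that by (intro measure_dist_dirac_sum) auto
  show ?thesis
    unfolding distributions_def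
  proof (rule continuous_dualI[of H_norm, OF H_norm_0 _ _ _ _ C(2,1)])
    show "measure_dist (dirac_sum x) \<in> extensional test_functions" by (simp add: measure_dist_def)
    show "measure_dist (dirac_sum x) (\<lambda>y. f y + g y) = measure_dist (dirac_sum x) f + measure_dist (dirac_sum x) g"
      if "f \<in> test_functions" "g \<in> test_functions" for f g
    proof -
      let ?A = "{i. f (x i) \<noteq> 0} \<union> {i. g (x i) \<noteq> 0}"
      have A: "finite ?A" using that finite_support by blast
      show ?thesis
      proof -
        have "{i. f (x i) + g (x i) \<noteq> 0} \<subseteq> ?A" by auto
        from eq[OF test_functions_add[OF that] A this] eq[OF that(1) A] eq[OF that(2) A] show ?thesis
          by (simp add: sum.distrib)
      qed
    qed
    show "measure_dist (dirac_sum x) (\<lambda>y. c * f y) = c * measure_dist (dirac_sum x) f" if "f \<in> test_functions" for c f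
    proof -
      have A: "finite {i. f (x i) \<noteq> 0}" using that finite_support by blast
      show ?thesis
        using eq[OF test_functions_cmult[OF that] A] eq[OF that A] by (auto simp: sum_distrib_left)
    qed
    show "\<bar>measure_dist (dirac_sum x) f\<bar> \<le> C * H_norm l \<phi> f" if "f \<in> test_functions" for f
      unfolding eq[OF that finite_support[OF that] subset_refl]
      by (rule order_trans[OF sum_abs C(3)[OF that finite_support[OF that]]])
  qed (rule test_functions_diff)
qed

lemma falling_gf_nth:
  assumes \<xi>: "\<xi> \<in> test_functions"
  shows "fps_nth (falling_gf (measure_dist (dirac_sum x)) \<xi>) n
    = (\<Sum>I | I \<subseteq> {i. \<xi> (x i) \<noteq> 0} \<and> card I = n. \<Prod>i\<in>I. \<xi> (x i))"
proof -
  let ?A = "{i. \<xi> (x i) \<noteq> 0}"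
  have A: "finite ?A" by (rule finite_support[OF \<xi>])
  have "measure_dist (dirac_sum x) (\<lambda>y. \<xi> y ^ k) = (\<Sum>i\<in>?A. \<xi> (x i) ^ k)" if "k > 0" for k
    using that by (intro measure_dist_dirac_sum test_functions_power \<xi> A) auto
  then have "falling_gf (measure_dist (dirac_sum x)) \<xi> = (\<Prod>i\<in>?A. 1 + fps_const (\<xi> (x i)) * fps_X)"
    unfolding falling_gf_def exp_log_series_eq_prod[OF A, symmetric]
    by (intro arg_cong[where f = "fps_compose (fps_exp 1)"] arg_cong[where f = Abs_fps]) auto
  then show ?thesis by (simp add: prod_one_plus_nth[OF A])
qed

lemma evaluation_distribution:
  fixes e :: "'n::finite \<Rightarrow> nat"
  shows "(\<lambda>f\<in>test_functions. f (\<chi> j. x (e j))) \<in> (tensor_distributions :: (((real^'d)^'n \<Rightarrow> real) \<Rightarrow> real) set)"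
proof -
  obtain C \<phi> l where C: "C \<ge> 0" "\<phi> \<in> weights"
    "\<And>f (E :: ('n \<Rightarrow> nat) set). f \<in> test_functions \<Longrightarrow> finite E \<Longrightarrow> (\<Sum>e\<in>E. \<bar>f (\<chi> j. x (e j))\<bar>) \<le> C * H_tensor_norm l \<phi> f"
    using configuration_tensor_bound[of x, OF fin] by blast
  show ?thesis
    unfolding tensor_distributions_def
  proof (rule continuous_dualI[of H_tensor_norm, OF H_tensor_norm_0 _ _ _ _ C(2,1)])
    show "\<bar>(\<lambda>f\<in>test_functions. f (\<chi> j. x (e j))) f\<bar> \<le> C * H_tensor_norm l \<phi> f" if "f \<in> test_functions" for f
      using C(3)[OF that, of "{e}"] that by simp
  qed (auto simp: test_functions_add test_functions_cmult test_functions_diff)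
qed

text \<open>The tensor product of Dirac distributions is evaluation at the point with the given blocks.\<close>

lemma dist_tensor_dirac:
  fixes e :: "'n::finite \<Rightarrow> nat"
  shows "dist_tensor (\<lambda>j. measure_dist (dirac (x (e j)))) = (\<lambda>f\<in>test_functions. f (\<chi> j. x (e j)))"
  unfolding dist_tensor_def
proof (rule the_equality)
  show 1: "(\<lambda>f\<in>test_functions. f (\<chi> j. x (e j))) \<in> tensor_distributions \<and>
    (\<forall>\<xi>. (\<forall>i. \<xi> i \<in> test_functions) \<longrightarrow> (\<lambda>f\<in>test_functions. f (\<chi> j. x (e j))) (fun_tensor \<xi>) =
      (\<Prod>i\<in>UNIV. measure_dist (dirac (x (e i))) (\<xi> i)))"
    using evaluation_distribution[of e] by (auto simp: fun_tensor_test measure_dist_dirac) (simp add: fun_tensor_def)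
  fix T assume "T \<in> tensor_distributions \<and> (\<forall>\<xi>. (\<forall>i. \<xi> i \<in> test_functions) \<longrightarrow>
     T (fun_tensor \<xi>) = (\<Prod>i\<in>UNIV. measure_dist (dirac (x (e i))) (\<xi> i)))"
  with 1 show "T = (\<lambda>f\<in>test_functions. f (\<chi> j. x (e j)))"
    by (intro tensor_distributions_eqI) auto
qed

lemma dist_sym_tensor_dirac:
  fixes e :: "'n::finite \<Rightarrow> nat"
  assumes f: "f \<in> sym_test_functions"
  shows "dist_sym_tensor (\<lambda>j. measure_dist (dirac (x (e j)))) f = f (\<chi> j. x (e j))"
proof -
  have ft: "f \<in> test_functions" and sym: "symmetric_function f" using f by (auto simp: sym_test_functions_def)
  have "dist_tensor (\<lambda>i. measure_dist (dirac (x (e (\<sigma> i))))) f = f (\<chi> j. x (e j))" if "\<sigma> permutes UNIV" for \<sigma>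
  proof -
    have "f (\<chi> j. x (e (\<sigma> j))) = f (\<chi> j. x (e j))"
      using sym[unfolded symmetric_function_def, rule_format, OF that, of "\<chi> j. x (e j)"] by simp
    then show ?thesis using dist_tensor_dirac[of "\<lambda>i. e (\<sigma> i)"] ft by simp
  qed
  then show ?thesis
    using f by (simp add: dist_sym_tensor_def card_perms)
qed

text \<open>The point of \<open>(\<real>\<^sup>d)\<^sup>n\<close> formed by the terms with index in \<open>I\<close>, ordered by the chosen numbering of \<open>I\<close>.\<close>

definition config_point :: "nat set \<Rightarrow> (real^'d)^'n" where
  "config_point I = (\<chi> j. x (numbering I j))"

lemma numbering_bij:
  assumes "finite I" "card I = CARD('n::finite)" shows "bij_betw (numbering I :: 'n \<Rightarrow> nat) UNIV I"
proof -
  have "\<exists>e :: 'n \<Rightarrow> nat. bij_betw e UNIV I" using assms by (intro finite_same_card_bij) auto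
  then show ?thesis unfolding numbering_def by (rule someI_ex)
qed

text \<open>The sets of \<open>n\<close> natural numbers, where \<open>n\<close> is the cardinality of the type argument.\<close>

definition subsets_of_card :: "'n itself \<Rightarrow> nat set set" where
  "subsets_of_card _ = {I. finite I \<and> card I = CARD('n)}"

lemma finite_config_support:
  fixes f :: "(real^'d)^'n \<Rightarrow> real"
  assumes "f \<in> test_functions"
  shows "finite {I \<in> subsets_of_card TYPE('n). f (config_point I) \<noteq> 0}"
proof -
  obtain R where R: "\<And>y. norm y > R \<Longrightarrow> f y = 0" using test_functions_boundE[OF assms] by blast
  have "I \<subseteq> {i. norm (x i) \<le> R}" if I: "I \<in> subsets_of_card TYPE('n)" "f (config_point I) \<noteq> 0" for I
  proof
    fix i assume "i \<in> I"
    moreover have "bij_betw (numbering I :: 'n \<Rightarrow> nat) UNIV I" using I by (intro numbering_bij) (auto simp: subsets_of_card_def)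
    ultimately obtain j :: 'n where j: "i = numbering I j" by (auto simp: bij_betw_def)
    have "norm (config_point I :: (real^'d)^'n) \<le> R" using R I(2) by (meson not_less)
    moreover have "norm ((config_point I :: (real^'d)^'n) $ j) \<le> norm (config_point I :: (real^'d)^'n)"
      by (rule Finite_Cartesian_Product.norm_nth_le)
    ultimately show "i \<in> {i. norm (x i) \<le> R}" by (simp add: config_point_def j)
  qed
  then have "{I \<in> subsets_of_card TYPE('n). f (config_point I) \<noteq> 0} \<subseteq> Pow {i. norm (x i) \<le> R}" by blast
  then show ?thesis using fin finite_subset by blast
qed

text \<open>The candidate for the binomial coefficient: the sum of \<open>f (x\<^sub>I)\<close> over all sets \<open>I\<close> of indices with \<open>n\<close>
  elements.\<close>

definition config_sum :: "((real^'d)^'n \<Rightarrow> real) \<Rightarrow> real" where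
  "config_sum f = (\<Sum>\<^sub>\<infinity>I\<in>subsets_of_card TYPE('n). f (config_point I))"

lemma config_sum_eq:
  fixes f :: "(real^'d)^'n \<Rightarrow> real"
  assumes "finite A" "A \<subseteq> subsets_of_card TYPE('n)"
    "\<And>I. I \<in> subsets_of_card TYPE('n) \<Longrightarrow> f (config_point I) \<noteq> 0 \<Longrightarrow> I \<in> A"
  shows "config_sum f = (\<Sum>I\<in>A. f (config_point I))"
proof -
  have "config_sum f = (\<Sum>\<^sub>\<infinity>I\<in>A. f (config_point I))"
    unfolding config_sum_def using assms by (intro infsum_cong_neutral) auto
  then show ?thesis using assms(1) by simp
qed

lemma config_sum_distribution:
  "(\<lambda>f\<in>sym_test_functions. c * config_sum f) \<in> (sym_tensor_distributions :: (((real^'d)^'n \<Rightarrow> real) \<Rightarrow> real) set)"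
proof -
  obtain C \<phi> l where C: "C \<ge> 0" "\<phi> \<in> weights"
    "\<And>f (E :: ('n \<Rightarrow> nat) set). f \<in> test_functions \<Longrightarrow> finite E \<Longrightarrow> (\<Sum>e\<in>E. \<bar>f (\<chi> j. x (e j))\<bar>) \<le> C * H_tensor_norm l \<phi> f"
    using configuration_tensor_bound[of x, OF fin] by blast
  have C': "\<bar>c\<bar> * C \<ge> 0" using C by simp
  let ?S = "subsets_of_card TYPE('n)"
  have t: "f \<in> test_functions" if "f \<in> sym_test_functions" for f :: "(real^'d)^'n \<Rightarrow> real"
    using that by (simp add: sym_test_functions_def)
  show ?thesis
    unfolding sym_tensor_distributions_def
  proof (rule continuous_dualI[of H_tensor_norm, OF H_tensor_norm_0 _ _ _ _ C(2) C'])
    fix f g :: "(real^'d)^'n \<Rightarrow> real" assume f: "f \<in> sym_test_functions" and g: "g \<in> sym_test_functions"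
    let ?A = "{I \<in> ?S. f (config_point I) \<noteq> 0} \<union> {I \<in> ?S. g (config_point I) \<noteq> 0}"
    have A: "finite ?A" using t[OF f] t[OF g] finite_config_support by blast
    have "config_sum (\<lambda>y. f y + g y) = (\<Sum>I\<in>?A. f (config_point I) + g (config_point I))"
      by (rule config_sum_eq[OF A]) auto
    moreover have "config_sum f = (\<Sum>I\<in>?A. f (config_point I))" by (rule config_sum_eq[OF A]) auto
    moreover have "config_sum g = (\<Sum>I\<in>?A. g (config_point I))" by (rule config_sum_eq[OF A]) auto
    ultimately have "config_sum (\<lambda>y. f y + g y) = config_sum f + config_sum g" by (simp add: sum.distrib)
    then show "(\<lambda>f\<in>sym_test_functions. c * config_sum f) (\<lambda>y. f y + g y) =
      (\<lambda>f\<in>sym_test_functions. c * config_sum f) f + (\<lambda>f\<in>sym_test_functions. c * config_sum f) g"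
      using f g by (simp add: sym_test_functions_add distrib_left)
  next
    fix a and f :: "(real^'d)^'n \<Rightarrow> real" assume f: "f \<in> sym_test_functions"
    have "config_sum (\<lambda>y. a * f y) = a * config_sum f"
      unfolding config_sum_def by (rule infsum_cmult_right')
    then show "(\<lambda>f\<in>sym_test_functions. c * config_sum f) (\<lambda>y. a * f y) = a * (\<lambda>f\<in>sym_test_functions. c * config_sum f) f"
      using f by (simp add: sym_test_functions_cmult)
  next
    fix f :: "(real^'d)^'n \<Rightarrow> real" assume f: "f \<in> sym_test_functions"
    let ?A = "{I \<in> ?S. f (config_point I) \<noteq> 0}"
    let ?num = "numbering :: nat set \<Rightarrow> 'n \<Rightarrow> nat"
    have A: "finite ?A" by (rule finite_config_support[OF t[OF f]])
    \<comment> \<open>distinct index sets have distinct numberings, so the sum is one over index maps\<close>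
  have "inj_on ?num ?S"
    proof (rule inj_onI)
      fix I J assume IJ: "I \<in> ?S" "J \<in> ?S" "?num I = ?num J"
      have "bij_betw (?num I) UNIV I" "bij_betw (?num J) UNIV J"
        using IJ(1,2) by (auto intro!: numbering_bij simp: subsets_of_card_def)
      then show "I = J" using IJ(3) by (simp add: bij_betw_def)
    qed
    then have inj: "inj_on ?num ?A" by (rule inj_on_subset) auto
    have "\<bar>config_sum f\<bar> \<le> (\<Sum>I\<in>?A. \<bar>f (config_point I)\<bar>)"
      by (subst config_sum_eq[OF A]) (auto intro: sum_abs)
    also have "\<dots> = (\<Sum>e\<in>?num ` ?A. \<bar>f (\<chi> j. x (e j))\<bar>)"
      unfolding sum.reindex[OF inj] by (simp add: o_def config_point_def)
    also have "\<dots> \<le> C * H_tensor_norm l \<phi> f" using A by (intro C(3) t f) auto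
    finally have "\<bar>c\<bar> * \<bar>config_sum f\<bar> \<le> \<bar>c\<bar> * (C * H_tensor_norm l \<phi> f)" by (rule mult_left_mono) simp
    then show "\<bar>(\<lambda>f\<in>sym_test_functions. c * config_sum f) f\<bar> \<le> \<bar>c\<bar> * C * H_tensor_norm l \<phi> f"
      using f by (simp add: abs_mult mult.assoc)
  qed (auto intro: sym_test_functions_diff)
qed

lemma config_sum_diagonal:
  assumes \<xi>: "\<xi> \<in> test_functions"
  shows "config_sum (fun_tensor (\<lambda>_. \<xi>) :: (real^'d)^'n \<Rightarrow> real) =
    fps_nth (falling_gf (measure_dist (dirac_sum x)) \<xi>) CARD('n)"
proof -
  let ?Z = "{i. \<xi> (x i) \<noteq> 0}" and ?A = "{I. I \<subseteq> {i. \<xi> (x i) \<noteq> 0} \<and> card I = CARD('n)}"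
  have Z: "finite ?Z" by (rule finite_support[OF \<xi>])
  then have A: "finite ?A" by (intro finite_subset[of ?A "Pow ?Z"]) auto
  have pr: "fun_tensor (\<lambda>_. \<xi>) (config_point I :: (real^'d)^'n) = (\<Prod>i\<in>I. \<xi> (x i))" if "I \<in> subsets_of_card TYPE('n)" for I
  proof -
    have "bij_betw (numbering I :: 'n \<Rightarrow> nat) UNIV I" using that by (intro numbering_bij) (auto simp: subsets_of_card_def)
    from prod.reindex_bij_betw[OF this, of "\<lambda>i. \<xi> (x i)"] show ?thesis by (simp add: fun_tensor_def config_point_def)
  qed
  have sub: "?A \<subseteq> subsets_of_card TYPE('n)" using Z finite_subset by (auto simp: subsets_of_card_def)
  have "config_sum (fun_tensor (\<lambda>_. \<xi>) :: (real^'d)^'n \<Rightarrow> real) = (\<Sum>I\<in>?A. fun_tensor (\<lambda>_. \<xi>) (config_point I :: (real^'d)^'n))"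
  proof (rule config_sum_eq[OF A sub])
    fix I assume I: "I \<in> subsets_of_card TYPE('n)" "fun_tensor (\<lambda>_. \<xi>) (config_point I :: (real^'d)^'n) \<noteq> 0"
    then have "(\<Prod>i\<in>I. \<xi> (x i)) \<noteq> 0" "finite I" "card I = CARD('n)" by (auto simp: pr subsets_of_card_def)
    then show "I \<in> ?A" by auto
  qed
  also have "\<dots> = (\<Sum>I\<in>?A. \<Prod>i\<in>I. \<xi> (x i))" using sub by (intro sum.cong) (auto simp: pr)
  finally show ?thesis by (simp add: falling_gf_nth[OF \<xi>])
qed

lemma falling_factorial_configuration:
  "(falling_factorial (measure_dist (dirac_sum x)) :: ((real^'d)^'n \<Rightarrow> real) \<Rightarrow> real) =
    (\<lambda>f\<in>sym_test_functions. fact CARD('n) * config_sum f)"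
proof -
  let ?F = "(\<lambda>f\<in>sym_test_functions. fact CARD('n) * config_sum f) :: ((real^'d)^'n \<Rightarrow> real) \<Rightarrow> real"
  have 1: "?F \<in> sym_tensor_distributions \<and> (\<forall>\<xi>\<in>test_functions. ?F (fun_tensor (\<lambda>_. \<xi>)) / fact CARD('n) =
      fps_nth (falling_gf (measure_dist (dirac_sum x)) \<xi>) CARD('n))"
    using config_sum_distribution by (auto simp: fun_tensor_diagonal_sym config_sum_diagonal)
  have "(THE F. F \<in> sym_tensor_distributions \<and> (\<forall>\<xi>\<in>test_functions. F (fun_tensor (\<lambda>_. \<xi>)) / fact CARD('n) =
      fps_nth (falling_gf (measure_dist (dirac_sum x)) \<xi>) CARD('n))) = ?F"
  proof (rule the_equality[where P = "\<lambda>F. F \<in> sym_tensor_distributions \<and> (\<forall>\<xi>\<in>test_functions. F (fun_tensor (\<lambda>_. \<xi>)) / fact CARD('n) =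
      fps_nth (falling_gf (measure_dist (dirac_sum x)) \<xi>) CARD('n))", OF 1])
    fix F :: "((real^'d)^'n \<Rightarrow> real) \<Rightarrow> real"
    assume F: "F \<in> sym_tensor_distributions \<and> (\<forall>\<xi>\<in>test_functions. F (fun_tensor (\<lambda>_. \<xi>)) / fact CARD('n) =
      fps_nth (falling_gf (measure_dist (dirac_sum x)) \<xi>) CARD('n))"
    show "F = ?F"
    proof (rule sym_tensor_distributions_eqI)
      fix \<xi> :: "real^'d \<Rightarrow> real" assume \<xi>: "\<xi> \<in> test_functions"
      then have "F (fun_tensor (\<lambda>_. \<xi>)) / fact CARD('n) = ?F (fun_tensor (\<lambda>_. \<xi>)) / fact CARD('n)"
        using 1 F by simp
      then show "F (fun_tensor (\<lambda>_. \<xi>)) = ?F (fun_tensor (\<lambda>_. \<xi>))" by simp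
    qed (use 1 F in auto)
  qed
  then show ?thesis
    using measure_dist_distribution by (simp add: falling_factorial_def)
qed

end

theorem corollary5p6:
  fixes \<gamma> :: "(real^'d) measure" and x :: "nat \<Rightarrow> real^'d"
  assumes "\<gamma> \<in> configuration_space" and "inj x" and "\<gamma> = dirac_sum x"
  shows "(dist_binomial (measure_dist \<gamma>) :: ((real^'d)^'n \<Rightarrow> real) \<Rightarrow> real) =
    (\<lambda>f\<in>sym_test_functions.
       \<Sum>\<^sub>\<infinity>I\<in>{I :: nat set. finite I \<and> card I = CARD('n)}.
         dist_sym_tensor (\<lambda>j :: 'n. measure_dist (dirac (x (numbering I j)))) f)"
proof -
  interpret locally_finite_sequence x
    by unfold_locales (use assms configuration_locally_finite in blast)
  have "dist_binomial (measure_dist \<gamma>) f = config_sum f" if "f \<in> sym_test_functions" for f :: "(real^'d)^'n \<Rightarrow> real"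
    using that by (simp add: dist_binomial_def assms(3) falling_factorial_configuration)
  moreover have "config_sum f = (\<Sum>\<^sub>\<infinity>I\<in>{I :: nat set. finite I \<and> card I = CARD('n)}.
         dist_sym_tensor (\<lambda>j :: 'n. measure_dist (dirac (x (numbering I j)))) f)"
    if "f \<in> sym_test_functions" for f :: "(real^'d)^'n \<Rightarrow> real"
    using that by (simp add: config_sum_def subsets_of_card_def config_point_def dist_sym_tensor_dirac)
  ultimately show ?thesis by (auto simp: dist_binomial_def fun_eq_iff)
qed

end
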